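(* Let $m,n$ be positive integers, $\mathcal{N}=[z^m-w^n]^\perp=H^2(\mathbb{D}^2)\ominus[z^m-w^n]$ and $S_z=P_{\mathcal{N}}T_z|_{\mathcal{N}}$. For $j=0,1,\dots,n-1$ and $\lambda\in\mathbb{D}$ set $$e_j(\lambda)=\frac{1}{1-\bar\lambda z}\,\frac{w^j}{1-\bar\lambda^m w^n}.$$ Then $S_z^*$ is a Cowen–Douglas operator over $\mathbb{D}$ with index $n$ (i.e. $S_z^*\in\mathfrak{B}_n(\mathbb{D})$), and $\{e_j(\lambda)\}_{j=0}^{n-1}$ is an orthogonal anti-holomorphic frame of $E_{S_z^*}$ over $\mathbb{D}$. Hence it gives a minimal reducing subspace decomposition of $S_z$: $$\mathcal{N}=\bigoplus_{j=0}^{n-1}\mathcal{H}_j,\qquad \mathcal{H}_j=\bigvee_{\lambda\in\mathbb{D}}e_j(\lambda),$$ that is, the $\mathcal{H}_j$ are mutually orthogonal minimal reducing subspaces of $S_z$. Moreover, the block diagonalization of the canonical connection on $E_{S_z^*}$ is $M(1,\otimes n)$, and $V^*(S_z)$ is isomorphic to $M_n(\mathbb{C})$.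
   Context: $H^2(\mathbb{D}^2)$ is the Hardy space over the bidisk, with coordinates $(z,w)$; $[p]$ is the closure of $p\,\mathbb{C}[z,w]$ in $H^2(\mathbb{D}^2)$; $T_z$ is multiplication by $z$; $P_{\mathcal{N}}$ is the orthogonal projection onto $\mathcal{N}$; $\bigvee$ is closed linear span. $V^*(T)=\{T,T^*\}'$ is the von Neumann algebra of operators commuting with $T$ and $T^*$. A reducing subspace is a closed subspace invariant under $T$ and $T^*$; it is minimal if the only reducing subspaces it contains are itself and $\{0\}$. $\mathfrak{B}_n(G)$, for $G\subset\mathbb{C}$ connected open, is the set of bounded operators $T$ on a separable Hilbert space $\mathcal{H}$ such that $\mathrm{Ran}(T-w)=\mathcal{H}$ for $w\in G$, $\bigvee_{w\in G}\mathrm{Ker}(T-w)=\mathcal{H}$, and $\dim\mathrm{Ker}(T-w)=n$ for all $w\in G$. By convention $E_{S_z^*}$ is viewed as the Hermitian anti-holomorphic vector bundle over $\mathbb{D}$ whose fibre at $\lambda$ is $\mathrm{Ker}(S_z-\lambda)^*=\mathrm{Ker}(S_z^*-\bar\lambda)$. Block diagonalization: for a Hermitian (anti-)holomorphic bundle $E$ of rank $n$ with its canonical metric-preserving connection $D$ and curvature $\mathcal{K}$, let $\mathcal{A}$ be the algebra of bundle maps generated by $\mathcal{K}$ and its covariant derivatives of all orders. For tuples of positive integers $\mathbf{n}=(n_1,\dots,n_r)$, $\mathbf{m}=(m_1,\dots,m_r)$, $M(\mathbf{n},\otimes\mathbf{m})$ is the algebra of matrices $A_1\otimes I_{m_1}\oplus\cdots\oplus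 A_r\otimes I_{m_r}$ with $A_i$ an arbitrary $n_i\times n_i$ matrix repeated $m_i$ times on the diagonal. Off a nowhere dense set, every point has a neighbourhood and a $C^\infty$ orthonormal frame $s$ on it such that $\mathcal{A}(s)(\lambda)$ (the algebra of matrices, relative to $s(\lambda)$, of the fibre maps induced by elements of $\mathcal{A}$) equals a fixed $M(\mathbf{n},\otimes\mathbf{m})$ throughout the neighbourhood and the connection matrix is $\Theta_1\otimes I_{m_1}\oplus\cdots\oplus\Theta_r\otimes I_{m_r}$ with $\Theta_i$ an $n_i\times n_i$ matrix of $1$-forms; "the block diagonalization is $M(\mathbf{n},\otimes\mathbf{m})$" refers to this algebra. $M(1,\otimes n)$ is the algebra of scalar $n\times n$ matrices. *)

theory Defs
  imports
    "HOL-Complex_Analysis.Complex_Analysis"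
    "Jordan_Normal_Form.Schur_Decomposition"
begin

section \<open>Complex inner product spaces\<close>

text \<open>The inner product is linear in the first argument. Completeness is not part of the
  class; it is required of the carrier (a closed subspace) wherever a Hilbert space is meant.\<close>

class complex_inner = real_inner +
  fixes scaleC :: "complex \<Rightarrow> 'a \<Rightarrow> 'a"  (infixr "*\<^sub>C" 75)
    and cinner :: "'a \<Rightarrow> 'a \<Rightarrow> complex"
  assumes scaleC_add_right: "a *\<^sub>C (x + y) = a *\<^sub>C x + a *\<^sub>C y"
    and scaleC_add_left: "(a + b) *\<^sub>C x = a *\<^sub>C x + b *\<^sub>C x"
    and scaleC_scaleC: "a *\<^sub>C (b *\<^sub>C x) = (a * b) *\<^sub>C x"
    and scaleR_eq_scaleC: "r *\<^sub>R x = complex_of_real r *\<^sub>C x"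
    and cinner_commute: "cinner x y = cnj (cinner y x)"
    and cinner_add_left: "cinner (x + y) z = cinner x z + cinner y z"
    and cinner_scaleC_left: "cinner (a *\<^sub>C x) y = a * cinner x y"
    and inner_eq_Re_cinner: "inner x y = Re (cinner x y)"

global_interpretation complex_vec: vector_space "scaleC :: complex \<Rightarrow> 'a \<Rightarrow> 'a::complex_inner"
  defines cdependent = complex_vec.dependent
    and csubspace = complex_vec.subspace
    and cspan = complex_vec.span
    and cdim = complex_vec.dim
proof unfold_locales
  show "1 *\<^sub>C x = x" for x :: 'a
    using scaleR_eq_scaleC[of 1 x] by simp
qed (auto simp: scaleC_add_right scaleC_add_left scaleC_scaleC)

instantiation complex :: complex_inner
begin
definition scaleC_complex :: "complex \<Rightarrow> complex \<Rightarrow> complex" where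
  "scaleC_complex a x = a * x"
definition cinner_complex :: "complex \<Rightarrow> complex \<Rightarrow> complex" where
  "cinner_complex x y = x * cnj y"
instance
  by standard
    (auto simp: scaleC_complex_def cinner_complex_def inner_complex_def algebra_simps
      scaleR_conv_of_real)
end

definition closed_cspan :: "'a::complex_inner set \<Rightarrow> 'a set" where
  "closed_cspan S = closure (cspan S)"

definition orth_compl :: "'a::complex_inner set \<Rightarrow> 'a set" where
  "orth_compl M = {x. \<forall>y\<in>M. cinner x y = 0}"

definition hilbert_subspace :: "'a::complex_inner set \<Rightarrow> bool" where
  "hilbert_subspace H \<longleftrightarrow> csubspace H \<and> complete H"

definition orth_proj :: "'a::complex_inner set \<Rightarrow> 'a \<Rightarrow> 'a" where
  "orth_proj H x = (THE y. y \<in> H \<and> (\<forall>v\<in>H. cinner (x - y) v = 0))"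


section \<open>Bounded operators on a closed subspace\<close>

text \<open>Operators on \<^term>\<open>H\<close> are extended by \<open>0\<close> outside \<^term>\<open>H\<close>, so that equality of
  operators is equality of functions.\<close>

definition bounded_ops :: "'a::complex_inner set \<Rightarrow> ('a \<Rightarrow> 'a) set" where
  "bounded_ops H = {T. (\<forall>x\<in>H. T x \<in> H) \<and> (\<forall>x. x \<notin> H \<longrightarrow> T x = 0)
     \<and> (\<forall>x\<in>H. \<forall>y\<in>H. T (x + y) = T x + T y)
     \<and> (\<forall>a. \<forall>x\<in>H. T (a *\<^sub>C x) = a *\<^sub>C T x)
     \<and> (\<exists>K. \<forall>x\<in>H. norm (T x) \<le> K * norm x)}"

definition adj :: "'a::complex_inner set \<Rightarrow> ('a \<Rightarrow> 'a) \<Rightarrow> 'a \<Rightarrow> 'a" where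
  "adj H T y = (if y \<in> H then THE z. z \<in> H \<and> (\<forall>x\<in>H. cinner (T x) y = cinner x z) else 0)"

definition compression :: "'a::complex_inner set \<Rightarrow> ('a \<Rightarrow> 'a) \<Rightarrow> 'a \<Rightarrow> 'a" where
  "compression H T x = (if x \<in> H then orth_proj H (T x) else 0)"

definition eigenspace :: "'a::complex_inner set \<Rightarrow> ('a \<Rightarrow> 'a) \<Rightarrow> complex \<Rightarrow> 'a set" where
  "eigenspace H T w = {x \<in> H. T x - w *\<^sub>C x = 0}"

definition reducing_subspace ::
    "'a::complex_inner set \<Rightarrow> ('a \<Rightarrow> 'a) \<Rightarrow> 'a set \<Rightarrow> bool" where
  "reducing_subspace H T M \<longleftrightarrow> M \<subseteq> H \<and> csubspace M \<and> closed M
     \<and> (\<forall>x\<in>M. T x \<in> M) \<and> (\<forall>x\<in>M. adj H T x \<in> M)"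

definition minimal_reducing_subspace ::
    "'a::complex_inner set \<Rightarrow> ('a \<Rightarrow> 'a) \<Rightarrow> 'a set \<Rightarrow> bool" where
  "minimal_reducing_subspace H T M \<longleftrightarrow> reducing_subspace H T M
     \<and> (\<forall>M'. reducing_subspace H T M' \<and> M' \<subseteq> M \<longrightarrow> M' = M \<or> M' = {0})"

definition commutant_vn :: "'a::complex_inner set \<Rightarrow> ('a \<Rightarrow> 'a) \<Rightarrow> ('a \<Rightarrow> 'a) set" where
  "commutant_vn H T =
     {A \<in> bounded_ops H. A \<circ> T = T \<circ> A \<and> A \<circ> adj H T = adj H T \<circ> A}"

text \<open>Isomorphism (as von Neumann algebras, i.e. *-isomorphism) of a set of operators on
  \<^term>\<open>H\<close> with the full matrix algebra.\<close>

definition star_isomorphic_matrices ::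
    "'a::complex_inner set \<Rightarrow> ('a \<Rightarrow> 'a) set \<Rightarrow> nat \<Rightarrow> bool" where
  "star_isomorphic_matrices H V n \<longleftrightarrow>
     (\<exists>\<Phi> :: complex mat \<Rightarrow> 'a \<Rightarrow> 'a. bij_betw \<Phi> (carrier_mat n n) V
       \<and> (\<forall>A\<in>carrier_mat n n. \<forall>B\<in>carrier_mat n n. \<Phi> (A + B) = (\<lambda>x. \<Phi> A x + \<Phi> B x))
       \<and> (\<forall>c. \<forall>A\<in>carrier_mat n n. \<Phi> (c \<cdot>\<^sub>m A) = (\<lambda>x. c *\<^sub>C \<Phi> A x))
       \<and> (\<forall>A\<in>carrier_mat n n. \<forall>B\<in>carrier_mat n n. \<Phi> (A * B) = \<Phi> A \<circ> \<Phi> B)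
       \<and> (\<forall>A\<in>carrier_mat n n. \<Phi> (mat_adjoint A) = adj H (\<Phi> A)))"

text \<open>The Cowen-Douglas class \<open>B\<^sub>n(G)\<close>. The condition \<open>0 < n\<close> makes
  \<^term>\<open>cdim\<close>\<open> = n\<close> express finite dimension (the library sets the dimension of an
  infinite-dimensional space to \<open>0\<close>).\<close>

definition cowen_douglas ::
    "nat \<Rightarrow> complex set \<Rightarrow> 'a::complex_inner set \<Rightarrow> ('a \<Rightarrow> 'a) \<Rightarrow> bool" where
  "cowen_douglas n G H T \<longleftrightarrow> 0 < n \<and> open G \<and> connected G
     \<and> hilbert_subspace H \<and> separable_space (top_of_set H) \<and> T \<in> bounded_ops H
     \<and> (\<forall>w\<in>G. (\<lambda>x. T x - w *\<^sub>C x) ` H = H)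
     \<and> closed_cspan (\<Union>w\<in>G. eigenspace H T w) = H
     \<and> (\<forall>w\<in>G. cdim (eigenspace H T w) = n)"


section \<open>Hermitian anti-holomorphic bundles and their canonical connection\<close>

text \<open>A bundle over an open set \<open>G\<close> is a family \<open>E\<close> of subspaces of a fixed inner product
  space; its Hermitian metric is the restriction of the inner product, and its smooth
  (anti-holomorphic) sections over \<open>U\<close> are the smooth (anti-holomorphic) vector-valued
  functions on \<open>U\<close> that take their values in the fibres.\<close>

fun Ck_on :: "nat \<Rightarrow> complex set \<Rightarrow> (complex \<Rightarrow> 'a::real_normed_vector) \<Rightarrow> bool" where
  "Ck_on 0 U f \<longleftrightarrow> continuous_on U f"
| "Ck_on (Suc k) U f \<longleftrightarrow> (\<exists>fx fy.
     (\<forall>\<mu>\<in>U. (f has_derivative (\<lambda>h. Re h *\<^sub>R fx \<mu> + Im h *\<^sub>R fy \<mu>)) (at \<mu>))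
     \<and> Ck_on k U fx \<and> Ck_on k U fy)"

definition smooth_on :: "complex set \<Rightarrow> (complex \<Rightarrow> 'a::real_normed_vector) \<Rightarrow> bool" where
  "smooth_on U f \<longleftrightarrow> (\<forall>k. Ck_on k U f)"

definition antiholomorphic_on :: "complex set \<Rightarrow> (complex \<Rightarrow> 'a::complex_inner) \<Rightarrow> bool" where
  "antiholomorphic_on U f \<longleftrightarrow>
     (\<forall>\<mu>\<in>U. \<exists>d. (f has_derivative (\<lambda>h. cnj h *\<^sub>C d)) (at \<mu>))"

text \<open>Wirtinger derivatives: the coefficients of \<open>d\<mu>\<close> and of its conjugate in \<open>df\<close>.\<close>

definition wirt :: "(complex \<Rightarrow> 'a::complex_inner) \<Rightarrow> complex \<Rightarrow> 'a" where
  "wirt f \<mu> = (1/2) *\<^sub>C (frechet_derivative f (at \<mu>) 1 - \<i> *\<^sub>C frechet_derivative f (at \<mu>) \<i>)"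

definition wirt_bar :: "(complex \<Rightarrow> 'a::complex_inner) \<Rightarrow> complex \<Rightarrow> 'a" where
  "wirt_bar f \<mu> = (1/2) *\<^sub>C (frechet_derivative f (at \<mu>) 1 + \<i> *\<^sub>C frechet_derivative f (at \<mu>) \<i>)"

definition smooth_section ::
    "complex set \<Rightarrow> (complex \<Rightarrow> 'a::complex_inner set) \<Rightarrow> (complex \<Rightarrow> 'a) \<Rightarrow> bool" where
  "smooth_section U E \<sigma> \<longleftrightarrow> smooth_on U \<sigma> \<and> (\<forall>\<mu>\<in>U. \<sigma> \<mu> \<in> E \<mu>)"

definition antiholomorphic_section ::
    "complex set \<Rightarrow> (complex \<Rightarrow> 'a::complex_inner set) \<Rightarrow> (complex \<Rightarrow> 'a) \<Rightarrow> bool" where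
  "antiholomorphic_section U E \<sigma> \<longleftrightarrow> antiholomorphic_on U \<sigma> \<and> (\<forall>\<mu>\<in>U. \<sigma> \<mu> \<in> E \<mu>)"

definition basis_family :: "nat \<Rightarrow> (nat \<Rightarrow> 'a::complex_inner) \<Rightarrow> 'a set \<Rightarrow> bool" where
  "basis_family n b V \<longleftrightarrow> inj_on b {..<n} \<and> \<not> cdependent (b ` {..<n}) \<and> cspan (b ` {..<n}) = V"

definition antiholomorphic_frame ::
    "nat \<Rightarrow> complex set \<Rightarrow> (complex \<Rightarrow> 'a::complex_inner set) \<Rightarrow> (nat \<Rightarrow> complex \<Rightarrow> 'a) \<Rightarrow> bool" where
  "antiholomorphic_frame n U E s \<longleftrightarrow>
     (\<forall>j<n. antiholomorphic_section U E (s j)) \<and> (\<forall>\<mu>\<in>U. basis_family n (\<lambda>j. s j \<mu>) (E \<mu>))"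

definition orthogonal_family ::
    "nat \<Rightarrow> complex set \<Rightarrow> (nat \<Rightarrow> complex \<Rightarrow> 'a::complex_inner) \<Rightarrow> bool" where
  "orthogonal_family n U s \<longleftrightarrow>
     (\<forall>\<mu>\<in>U. \<forall>i<n. \<forall>j<n. i \<noteq> j \<longrightarrow> cinner (s i \<mu>) (s j \<mu>) = 0)"

definition orthonormal_smooth_frame ::
    "nat \<Rightarrow> complex set \<Rightarrow> (complex \<Rightarrow> 'a::complex_inner set) \<Rightarrow> (nat \<Rightarrow> complex \<Rightarrow> 'a) \<Rightarrow> bool" where
  "orthonormal_smooth_frame n U E s \<longleftrightarrow>
     (\<forall>j<n. smooth_section U E (s j)) \<and> (\<forall>\<mu>\<in>U. basis_family n (\<lambda>j. s j \<mu>) (E \<mu>))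
     \<and> orthogonal_family n U s \<and> (\<forall>\<mu>\<in>U. \<forall>j<n. cinner (s j \<mu>) (s j \<mu>) = 1)"

definition antiholomorphic_bundle ::
    "nat \<Rightarrow> complex set \<Rightarrow> (complex \<Rightarrow> 'a::complex_inner set) \<Rightarrow> bool" where
  "antiholomorphic_bundle n G E \<longleftrightarrow> open G
     \<and> (\<forall>\<mu>\<in>G. \<exists>U s. open U \<and> \<mu> \<in> U \<and> U \<subseteq> G \<and> antiholomorphic_frame n U E s)"

text \<open>A connection \<open>D\<close> is given by the coefficients \<open>D1\<close>, \<open>D2\<close> of \<open>d\<mu>\<close> and of its conjugate.
  These are defined on all functions, but are only meaningful on smooth sections over open
  subsets of \<open>G\<close>; the third clause says that they are local.\<close>

type_synonym 'a section_op = "(complex \<Rightarrow> 'a) \<Rightarrow> complex \<Rightarrow> 'a"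

definition is_connection ::
    "complex set \<Rightarrow> (complex \<Rightarrow> 'a::complex_inner set) \<Rightarrow> 'a section_op \<Rightarrow> 'a section_op \<Rightarrow> bool" where
  "is_connection G E D1 D2 \<longleftrightarrow> (\<forall>U. open U \<and> U \<subseteq> G \<longrightarrow>
     (\<forall>\<sigma>. smooth_section U E \<sigma> \<longrightarrow>
        smooth_section U E (D1 \<sigma>) \<and> smooth_section U E (D2 \<sigma>))
     \<and> (\<forall>\<sigma> \<tau>. smooth_section U E \<sigma> \<and> smooth_section U E \<tau> \<longrightarrow> (\<forall>\<mu>\<in>U.
          D1 (\<lambda>\<nu>. \<sigma> \<nu> + \<tau> \<nu>) \<mu> = D1 \<sigma> \<mu> + D1 \<tau> \<mu>
          \<and> D2 (\<lambda>\<nu>. \<sigma> \<nu> + \<tau> \<nu>) \<mu> = D2 \<sigma> \<mu> + D2 \<tau> \<mu>))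
     \<and> (\<forall>\<sigma> \<tau>. smooth_section U E \<sigma> \<and> (\<forall>\<mu>\<in>U. \<sigma> \<mu> = \<tau> \<mu>) \<longrightarrow> (\<forall>\<mu>\<in>U.
          D1 \<sigma> \<mu> = D1 \<tau> \<mu> \<and> D2 \<sigma> \<mu> = D2 \<tau> \<mu>))
     \<and> (\<forall>(f :: complex \<Rightarrow> complex) \<sigma>. smooth_on U f \<and> smooth_section U E \<sigma> \<longrightarrow> (\<forall>\<mu>\<in>U.
          D1 (\<lambda>\<nu>. f \<nu> *\<^sub>C \<sigma> \<nu>) \<mu> = wirt f \<mu> *\<^sub>C \<sigma> \<mu> + f \<mu> *\<^sub>C D1 \<sigma> \<mu>
          \<and> D2 (\<lambda>\<nu>. f \<nu> *\<^sub>C \<sigma> \<nu>) \<mu> = wirt_bar f \<mu> *\<^sub>C \<sigma> \<mu> + f \<mu> *\<^sub>C D2 \<sigma> \<mu>)))"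

definition metric_preserving ::
    "complex set \<Rightarrow> (complex \<Rightarrow> 'a::complex_inner set) \<Rightarrow> 'a section_op \<Rightarrow> 'a section_op \<Rightarrow> bool" where
  "metric_preserving G E D1 D2 \<longleftrightarrow> (\<forall>U \<sigma> \<tau>. open U \<and> U \<subseteq> G
     \<and> smooth_section U E \<sigma> \<and> smooth_section U E \<tau> \<longrightarrow> (\<forall>\<mu>\<in>U.
        wirt (\<lambda>\<nu>. cinner (\<sigma> \<nu>) (\<tau> \<nu>)) \<mu> = cinner (D1 \<sigma> \<mu>) (\<tau> \<mu>) + cinner (\<sigma> \<mu>) (D2 \<tau> \<mu>)
        \<and> wirt_bar (\<lambda>\<nu>. cinner (\<sigma> \<nu>) (\<tau> \<nu>)) \<mu>
            = cinner (D2 \<sigma> \<mu>) (\<tau> \<mu>) + cinner (\<sigma> \<mu>) (D1 \<tau> \<mu>)))"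

text \<open>The canonical connection of a Hermitian anti-holomorphic bundle is the unique
  metric-preserving connection whose \<open>d\<mu>\<close>-part annihilates anti-holomorphic sections.\<close>

definition canonical_connection ::
    "complex set \<Rightarrow> (complex \<Rightarrow> 'a::complex_inner set) \<Rightarrow> 'a section_op \<Rightarrow> 'a section_op \<Rightarrow> bool" where
  "canonical_connection G E D1 D2 \<longleftrightarrow> is_connection G E D1 D2 \<and> metric_preserving G E D1 D2
     \<and> (\<forall>U \<sigma>. open U \<and> U \<subseteq> G \<and> antiholomorphic_section U E \<sigma> \<longrightarrow> (\<forall>\<mu>\<in>U. D1 \<sigma> \<mu> = 0))"

text \<open>The coefficient of \<open>d\<mu> \<and> d\<mu>\<^sup>*\<close> in \<open>D\<^sup>2\<close>.\<close>

definition curvature ::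
    "'a::complex_inner section_op \<Rightarrow> 'a section_op \<Rightarrow> 'a section_op" where
  "curvature D1 D2 \<sigma> \<mu> = D1 (D2 \<sigma>) \<mu> - D2 (D1 \<sigma>) \<mu>"

text \<open>Bundle maps are represented by their action on sections, so that the covariant
  derivatives of a bundle map are its commutators with \<open>D1\<close> and \<open>D2\<close>.\<close>

definition op_commutator ::
    "'a::complex_inner section_op \<Rightarrow> 'a section_op \<Rightarrow> 'a section_op" where
  "op_commutator D \<Phi> \<sigma> \<mu> = D (\<Phi> \<sigma>) \<mu> - \<Phi> (D \<sigma>) \<mu>"

inductive_set curvature_derivatives ::
    "'a::complex_inner section_op \<Rightarrow> 'a section_op \<Rightarrow> 'a section_op set"
  for D1 D2 :: "'a section_op" where
  "curvature D1 D2 \<in> curvature_derivatives D1 D2"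
| "\<Phi> \<in> curvature_derivatives D1 D2 \<Longrightarrow> op_commutator D1 \<Phi> \<in> curvature_derivatives D1 D2"
| "\<Phi> \<in> curvature_derivatives D1 D2 \<Longrightarrow> op_commutator D2 \<Phi> \<in> curvature_derivatives D1 D2"

text \<open>The generated algebra is unital, in accordance with the matrix algebras
  \<open>M(n, \<otimes>m)\<close>, which contain the identity.\<close>

inductive_set curvature_algebra ::
    "'a::complex_inner section_op \<Rightarrow> 'a section_op \<Rightarrow> 'a section_op set"
  for D1 D2 :: "'a section_op" where
  "\<Phi> \<in> curvature_derivatives D1 D2 \<Longrightarrow> \<Phi> \<in> curvature_algebra D1 D2"
| "(\<lambda>\<sigma>. \<sigma>) \<in> curvature_algebra D1 D2"
| "\<Phi> \<in> curvature_algebra D1 D2 \<Longrightarrow> \<Psi> \<in> curvature_algebra D1 D2 \<Longrightarrow>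
     (\<lambda>\<sigma> \<mu>. \<Phi> \<sigma> \<mu> + \<Psi> \<sigma> \<mu>) \<in> curvature_algebra D1 D2"
| "\<Phi> \<in> curvature_algebra D1 D2 \<Longrightarrow> (\<lambda>\<sigma> \<mu>. c *\<^sub>C \<Phi> \<sigma> \<mu>) \<in> curvature_algebra D1 D2"
| "\<Phi> \<in> curvature_algebra D1 D2 \<Longrightarrow> \<Psi> \<in> curvature_algebra D1 D2 \<Longrightarrow>
     (\<lambda>\<sigma>. \<Phi> (\<Psi> \<sigma>)) \<in> curvature_algebra D1 D2"

text \<open>\<open>A\<close> is the matrix at \<open>\<mu>\<close>, relative to the frame \<open>s\<close>, of a bundle map or of a
  coefficient of a connection.\<close>

definition frame_matrix ::
    "nat \<Rightarrow> (nat \<Rightarrow> complex \<Rightarrow> 'a::complex_inner) \<Rightarrow> complex \<Rightarrow> 'a section_op \<Rightarrow> complex mat \<Rightarrow> bool" where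
  "frame_matrix n s \<mu> \<Phi> A \<longleftrightarrow> A \<in> carrier_mat n n
     \<and> (\<forall>j<n. \<Phi> (s j) \<mu> = (\<Sum>i<n. A $$ (i, j) *\<^sub>C s i \<mu>))"

text \<open>The algebra \<open>M(ns, \<otimes>ms)\<close>: the \<open>k\<close>-th block, an arbitrary \<open>ns ! k \<times> ns ! k\<close> matrix, is
  repeated \<open>ms ! k\<close> times on the diagonal.\<close>

definition block_algebra :: "nat list \<Rightarrow> nat list \<Rightarrow> complex mat set" where
  "block_algebra ns ms = {diag_block_mat (concat (map2 replicate ms As)) | As.
     length As = length ns \<and> (\<forall>k<length ns. As ! k \<in> carrier_mat (ns ! k) (ns ! k))}"

definition block_diagonalization ::
    "complex set \<Rightarrow> (complex \<Rightarrow> 'a::complex_inner set) \<Rightarrow> nat list \<Rightarrow> nat list \<Rightarrow> bool" where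
  "block_diagonalization G E ns ms \<longleftrightarrow>
     length ns = length ms \<and> (\<forall>k\<in>set ns. 0 < k) \<and> (\<forall>k\<in>set ms. 0 < k)
     \<and> (let n = sum_list (map2 (*) ns ms) in
        antiholomorphic_bundle n G E
        \<and> (\<exists>D1 D2 Z. canonical_connection G E D1 D2 \<and> interior (closure Z) = {}
            \<and> (\<forall>\<mu>\<in>G - Z. \<exists>U s. open U \<and> \<mu> \<in> U \<and> U \<subseteq> G
                 \<and> orthonormal_smooth_frame n U E s
                 \<and> (\<forall>\<nu>\<in>U. {A. \<exists>\<Phi>\<in>curvature_algebra D1 D2. frame_matrix n s \<nu> \<Phi> A}
                            = block_algebra ns ms
                       \<and> (\<exists>\<Theta>1\<in>block_algebra ns ms. frame_matrix n s \<nu> D1 \<Theta>1)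
                       \<and> (\<exists>\<Theta>2\<in>block_algebra ns ms. frame_matrix n s \<nu> D2 \<Theta>2)))))"


section \<open>The Hardy space of the bidisk\<close>

abbreviation unit_disk :: "complex set"  ("\<D>") where
  "\<D> \<equiv> ball 0 1"

definition square_summable :: "(nat \<times> nat \<Rightarrow> complex) \<Rightarrow> bool" where
  "square_summable a \<longleftrightarrow> (\<lambda>p. (cmod (a p))\<^sup>2) summable_on UNIV"

definition taylor2 :: "(nat \<times> nat \<Rightarrow> complex) \<Rightarrow> (complex \<Rightarrow> complex \<Rightarrow> complex) \<Rightarrow> bool" where
  "taylor2 a f \<longleftrightarrow> (\<forall>z\<in>\<D>. \<forall>w\<in>\<D>. ((\<lambda>(i, j). a (i, j) * z ^ i * w ^ j) has_sum f z w) UNIV)"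

text \<open>Analytic functions on the bidisk with square-summable Taylor coefficients, extended by
  \<open>0\<close> outside the bidisk.\<close>

typedef hardy2 = "{f :: complex \<Rightarrow> complex \<Rightarrow> complex.
    (\<exists>a. square_summable a \<and> taylor2 a f) \<and> (\<forall>z w. z \<notin> \<D> \<or> w \<notin> \<D> \<longrightarrow> f z w = 0)}"
  morphisms h2_fun Abs_hardy2
  by (rule exI[of _ "\<lambda>_ _. 0"])
    (auto simp: square_summable_def taylor2_def case_prod_unfold intro!: exI[of _ "\<lambda>_. 0"])

setup_lifting type_definition_hardy2

definition coef :: "hardy2 \<Rightarrow> nat \<times> nat \<Rightarrow> complex" where
  "coef f = (THE a. square_summable a \<and> taylor2 a (h2_fun f))"

text \<open>The element of the Hardy space given by \<open>F\<close> on the bidisk.\<close>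

definition h2_of :: "(complex \<Rightarrow> complex \<Rightarrow> complex) \<Rightarrow> hardy2" where
  "h2_of F = Abs_hardy2 (\<lambda>z w. if z \<in> \<D> \<and> w \<in> \<D> then F z w else 0)"

lemma powser_unique_0:
  fixes a :: "nat \<Rightarrow> complex"
  assumes "\<And>z. z \<in> \<D> \<Longrightarrow> (\<lambda>i. a i * z ^ i) sums 0"
  shows "a i = 0"
proof (rule ccontr)
  assume nz: "a i \<noteq> 0"
  have "(\<lambda>i. a i * 0 ^ i) sums 0"
    by (rule assms) simp
  then have "a 0 = 0"
    using powser_sums_zero sums_unique2 by blast
  with nz have pos: "i > 0" by (cases i) auto
  have sums: "(\<lambda>i. a i * (z - 0) ^ i) sums 0" if "norm (z - 0) < 1" for z
    using assms[of z] that by simp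
  obtain s where s: "0 < s" "\<And>z. z \<in> cball (0::complex) s - {0} \<Longrightarrow> (0::complex) \<noteq> 0"
    by (rule powser_0_nonzero[where r = 1 and \<xi> = 0 and a = a and f = "\<lambda>_. 0" and m = i])
      (use sums nz pos in \<open>auto\<close>)
  have "complex_of_real s \<in> cball 0 s - {0}" using s(1) by simp
  from s(2)[OF this] show False by simp
qed

lemma taylor2_unique_0:
  assumes "taylor2 a (\<lambda>_ _. 0)"
  shows "a p = 0"
proof -
  obtain i j where p: "p = (i, j)" by (cases p)
  have hs: "((\<lambda>(i, j). a (i, j) * z ^ i * w ^ j) has_sum 0) (UNIV \<times> UNIV)"
    if "z \<in> \<D>" "w \<in> \<D>" for z w
    using assms that by (auto simp: taylor2_def)
  have inner_summable: "(\<lambda>j. a (i, j) * w ^ j) summable_on UNIV" if "w \<in> \<D>" for i w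
  proof -
    have "(\<lambda>(i, j). a (i, j) * (1/2) ^ i * w ^ j) summable_on (UNIV \<times> UNIV)"
      using hs[of "1/2" w] that unfolding summable_on_def by auto
    then have "(\<lambda>(i, j). a (i, j) * (1/2) ^ i * w ^ j) summable_on (Pair i ` UNIV)"
      by (rule summable_on_subset_banach) auto
    then have "(\<lambda>j. a (i, j) * (1/2) ^ i * w ^ j) summable_on UNIV"
      by (subst (asm) summable_on_reindex) (auto simp: inj_on_def o_def)
    then have "(\<lambda>j. (a (i, j) * (1/2) ^ i * w ^ j) * 2 ^ i) summable_on UNIV"
      by (rule summable_on_cmult_left)
    then show ?thesis
      by (simp add: power_one_over field_simps)
  qed
  have outer: "(\<Sum>\<^sub>\<infinity>j. a (i, j) * w ^ j) = 0" if w: "w \<in> \<D>" for i w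
  proof (rule powser_unique_0)
    fix z :: complex assume z: "z \<in> \<D>"
    have "((\<lambda>j. a (i, j) * z ^ i * w ^ j) has_sum (\<Sum>\<^sub>\<infinity>j. a (i, j) * w ^ j) * z ^ i) UNIV" for i
      using has_sum_cmult_left[OF has_sum_infsum[OF inner_summable[OF w, of i]], of "z ^ i"]
      by (simp add: mult_ac)
    then have "((\<lambda>i. (\<Sum>\<^sub>\<infinity>j. a (i, j) * w ^ j) * z ^ i) has_sum 0) UNIV"
      by (intro has_sum_SigmaD[OF hs[OF z w]]) auto
    then show "(\<lambda>i. (\<Sum>\<^sub>\<infinity>j. a (i, j) * w ^ j) * z ^ i) sums 0"
      by (rule has_sum_imp_sums)
  qed
  have "a (i, j) = 0"
  proof (rule powser_unique_0)
    fix w :: complex assume w: "w \<in> \<D>"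
    show "(\<lambda>j. a (i, j) * w ^ j) sums 0"
      using has_sum_imp_sums[OF has_sum_infsum[OF inner_summable[OF w, of i]]] outer[OF w] by simp
  qed
  with p show ?thesis by simp
qed

lemma taylor2_add:
  assumes "taylor2 a f" "taylor2 b g"
  shows "taylor2 (\<lambda>p. a p + b p) (\<lambda>z w. f z w + g z w)"
  unfolding taylor2_def
proof (intro ballI)
  fix z w assume "z \<in> \<D>" "w \<in> \<D>"
  then have "((\<lambda>p. (case p of (i, j) \<Rightarrow> a (i, j) * z ^ i * w ^ j)
      + (case p of (i, j) \<Rightarrow> b (i, j) * z ^ i * w ^ j)) has_sum f z w + g z w) UNIV"
    using assms unfolding taylor2_def by (intro has_sum_add) blast+
  then show "((\<lambda>(i, j). (a (i, j) + b (i, j)) * z ^ i * w ^ j) has_sum f z w + g z w) UNIV"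
    by (simp add: case_prod_unfold distrib_right)
qed

lemma taylor2_scale:
  assumes "taylor2 a f"
  shows "taylor2 (\<lambda>p. c * a p) (\<lambda>z w. c * f z w)"
  unfolding taylor2_def
proof (intro ballI)
  fix z w assume "z \<in> \<D>" "w \<in> \<D>"
  then have "((\<lambda>p. c * (case p of (i, j) \<Rightarrow> a (i, j) * z ^ i * w ^ j)) has_sum c * f z w) UNIV"
    using assms unfolding taylor2_def by (intro has_sum_cmult_right) blast
  then show "((\<lambda>(i, j). c * a (i, j) * z ^ i * w ^ j) has_sum c * f z w) UNIV"
    by (simp add: case_prod_unfold mult.assoc)
qed

lemma taylor2_unique:
  assumes "taylor2 a f" "taylor2 b f"
  shows "a = b"
proof
  fix p
  have "taylor2 (\<lambda>p. a p + (-1) * b p) (\<lambda>z w. f z w + (-1) * f z w)"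
    by (intro taylor2_add taylor2_scale assms)
  then have "taylor2 (\<lambda>p. a p + (-1) * b p) (\<lambda>_ _. 0)" by simp
  from taylor2_unique_0[OF this, of p] show "a p = b p" by simp
qed

lemma square_summable_add:
  assumes "square_summable a" "square_summable b"
  shows "square_summable (\<lambda>p. a p + b p)"
proof -
  have "(\<lambda>p. 2 * (cmod (a p))\<^sup>2 + 2 * (cmod (b p))\<^sup>2) summable_on UNIV"
    using assms unfolding square_summable_def
    by (intro summable_on_add summable_on_cmult_right)
  then show ?thesis unfolding square_summable_def
  proof (rule summable_on_comparison_test)
    fix p
    have "(cmod (a p + b p))\<^sup>2 \<le> (cmod (a p) + cmod (b p))\<^sup>2"
      by (intro power_mono norm_triangle_ineq) auto
    also have "\<dots> \<le> 2 * (cmod (a p))\<^sup>2 + 2 * (cmod (b p))\<^sup>2"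
      using sum_squares_bound[of "cmod (a p)" "cmod (b p)"] by (simp add: power2_sum)
    finally show "(cmod (a p + b p))\<^sup>2 \<le> 2 * (cmod (a p))\<^sup>2 + 2 * (cmod (b p))\<^sup>2" .
  qed auto
qed

lemma square_summable_scale: "square_summable a \<Longrightarrow> square_summable (\<lambda>p. c * a p)"
  unfolding square_summable_def norm_mult power_mult_distrib by (rule summable_on_cmult_right)

lemma square_summable_prod:
  assumes "square_summable a" "square_summable b"
  shows "(\<lambda>p. a p * cnj (b p)) summable_on UNIV"
proof (rule abs_summable_summable)
  have "(\<lambda>p. (cmod (a p))\<^sup>2 + (cmod (b p))\<^sup>2) summable_on UNIV"
    using assms unfolding square_summable_def by (intro summable_on_add)
  then show "(\<lambda>p. norm (a p * cnj (b p))) summable_on UNIV"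
  proof (rule summable_on_comparison_test)
    fix p
    have "2 * (cmod (a p) * cmod (b p)) \<le> (cmod (a p))\<^sup>2 + (cmod (b p))\<^sup>2"
      using sum_squares_bound[of "cmod (a p)" "cmod (b p)"] by simp
    moreover have "0 \<le> cmod (a p) * cmod (b p)" by simp
    ultimately have "cmod (a p) * cmod (b p) \<le> (cmod (a p))\<^sup>2 + (cmod (b p))\<^sup>2" by linarith
    then show "norm (a p * cnj (b p)) \<le> (cmod (a p))\<^sup>2 + (cmod (b p))\<^sup>2"
      by (simp add: norm_mult)
  qed auto
qed

lemma coef: "square_summable (coef f)" "taylor2 (coef f) (h2_fun f)"
proof -
  obtain a where a: "square_summable a \<and> taylor2 a (h2_fun f)"
    using h2_fun[of f] by auto
  have "square_summable (coef f) \<and> taylor2 (coef f) (h2_fun f)"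
    unfolding coef_def
    by (rule theI[where a = a]) (use a in \<open>auto dest: taylor2_unique\<close>)
  then show "square_summable (coef f)" "taylor2 (coef f) (h2_fun f)" by auto
qed

lemma coef_eqI: "taylor2 a (h2_fun f) \<Longrightarrow> coef f = a"
  by (rule taylor2_unique[OF coef(2)])

instantiation hardy2 :: complex_inner
begin

lift_definition zero_hardy2 :: hardy2 is "\<lambda>_ _. 0"
  by (auto simp: square_summable_def taylor2_def case_prod_unfold intro!: exI[of _ "\<lambda>_. 0"])

lift_definition plus_hardy2 :: "hardy2 \<Rightarrow> hardy2 \<Rightarrow> hardy2" is "\<lambda>f g z w. f z w + g z w"
  by (auto, blast intro: square_summable_add taylor2_add)

lift_definition scaleC_hardy2 :: "complex \<Rightarrow> hardy2 \<Rightarrow> hardy2" is "\<lambda>c f z w. c * f z w"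
  by (auto, blast intro: square_summable_scale taylor2_scale)

definition uminus_hardy2 :: "hardy2 \<Rightarrow> hardy2" where "uminus_hardy2 f = (-1) *\<^sub>C f"
definition minus_hardy2 :: "hardy2 \<Rightarrow> hardy2 \<Rightarrow> hardy2" where "minus_hardy2 f g = f + - (g::hardy2)"
definition scaleR_hardy2 :: "real \<Rightarrow> hardy2 \<Rightarrow> hardy2" where "scaleR_hardy2 r f = complex_of_real r *\<^sub>C f"
definition cinner_hardy2 :: "hardy2 \<Rightarrow> hardy2 \<Rightarrow> complex" where
  "cinner_hardy2 f g = (\<Sum>\<^sub>\<infinity>p. coef f p * cnj (coef g p))"
definition inner_hardy2 :: "hardy2 \<Rightarrow> hardy2 \<Rightarrow> real" where "inner_hardy2 f g = Re (cinner f g)"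
definition norm_hardy2 :: "hardy2 \<Rightarrow> real" where "norm_hardy2 f = sqrt (inner f f)"
definition sgn_hardy2 :: "hardy2 \<Rightarrow> hardy2" where "sgn_hardy2 f = inverse (norm f) *\<^sub>R f"
definition dist_hardy2 :: "hardy2 \<Rightarrow> hardy2 \<Rightarrow> real" where "dist_hardy2 f g = norm (f - g)"
definition uniformity_hardy2 :: "(hardy2 \<times> hardy2) filter" where
  "uniformity_hardy2 = (INF e\<in>{0<..}. principal {(f, g). dist f g < e})"
definition open_hardy2 :: "hardy2 set \<Rightarrow> bool" where
  "open_hardy2 U \<longleftrightarrow> (\<forall>f\<in>U. eventually (\<lambda>(f', g). f' = f \<longrightarrow> g \<in> U) uniformity)"

lemma coef_add: "coef (f + g) = (\<lambda>p. coef f p + coef g p)"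
  by (rule coef_eqI) (simp add: plus_hardy2.rep_eq taylor2_add coef)

lemma coef_scaleC: "coef (c *\<^sub>C f) = (\<lambda>p. c * coef f p)"
  by (rule coef_eqI) (simp add: scaleC_hardy2.rep_eq taylor2_scale coef)

lemma coef_zero: "coef 0 = (\<lambda>_. 0)"
  by (rule coef_eqI) (simp add: zero_hardy2.rep_eq taylor2_def case_prod_unfold)

lemma coef_inject:
  assumes "coef f = coef g"
  shows "f = g"
proof -
  have "h2_fun f z w = h2_fun g z w" for z w
  proof (cases "z \<in> \<D> \<and> w \<in> \<D>")
    case True
    with coef(2)[of f] have
      "((\<lambda>(i, j). coef g (i, j) * z ^ i * w ^ j) has_sum h2_fun f z w) UNIV"
      unfolding assms taylor2_def by blast
    moreover from True coef(2)[of g] have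
      "((\<lambda>(i, j). coef g (i, j) * z ^ i * w ^ j) has_sum h2_fun g z w) UNIV"
      unfolding taylor2_def by blast
    ultimately show ?thesis by (rule has_sum_unique)
  next
    case False
    then show ?thesis using h2_fun[of f] h2_fun[of g] by auto
  qed
  then have "h2_fun f = h2_fun g" by (intro ext)
  then show ?thesis by (simp add: h2_fun_inject)
qed

lemma cinner_self: "cinner f f = complex_of_real (\<Sum>\<^sub>\<infinity>p. (cmod (coef f p))\<^sup>2)" for f :: hardy2
proof -
  have "((\<lambda>p. complex_of_real ((cmod (coef f p))\<^sup>2)) has_sum
      complex_of_real (\<Sum>\<^sub>\<infinity>p. (cmod (coef f p))\<^sup>2)) UNIV"
    using coef(1)[of f] unfolding square_summable_def by (intro has_sum_of_real has_sum_infsum)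
  then show ?thesis
    unfolding cinner_hardy2_def
    by (intro infsumI) (simp only: complex_norm_square)
qed

instance
proof
  fix f g h :: hardy2 and a b :: complex and r s :: real
  have lin: "cinner (f + g) h = cinner f h + cinner g h" for f g h :: hardy2
    unfolding cinner_hardy2_def coef_add distrib_right
    by (intro infsum_add square_summable_prod coef)
  have scl: "cinner (a *\<^sub>C f) h = a * cinner f h" for a and f h :: hardy2
    unfolding cinner_hardy2_def coef_scaleC mult.assoc by (rule infsum_cmult_right')
  have comm: "cinner f g = cnj (cinner g f)" for f g :: hardy2
    unfolding cinner_hardy2_def by (subst infsum_cnj[symmetric]) (simp add: mult.commute)
  show "f + g + h = f + (g + h)" "f + g = g + f" "0 + f = f" "- f + f = 0"
    "a *\<^sub>C (f + g) = a *\<^sub>C f + a *\<^sub>C g" "(a + b) *\<^sub>C f = a *\<^sub>C f + b *\<^sub>C f"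
    "a *\<^sub>C b *\<^sub>C f = (a * b) *\<^sub>C f"
    "r *\<^sub>R (f + g) = r *\<^sub>R f + r *\<^sub>R g" "(r + s) *\<^sub>R f = r *\<^sub>R f + s *\<^sub>R f"
    "r *\<^sub>R s *\<^sub>R f = (r * s) *\<^sub>R f" "1 *\<^sub>R f = f"
    by (rule coef_inject, simp add: coef_add coef_scaleC coef_zero uminus_hardy2_def
        scaleR_hardy2_def algebra_simps)+
  show "inner f g = inner g f"
    unfolding inner_hardy2_def comm[of f g] by simp
  show "inner (f + g) h = inner f h + inner g h" "inner (r *\<^sub>R f) g = r * inner f g"
    by (simp_all add: inner_hardy2_def lin scl scaleR_hardy2_def)
  show "0 \<le> inner f f"
    by (simp add: inner_hardy2_def cinner_self infsum_nonneg)
  show "inner f f = 0 \<longleftrightarrow> f = 0"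
  proof
    assume "inner f f = 0"
    then have "(\<Sum>\<^sub>\<infinity>p. (cmod (coef f p))\<^sup>2) \<le> 0"
      by (simp add: inner_hardy2_def cinner_self)
    moreover have "(\<lambda>p. (cmod (coef f p))\<^sup>2) summable_on UNIV"
      using coef(1)[of f] by (simp add: square_summable_def)
    ultimately have "(cmod (coef f p))\<^sup>2 = 0" for p
      by (rule nonneg_infsum_le_0D) simp_all
    then have "coef f = (\<lambda>_. 0)" by (intro ext) simp
    then show "f = 0" by (intro coef_inject) (simp only: coef_zero)
  next
    assume "f = 0"
    then show "inner f f = 0" by (simp add: inner_hardy2_def cinner_hardy2_def coef_zero)
  qed
  show "cinner f g = cnj (cinner g f)" "cinner (f + g) h = cinner f h + cinner g h"
    "cinner (a *\<^sub>C f) g = a * cinner f g"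
    by (fact comm lin scl)+
qed (simp_all add: minus_hardy2_def scaleR_hardy2_def inner_hardy2_def norm_hardy2_def
      sgn_hardy2_def dist_hardy2_def uniformity_hardy2_def open_hardy2_def)

end

text \<open>\<open>\<complex>[z,w]\<close> is represented as \<open>\<complex>[z][w]\<close>.\<close>

type_synonym poly_zw = "complex poly poly"

definition var_z :: poly_zw where "var_z = [:[:0, 1:]:]"
definition var_w :: poly_zw where "var_w = [:0, 1:]"

definition eval_zw :: "poly_zw \<Rightarrow> complex \<Rightarrow> complex \<Rightarrow> complex" where
  "eval_zw p z w = poly (poly p [:w:]) z"

definition poly_submodule :: "poly_zw \<Rightarrow> hardy2 set"  ("[_]\<^sub>H") where
  "[p]\<^sub>H = closure {h2_of (eval_zw (p * q)) | q. True}"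

definition mult_z :: "hardy2 \<Rightarrow> hardy2" where
  "mult_z f = h2_of (\<lambda>z w. z * h2_fun f z w)"

definition quotient_N :: "nat \<Rightarrow> nat \<Rightarrow> hardy2 set" where
  "quotient_N m n = orth_compl [var_z ^ m - var_w ^ n]\<^sub>H"

definition S_z :: "nat \<Rightarrow> nat \<Rightarrow> hardy2 \<Rightarrow> hardy2" where
  "S_z m n = compression (quotient_N m n) mult_z"

text \<open>The adjoint \<open>S\<^sub>z\<^sup>*\<close> and its bundle, whose fibre at \<open>\<mu>\<close> is \<open>Ker (S\<^sub>z\<^sup>* - cnj \<mu>)\<close>.\<close>

definition S_z_adj :: "nat \<Rightarrow> nat \<Rightarrow> hardy2 \<Rightarrow> hardy2" where
  "S_z_adj m n = adj (quotient_N m n) (S_z m n)"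

definition bundle_S_z_adj :: "nat \<Rightarrow> nat \<Rightarrow> complex \<Rightarrow> hardy2 set" where
  "bundle_S_z_adj m n \<mu> = eigenspace (quotient_N m n) (S_z_adj m n) (cnj \<mu>)"

definition e_vec :: "nat \<Rightarrow> nat \<Rightarrow> nat \<Rightarrow> complex \<Rightarrow> hardy2" where
  "e_vec m n j \<mu> =
     h2_of (\<lambda>z w. 1 / (1 - cnj \<mu> * z) * (w ^ j / (1 - (cnj \<mu>) ^ m * w ^ n)))"

definition H_space :: "nat \<Rightarrow> nat \<Rightarrow> nat \<Rightarrow> hardy2 set" where
  "H_space m n j = closed_cspan (e_vec m n j ` \<D>)"

end

theory Submission
  imports Defs
begin

text \<open>Orthogonality to \<open>(z\<^sup>m - w\<^sup>n) z\<^sup>a w\<^sup>b\<close> says that the Taylor coefficient at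
  \<open>(i, j + n q)\<close>, with \<open>j < n\<close>, depends only on \<open>j\<close> and \<open>l = i + m q\<close>. Hence \<open>N\<close> is the
  orthogonal sum of \<open>n\<close> copies of one weighted sequence space, with weight \<open>d l\<close> the number of
  pairs \<open>(i, q)\<close> with \<open>i + m q = l\<close>. On each copy the adjoint of \<open>S\<^sub>z\<close> is the backward shift of
  the index \<open>l\<close> and \<open>S\<^sub>z\<close> is an injective weighted forward shift, so \<open>S\<^sub>z\<close> is an irreducible
  operator tensored with the identity of \<open>\<complex>\<^sup>n\<close>; this gives the eigenvectors, the minimal reducing
  subspaces and the commutant. The \<open>e\<^sub>j\<close> are orthogonal and, at each point, of equal norm;
  relative to such a frame the canonical connection, and hence every operator generated by its
  curvature, is scalar.\<close>

section \<open>Complex inner product spaces\<close>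

text \<open>\<open>S_z\<close> is defined through a projection, while its adjoint is the mere
  backward shift in \<open>z\<close> on Taylor coefficients. Facts on \<open>S_z\<close> are
  therefore obtained by pairing and moving it to the other side. The delicate point is the
  surjectivity of \<open>S_z_adj\<close> minus \<open>w\<close>. Solving the recurrence x(l+1) = w
  x(l) + f(l) is easy, but the solution must be square summable against \<open>d l\<close>, which is
  unbounded. The weight only records that the value at \<open>l\<close> is repeated at every
  \<open>(i, j + n q)\<close> with \<open>i + m q = l\<close>; along a row of fixed exponent of
  \<open>w\<close> the recurrence is unweighted. So the estimate is made row by row, and the initial
  values of the rows are controlled by one more use of it. For the connection, the bundle lies in a
  fixed space, so the two coefficients are the Wirtinger derivatives, the second one followed by
  projection to the fibre. Since elements of the curvature algebra are maps of sections and are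
  composed, scalarity has to be proved on all smooth sections over all open subsets, not only on the
  frame.\<close>

lemma scaleC_one [simp]: "1 *\<^sub>C x = x" and scaleC_zero_left [simp]: "0 *\<^sub>C x = 0"
  and scaleC_zero_right [simp]: "a *\<^sub>C 0 = 0"
  and scaleC_minus_left: "(- a) *\<^sub>C x = - (a *\<^sub>C x)"
  and scaleC_diff_left: "(a - b) *\<^sub>C x = a *\<^sub>C x - b *\<^sub>C x"
  and scaleC_diff_right: "a *\<^sub>C (x - y) = a *\<^sub>C x - a *\<^sub>C y"
  and scaleC_sum_right: "a *\<^sub>C sum g I = (\<Sum>i\<in>I. a *\<^sub>C g i)"
  for x y :: "'a::complex_inner"
  by (simp_all add: complex_vec.scale_left_diff_distrib complex_vec.scale_right_diff_distrib
      complex_vec.scale_sum_right)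

lemma cinner_add_right: "cinner x (y + z) = cinner x y + cinner x z"
  unfolding cinner_commute[of x] cinner_add_left by simp

lemma cinner_scaleC_right: "cinner x (a *\<^sub>C y) = cnj a * cinner x y"
  unfolding cinner_commute[of x] cinner_scaleC_left by simp

lemma cinner_zero_left [simp]: "cinner 0 y = 0" and cinner_zero_right [simp]: "cinner x 0 = 0"
  using cinner_scaleC_left[of 0 0 y] cinner_scaleC_right[of x 0 0] by simp_all

lemma cinner_minus_left: "cinner (- x) y = - cinner x y"
  and cinner_minus_right: "cinner x (- y) = - cinner x y"
  using cinner_add_left[of x "- x" y] cinner_add_right[of x y "- y"]
  by (simp_all add: eq_neg_iff_add_eq_0 add.commute)

lemma cinner_diff_left: "cinner (x - y) z = cinner x z - cinner y z"
  and cinner_diff_right: "cinner x (y - z) = cinner x y - cinner x z"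
  using cinner_add_left[of x "- y" z] cinner_add_right[of x y "- z"]
  by (simp_all add: cinner_minus_left cinner_minus_right)

lemma cinner_sum_left: "cinner (sum f I) y = (\<Sum>i\<in>I. cinner (f i) y)"
  by (induction I rule: infinite_finite_induct) (simp_all add: cinner_add_left)

lemma cinner_sum_right: "cinner x (sum f I) = (\<Sum>i\<in>I. cinner x (f i))"
  by (induction I rule: infinite_finite_induct) (simp_all add: cinner_add_right)

lemma cinner_self_norm: "cinner x x = of_real ((norm x)\<^sup>2)"
proof -
  have "Im (cinner x x) = 0"
    using arg_cong[OF cinner_commute[of x x], of Im] by simp
  moreover have "Re (cinner x x) = (norm x)\<^sup>2"
    by (simp add: inner_eq_Re_cinner[symmetric] power2_norm_eq_inner)
  ultimately show ?thesis by (simp add: complex_eq_iff)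
qed

lemma cinner_self_eq_0_iff [simp]: "cinner x x = 0 \<longleftrightarrow> x = 0"
  by (simp add: cinner_self_norm)

lemma cinner_zero_commute: "cinner x y = 0 \<longleftrightarrow> cinner y x = 0"
proof -
  have "cnj (cinner y x) = 0 \<longleftrightarrow> cinner y x = 0" by simp
  then show ?thesis unfolding cinner_commute[of x y] .
qed

lemma norm_scaleC: "norm (a *\<^sub>C x) = cmod a * norm x"
proof -
  have "complex_of_real ((norm (a *\<^sub>C x))\<^sup>2) = of_real ((cmod a * norm x)\<^sup>2)"
    unfolding cinner_self_norm[symmetric] cinner_scaleC_left cinner_scaleC_right power_mult_distrib of_real_mult
    unfolding cinner_self_norm complex_norm_square by (simp add: mult_ac)
  then have "(norm (a *\<^sub>C x))\<^sup>2 = (cmod a * norm x)\<^sup>2"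
    using of_real_eq_iff by blast
  then show ?thesis by (simp add: power2_eq_iff_nonneg)
qed

text \<open>Multiplying \<open>x\<close> by the unimodular \<open>a\<close> makes the complex inner
  product real and equal to its modulus, so the real Cauchy-Schwarz inequality applies.\<close>

lemma norm_cinner_le: "cmod (cinner x y) \<le> norm x * norm y"
proof (cases "cinner x y = 0")
  case False
  define a where "a = cnj (cinner x y) / cmod (cinner x y)"
  have a: "cmod a = 1" using False by (simp add: a_def norm_divide)
  have "a * cinner x y = (cinner x y * cnj (cinner x y)) / cmod (cinner x y)"
    by (simp add: a_def)
  also have "\<dots> = cmod (cinner x y)"
    using False unfolding complex_norm_square[symmetric] by (simp add: power2_eq_square)
  finally have "cmod (cinner x y) = Re (a * cinner x y)" by simp
  also have "\<dots> = inner (a *\<^sub>C x) y"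
    by (simp add: inner_eq_Re_cinner cinner_scaleC_left)
  also have "\<dots> \<le> norm (a *\<^sub>C x) * norm y" by (rule norm_cauchy_schwarz)
  finally show ?thesis by (simp add: norm_scaleC a)
qed simp

lemma bounded_bilinear_scaleC: "bounded_bilinear (scaleC :: complex \<Rightarrow> 'a::complex_inner \<Rightarrow> 'a)"
proof
  show "\<exists>K. \<forall>a x. norm (a *\<^sub>C x :: 'a) \<le> norm a * norm x * K"
    by (rule exI[of _ 1]) (simp add: norm_scaleC)
qed (simp_all add: scaleC_add_left scaleC_add_right scaleR_eq_scaleC scaleC_scaleC
    scaleC_complex_def mult.commute)

text \<open>Conjugate linearity in the second argument is still real linearity, which is all that
  the rules for limits, derivatives and \<open>Ck_on\<close> of products require.\<close>

lemma bounded_bilinear_cinner: "bounded_bilinear (cinner :: 'a::complex_inner \<Rightarrow> 'a \<Rightarrow> complex)"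
proof
  show "\<exists>K. \<forall>a x. norm (cinner a x) \<le> norm a * norm (x::'a) * K"
    by (rule exI[of _ 1]) (simp add: norm_cinner_le)
qed (simp_all add: cinner_add_left cinner_add_right scaleR_eq_scaleC cinner_scaleC_left
    cinner_scaleC_right scaleC_complex_def)

lemmas tendsto_scaleC = bounded_bilinear.tendsto[OF bounded_bilinear_scaleC]
lemmas bounded_linear_scaleC_right = bounded_bilinear.bounded_linear_right[OF bounded_bilinear_scaleC]
lemmas bounded_linear_scaleC_left = bounded_bilinear.bounded_linear_left[OF bounded_bilinear_scaleC]
lemmas bounded_linear_cinner_left = bounded_bilinear.bounded_linear_left[OF bounded_bilinear_cinner]

section \<open>Closed subspaces, closed spans and orthogonal complements\<close>

lemma csubspaceI:
  assumes "0 \<in> S" "\<And>x y. x \<in> S \<Longrightarrow> y \<in> S \<Longrightarrow> x + y \<in> S" "\<And>c x. x \<in> S \<Longrightarrow> c *\<^sub>C x \<in> S"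
  shows "csubspace S"
  using assms unfolding complex_vec.subspace_def by blast

lemma csubspace_0: "csubspace S \<Longrightarrow> 0 \<in> S"
  and csubspace_add: "csubspace S \<Longrightarrow> x \<in> S \<Longrightarrow> y \<in> S \<Longrightarrow> x + y \<in> S"
  and csubspace_scale: "csubspace S \<Longrightarrow> x \<in> S \<Longrightarrow> c *\<^sub>C x \<in> S"
  and csubspace_diff: "csubspace S \<Longrightarrow> x \<in> S \<Longrightarrow> y \<in> S \<Longrightarrow> x - y \<in> S"
  and csubspace_sum: "csubspace S \<Longrightarrow> (\<And>i. i \<in> I \<Longrightarrow> f i \<in> S) \<Longrightarrow> sum f I \<in> S"
  by (fact complex_vec.subspace_0 complex_vec.subspace_add complex_vec.subspace_scale
      complex_vec.subspace_diff complex_vec.subspace_sum)+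

lemma csubspace_closure:
  assumes "csubspace S" shows "csubspace (closure S)"
proof (rule csubspaceI)
  show "0 \<in> closure S" using csubspace_0[OF assms] closure_subset by blast
next
  fix x y assume "x \<in> closure S" "y \<in> closure S"
  then obtain f g where "\<And>n::nat. f n \<in> S" "f \<longlonglongrightarrow> x" "\<And>n::nat. g n \<in> S" "g \<longlonglongrightarrow> y"
    unfolding closure_sequential by blast
  then show "x + y \<in> closure S"
    unfolding closure_sequential
    by (intro exI[of _ "\<lambda>n. f n + g n"]) (auto intro: tendsto_add csubspace_add[OF assms])
next
  fix c x assume "x \<in> closure S"
  then obtain f where "\<And>n::nat. f n \<in> S" "f \<longlonglongrightarrow> x"
    unfolding closure_sequential by blast
  then show "c *\<^sub>C x \<in> closure S"
    unfolding closure_sequential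
    by (intro exI[of _ "\<lambda>n. c *\<^sub>C f n"]) (auto intro: tendsto_scaleC csubspace_scale[OF assms])
qed

lemma csubspace_closed_cspan: "csubspace (closed_cspan S)"
  unfolding closed_cspan_def by (rule csubspace_closure) (rule complex_vec.subspace_span)

lemma closed_closed_cspan: "closed (closed_cspan S)"
  by (simp add: closed_cspan_def)

lemma closed_cspan_superset: "S \<subseteq> closed_cspan S"
  unfolding closed_cspan_def using complex_vec.span_superset closure_subset by fast

lemma closed_cspan_minimal:
  assumes "S \<subseteq> M" "csubspace M" "closed M"
  shows "closed_cspan S \<subseteq> M"
  unfolding closed_cspan_def using assms by (intro closure_minimal complex_vec.span_minimal)

lemma csubspace_orth_compl: "csubspace (orth_compl M)"
  by (rule csubspaceI) (auto simp: orth_compl_def cinner_add_left cinner_scaleC_left)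

lemma closed_orth_compl: "closed (orth_compl M)"
proof -
  have "orth_compl M = (\<Inter>y\<in>M. {x. cinner x y = 0})"
    by (auto simp: orth_compl_def)
  moreover have "closed {x. cinner x y = 0}" for y :: 'a
    by (intro closed_Collect_eq continuous_intros linear_continuous_on bounded_linear_cinner_left)
  ultimately show ?thesis by (auto intro: closed_INT)
qed

text \<open>The vectors orthogonal to a given \<open>x\<close> form a closed set, so orthogonality
  to \<open>M\<close> extends to limits. This lets the quotient module be tested on polynomial
  multiples of the generator, without their closure.\<close>

lemma orth_compl_closure: "orth_compl (closure M) = orth_compl M"
proof
  show "orth_compl (closure M) \<subseteq> orth_compl M"
    using closure_subset by (force simp: orth_compl_def)
  show "orth_compl M \<subseteq> orth_compl (closure M)"
  proof
    fix x assume x: "x \<in> orth_compl M"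
    have "M \<subseteq> orth_compl {x}"
      using x by (auto simp: orth_compl_def cinner_zero_commute)
    then have "closure M \<subseteq> orth_compl {x}"
      by (intro closure_minimal closed_orth_compl)
    then show "x \<in> orth_compl (closure M)"
      by (auto simp: orth_compl_def cinner_zero_commute[of x])
  qed
qed

lemma orthogonal_independent:
  fixes b :: "nat \<Rightarrow> 'a::complex_inner"
  assumes orth: "\<And>i j. i < n \<Longrightarrow> j < n \<Longrightarrow> i \<noteq> j \<Longrightarrow> cinner (b i) (b j) = 0"
    and nz: "\<And>i. i < n \<Longrightarrow> b i \<noteq> 0"
  shows "inj_on b {..<n}" "\<not> cdependent (b ` {..<n})"
proof -
  show inj: "inj_on b {..<n}"
  proof (rule inj_onI, rule ccontr)
    fix i j assume ij: "i \<in> {..<n}" "j \<in> {..<n}" "b i = b j" "i \<noteq> j"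
    then have "cinner (b i) (b i) = 0" using orth[of i j] by simp
    then show False using nz[of i] ij by simp
  qed
  show "\<not> cdependent (b ` {..<n})"
  proof
    assume "cdependent (b ` {..<n})"
    then obtain v c where v: "v \<in> b ` {..<n}" "c v \<noteq> 0" "(\<Sum>v\<in>b ` {..<n}. c v *\<^sub>C v) = 0"
      by (subst (asm) complex_vec.dependent_finite) auto
    then obtain i where i: "i < n" "v = b i" by auto
    have "0 = cinner (\<Sum>j<n. c (b j) *\<^sub>C b j) (b i)"
      using v(3) sum.reindex[OF inj, of "\<lambda>v. c v *\<^sub>C v"] by simp
    also have "\<dots> = (\<Sum>j<n. if j = i then c (b i) * cinner (b i) (b i) else 0)"
      unfolding cinner_sum_left cinner_scaleC_left
      using i(1) orth by (intro sum.cong refl) auto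
    also have "\<dots> = c v * cinner (b i) (b i)" using i by simp
    finally show False using v(2) nz[OF i(1)] by simp
  qed
qed

section \<open>Orthogonal projections, adjoints and totality\<close>

lemma parallelogram: "(norm (x + y))\<^sup>2 + (norm (x - y))\<^sup>2 = 2 * (norm x)\<^sup>2 + 2 * (norm y)\<^sup>2"
  for x y :: "'a::real_inner"
  by (simp add: power2_norm_eq_inner inner_simps inner_commute)

text \<open>A minimizing sequence is Cauchy because the midpoint of two of its members stays in
  \<open>M\<close> and cannot be closer to \<open>x\<close> than the distance \<open>d\<close>.
  Completeness is demanded of \<open>M\<close>, since the ambient class does not provide it.\<close>

theorem orthogonal_projection:
  fixes M :: "'a::complex_inner set"
  assumes M: "csubspace M" and cpl: "complete M"
  obtains y where "y \<in> M" "\<And>v. v \<in> M \<Longrightarrow> cinner (x - y) v = 0"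
proof -
  define d where "d = infdist x M"
  have ne: "M \<noteq> {}" using csubspace_0[OF M] by auto
  have d: "d \<le> norm (x - v)" if "v \<in> M" for v
    unfolding d_def using infdist_le[OF that, of x] by (simp add: dist_norm)
  have d0: "0 \<le> d" by (simp add: d_def infdist_nonneg)
  have "\<exists>v\<in>M. norm (x - v) < d + 1 / Suc k" for k
  proof (rule ccontr)
    assume "\<not> ?thesis"
    then have "d + 1 / Suc k \<le> dist x v" if "v \<in> M" for v
      using that by (metis dist_norm not_le)
    then have "d + 1 / Suc k \<le> (INF v\<in>M. dist x v)"
      by (intro cINF_greatest ne)
    then have "d + 1 / Suc k \<le> d"
      by (simp only: d_def infdist_notempty[OF ne])
    then show False by simp
  qed
  then obtain v where v: "\<And>k. v k \<in> M" "\<And>k. norm (x - v k) < d + 1 / real (Suc k)" by metis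
  \<comment> \<open>The parallelogram law for \<open>x - v k\<close> and \<open>x - v l\<close>:
    their sum has norm at least \<open>2 * d\<close> by the midpoint argument, which leaves little
    room for their difference.\<close>
  have bound: "(norm (v k - v l))\<^sup>2 \<le> 4 * (d + 1 / Suc N)\<^sup>2 - 4 * d\<^sup>2" if "N \<le> k" "N \<le> l" for k l N
  proof -
    have le: "norm (x - v k) \<le> d + 1 / Suc N" if "N \<le> k" for k
    proof -
      have "1 / real (Suc k) \<le> 1 / real (Suc N)" using that by (intro frac_le) auto
      with v(2)[of k] show ?thesis by linarith
    qed
    have "d \<le> norm (x - (1/2) *\<^sub>C (v k + v l))"
      by (intro d csubspace_scale csubspace_add M v)
    also have "x - (1/2) *\<^sub>C (v k + v l) = (1/2) *\<^sub>C ((x - v k) + (x - v l))"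
    proof -
      have "x = (1/2) *\<^sub>C x + (1/2) *\<^sub>C x"
        by (simp flip: scaleC_add_left)
      then show ?thesis by (simp add: scaleC_add_right scaleC_diff_right)
    qed
    finally have "2 * d \<le> norm ((x - v k) + (x - v l))" by (simp add: norm_scaleC norm_divide)
    then have "(2 * d)\<^sup>2 \<le> (norm ((x - v k) + (x - v l)))\<^sup>2" using d0 by (intro power_mono) auto
    moreover have "(norm (x - v k))\<^sup>2 \<le> (d + 1 / Suc N)\<^sup>2" "(norm (x - v l))\<^sup>2 \<le> (d + 1 / Suc N)\<^sup>2"
      using le that by (auto intro!: power_mono)
    moreover have "norm ((x - v k) - (x - v l)) = norm (v k - v l)"
      by (simp add: norm_minus_commute)
    ultimately show ?thesis
      using parallelogram[of "x - v k" "x - v l"] by (simp add: power_mult_distrib)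
  qed
  have lim: "(\<lambda>N. 4 * (d + 1 / Suc N)\<^sup>2 - 4 * d\<^sup>2) \<longlonglongrightarrow> 4 * (d + 0)\<^sup>2 - 4 * d\<^sup>2"
    by (intro tendsto_intros LIMSEQ_inverse_real_of_nat[unfolded inverse_eq_divide])
  have "Cauchy v"
  proof (rule metric_CauchyI)
    fix e :: real assume "0 < e"
    then have "eventually (\<lambda>N. 4 * (d + 1 / Suc N)\<^sup>2 - 4 * d\<^sup>2 < e\<^sup>2) sequentially"
      using lim by (intro order_tendstoD(2)) auto
    then obtain N where N: "4 * (d + 1 / Suc N)\<^sup>2 - 4 * d\<^sup>2 < e\<^sup>2" by (auto simp: eventually_sequentially)
    have "dist (v k) (v l) < e" if "N \<le> k" "N \<le> l" for k l
    proof -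
      have "(dist (v k) (v l))\<^sup>2 < e\<^sup>2"
        using bound[OF that] N unfolding dist_norm by linarith
      then show ?thesis using \<open>0 < e\<close> by (intro power_less_imp_less_base[of _ 2 e]) auto
    qed
    then show "\<exists>N. \<forall>k\<ge>N. \<forall>l\<ge>N. dist (v k) (v l) < e" by blast
  qed
  then obtain y where y: "y \<in> M" "v \<longlonglongrightarrow> y"
    using cpl v(1) unfolding complete_def by blast
  have "norm (x - y) \<le> d + 0"
  proof (rule LIMSEQ_le)
    show "(\<lambda>k. norm (x - v k)) \<longlonglongrightarrow> norm (x - y)" by (intro tendsto_intros y)
    show "(\<lambda>k. d + 1 / real (Suc k)) \<longlonglongrightarrow> d + 0"
      by (intro tendsto_intros LIMSEQ_inverse_real_of_nat[unfolded inverse_eq_divide])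
    show "\<exists>N. \<forall>k\<ge>N. norm (x - v k) \<le> d + 1 / real (Suc k)"
      by (intro exI allI impI less_imp_le v)
  qed
  then have min: "norm (x - y) \<le> norm (x - y - v)" if "v \<in> M" for v
    using d[OF csubspace_add[OF M y(1) that]] by (simp add: diff_diff_eq)
  have "cinner (x - y) v = 0" if vM: "v \<in> M" for v
  proof (rule ccontr)
    assume nz: "cinner (x - y) v \<noteq> 0"
    then have "v \<noteq> 0" by auto
    \<comment> \<open>\<open>c *\<^sub>C v\<close> is the component of \<open>x - y\<close> along
      \<open>v\<close>; removing it would shorten \<open>x - y\<close> by Pythagoras, against
      minimality.\<close>
    define c where "c = cinner (x - y) v / of_real ((norm v)\<^sup>2)"
    let ?p = "x - y - c *\<^sub>C v"
    have "cinner ?p v = 0"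
      using \<open>v \<noteq> 0\<close> by (simp add: c_def cinner_diff_left cinner_scaleC_left cinner_self_norm)
    then have orth: "cinner ?p (c *\<^sub>C v) = 0" "cinner (c *\<^sub>C v) ?p = 0"
      using cinner_zero_commute by (auto simp: cinner_scaleC_right cinner_scaleC_left)
    have "cinner (x - y) (x - y) = cinner (?p + c *\<^sub>C v) (?p + c *\<^sub>C v)" by simp
    also have "\<dots> = cinner ?p ?p + cinner (c *\<^sub>C v) (c *\<^sub>C v)"
      unfolding cinner_add_left[of ?p] cinner_add_right[of _ ?p] orth by simp
    finally have "(norm (x - y))\<^sup>2 = (norm ?p)\<^sup>2 + (norm (c *\<^sub>C v))\<^sup>2"
      unfolding cinner_self_norm of_real_add[symmetric] by (simp only: of_real_eq_iff)
    moreover have "(norm (x - y))\<^sup>2 \<le> (norm ?p)\<^sup>2"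
      by (intro power_mono min csubspace_scale M vM) auto
    ultimately have "c *\<^sub>C v = 0" by simp
    then have "c = 0" using \<open>v \<noteq> 0\<close> by simp
    then show False using nz \<open>v \<noteq> 0\<close> by (simp add: c_def)
  qed
  with y(1) show thesis by (rule that)
qed

lemma orth_proj_eqI:
  assumes "csubspace H" "y \<in> H" "\<And>v. v \<in> H \<Longrightarrow> cinner (x - y) v = 0"
  shows "orth_proj H x = y"
  unfolding orth_proj_def
proof (rule the_equality)
  fix y' assume y': "y' \<in> H \<and> (\<forall>v\<in>H. cinner (x - y') v = 0)"
  have "cinner (y' - y) (y' - y) = cinner (x - y) (y' - y) - cinner (x - y') (y' - y)"
    by (simp add: cinner_diff_left)
  also have "\<dots> = 0"
    using y' assms by (simp add: csubspace_diff)
  finally show "y' = y" by simp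
qed (use assms in blast)

lemma orth_proj:
  assumes "csubspace H" "complete H"
  shows "orth_proj H x \<in> H" and "v \<in> H \<Longrightarrow> cinner (orth_proj H x) v = cinner x v"
proof -
  obtain y where y: "y \<in> H" "\<And>v. v \<in> H \<Longrightarrow> cinner (x - y) v = 0"
    using orthogonal_projection[OF assms] by metis
  then have "orth_proj H x = y" using assms(1) by (intro orth_proj_eqI)
  with y show "orth_proj H x \<in> H" "v \<in> H \<Longrightarrow> cinner (orth_proj H x) v = cinner x v"
    by (auto simp: cinner_diff_left)
qed

text \<open>Values of compressions and adjoints are known only through inner products; this turns
  such knowledge into equations.\<close>

lemma csubspace_eqI_cinner:
  assumes "csubspace H" "x \<in> H" "y \<in> H" "\<And>v. v \<in> H \<Longrightarrow> cinner v x = cinner v y"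
  shows "x = y"
proof -
  have "cinner (x - y) (x - y) = 0"
    using assms(4)[of "x - y"] assms(1-3) by (simp add: cinner_diff_right csubspace_diff)
  then show ?thesis by simp
qed

lemma adj_eqI:
  assumes "csubspace H" "y \<in> H" "z \<in> H" "\<And>x. x \<in> H \<Longrightarrow> cinner (T x) y = cinner x z"
  shows "adj H T y = z"
proof -
  have "(THE z. z \<in> H \<and> (\<forall>x\<in>H. cinner (T x) y = cinner x z)) = z"
  proof (rule the_equality)
    fix z' assume z': "z' \<in> H \<and> (\<forall>x\<in>H. cinner (T x) y = cinner x z')"
    show "z' = z"
    proof (rule csubspace_eqI_cinner)
      show "cinner v z' = cinner v z" if "v \<in> H" for v
        using z' assms(4)[OF that] that by simp
    qed (use z' assms in auto)
  qed (use assms in auto)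
  then show ?thesis using assms(2) by (simp add: adj_def)
qed

text \<open>The part of \<open>x\<close> orthogonal to \<open>M\<close> again lies in
  \<open>H\<close>, hence vanishes. The totality statements below, for the \<open>g j l\<close>, the
  \<open>e j \<mu>\<close> and the eigenspaces, are instances.\<close>

lemma closed_subspace_eqI:
  assumes "csubspace M" "complete M" "M \<subseteq> H" "csubspace H"
    and "\<And>x. x \<in> H \<Longrightarrow> (\<And>v. v \<in> M \<Longrightarrow> cinner x v = 0) \<Longrightarrow> x = 0"
  shows "M = H"
proof
  show "H \<subseteq> M"
  proof
    fix x assume x: "x \<in> H"
    obtain y where y: "y \<in> M" "\<And>v. v \<in> M \<Longrightarrow> cinner (x - y) v = 0"
      using orthogonal_projection[OF assms(1,2)] by metis
    have "y \<in> H" using y(1) assms(3) by auto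
    then have "x - y \<in> H" by (rule csubspace_diff[OF assms(4) x])
    then have "x - y = 0" using y(2) by (rule assms(5))
    then show "x \<in> M" using y by simp
  qed
qed fact

text \<open>Finite combinations of \<open>B\<close> with coefficients in a countable dense subset of the scalars
  are dense.\<close>

lemma separable_closed_cspan:
  fixes B :: "'a::complex_inner set"
  assumes "countable B"
  shows "separable_space (top_of_set (closed_cspan B))"
proof -
  obtain Q :: "complex set" where Q: "countable Q" "\<And>X. open X \<Longrightarrow> X \<noteq> {} \<Longrightarrow> \<exists>q\<in>Q. q \<in> X"
    using countable_dense_setE by blast
  have Qlim: "\<exists>f. (\<forall>k. f k \<in> Q) \<and> f \<longlonglongrightarrow> c" for c
  proof -
    have "\<exists>q\<in>Q. dist q c < e" if "0 < e" for e
    proof -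
      have "ball c e \<noteq> {}" using that by auto
      from Q(2)[OF open_ball this] show ?thesis by (auto simp: dist_commute)
    qed
    then have "c \<in> closure Q" unfolding closure_approachable by blast
    then show ?thesis unfolding closure_sequential .
  qed
  \<comment> \<open>One application of \<open>step\<close> appends one more term to every
    combination, so that countability and membership in the span follow by induction on the number
    of terms.\<close>
  define step where "step X = (\<lambda>(x, q, b). x + q *\<^sub>C b) ` (X \<times> Q \<times> B)" for X
  define V where "V = (\<Union>k. (step ^^ k) {0})"
  have "countable ((step ^^ k) {0})" for k
    by (induction k) (auto simp: step_def intro!: countable_image countable_SIGMA Q(1) assms)
  then have V: "countable V" unfolding V_def by simp
  have V_step: "x + q *\<^sub>C b \<in> V" if "x \<in> V" "q \<in> Q" "b \<in> B" for x q b
  proof -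
    from that obtain k where "x \<in> (step ^^ k) {0}" by (auto simp: V_def)
    then have "x + q *\<^sub>C b \<in> (step ^^ Suc k) {0}" using that by (force simp: step_def)
    then show ?thesis unfolding V_def by blast
  qed
  have V_sub: "V \<subseteq> cspan B"
  proof -
    have "(step ^^ k) {0} \<subseteq> cspan B" for k
      by (induction k) (auto simp: step_def complex_vec.span_zero
          intro!: complex_vec.span_add complex_vec.span_scale intro: complex_vec.span_base)
    then show ?thesis by (auto simp: V_def)
  qed
  \<comment> \<open>\<open>V\<close> admits only coefficients from \<open>Q\<close>; a general
    \<open>c\<close> is reached by approximating the coefficient and the vector
    simultaneously.\<close>
  have V_closure: "c *\<^sub>C b + x \<in> closure V" if b: "b \<in> B" and x: "x \<in> closure V" for c b x
  proof -
    from x obtain f where f: "\<forall>k. f k \<in> V" "f \<longlonglongrightarrow> x"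
      by (auto simp: closure_sequential)
    from Qlim[of c] obtain q where q: "\<forall>k. q k \<in> Q" "q \<longlonglongrightarrow> c" by auto
    have "(\<lambda>k. f k + q k *\<^sub>C b) \<longlonglongrightarrow> x + c *\<^sub>C b"
      by (rule tendsto_add[OF f(2) tendsto_scaleC[OF q(2) tendsto_const]])
    moreover have "\<forall>k. f k + q k *\<^sub>C b \<in> V"
      using V_step f(1) q(1) b by simp
    ultimately show ?thesis
      unfolding closure_sequential add.commute[of _ x] by (intro exI conjI)
  qed
  have "0 \<in> (step ^^ 0) {0}" by simp
  then have "0 \<in> V" unfolding V_def by blast
  then have zero: "0 \<in> closure V" by (rule closure_subset[THEN subsetD])
  have "x \<in> closure V" if "x \<in> cspan B" for x
    using that by (induction rule: complex_vec.span_induct_alt) (use zero V_closure in auto)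
  then have sub: "closed_cspan B \<subseteq> closure V"
    unfolding closed_cspan_def by (intro closure_minimal subsetI) auto
  moreover have "closure V \<subseteq> closed_cspan B"
    unfolding closed_cspan_def using V_sub by (rule closure_mono)
  ultimately have "closure V = closed_cspan B" by auto
  moreover have "V \<subseteq> closed_cspan B" using calculation closure_subset[of V] by simp
  ultimately have "top_of_set (closed_cspan B) closure_of V = closed_cspan B"
    by (simp add: closure_of_subtopology Int_absorb1)
  then show ?thesis
    unfolding separable_space_def using V \<open>V \<subseteq> closed_cspan B\<close> by auto
qed

section \<open>Smooth functions of a complex variable\<close>

text \<open>Two applications of the mean value theorem: one in direction \<open>v\<close>, to the
  difference of \<open>g\<close> at the heights \<open>t\<close> and \<open>0\<close> along
  \<open>w\<close>, then one in direction \<open>w\<close> to the derivative so obtained.\<close>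

lemma mean_value_second_difference:
  fixes g :: "'a::real_normed_vector \<Rightarrow> real"
  assumes "0 < t"
    and g: "\<And>p. p \<in> U \<Longrightarrow> (g has_derivative g' p) (at p)"
    and g': "\<And>p. p \<in> U \<Longrightarrow> ((\<lambda>p. g' p v) has_derivative g'' p) (at p)"
    and U: "\<And>x y. 0 \<le> x \<Longrightarrow> x \<le> t \<Longrightarrow> 0 \<le> y \<Longrightarrow> y \<le> t \<Longrightarrow> a + x *\<^sub>R v + y *\<^sub>R w \<in> U"
  shows "\<exists>x y. 0 < x \<and> x < t \<and> 0 < y \<and> y < t \<and>
    g (a + t *\<^sub>R v + t *\<^sub>R w) - g (a + t *\<^sub>R v) - g (a + t *\<^sub>R w) + g a
      = t * t * g'' (a + x *\<^sub>R v + y *\<^sub>R w) w"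
proof -
  have D1: "DERIV (\<lambda>x. g (a + x *\<^sub>R v + y *\<^sub>R w)) x :> g' (a + x *\<^sub>R v + y *\<^sub>R w) v"
    if "0 \<le> x" "x \<le> t" "0 \<le> y" "y \<le> t" for x y
  proof -
    note d = g[OF U[OF that]]
    have "((\<lambda>x. a + x *\<^sub>R v + y *\<^sub>R w) has_derivative (\<lambda>h. h *\<^sub>R v)) (at x)"
      by (auto intro!: derivative_eq_intros)
    from has_derivative_compose[OF this d]
    have "((\<lambda>x. g (a + x *\<^sub>R v + y *\<^sub>R w)) has_derivative (\<lambda>h. g' (a + x *\<^sub>R v + y *\<^sub>R w) (h *\<^sub>R v))) (at x)" .
    moreover have "g' (a + x *\<^sub>R v + y *\<^sub>R w) (h *\<^sub>R v) = h * g' (a + x *\<^sub>R v + y *\<^sub>R w) v" for h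
      using linear_scale[OF has_derivative_linear[OF d]] by simp
    ultimately show ?thesis by (simp add: has_field_derivative_def mult_commute_abs)
  qed
  have D2: "DERIV (\<lambda>y. g' (a + x *\<^sub>R v + y *\<^sub>R w) v) y :> g'' (a + x *\<^sub>R v + y *\<^sub>R w) w"
    if "0 \<le> x" "x \<le> t" "0 \<le> y" "y \<le> t" for x y
  proof -
    note d = g'[OF U[OF that]]
    have "((\<lambda>y. a + x *\<^sub>R v + y *\<^sub>R w) has_derivative (\<lambda>h. h *\<^sub>R w)) (at y)"
      by (auto intro!: derivative_eq_intros)
    from has_derivative_compose[OF this d]
    have "((\<lambda>y. g' (a + x *\<^sub>R v + y *\<^sub>R w) v) has_derivative (\<lambda>h. g'' (a + x *\<^sub>R v + y *\<^sub>R w) (h *\<^sub>R w))) (at y)" .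
    moreover have "g'' (a + x *\<^sub>R v + y *\<^sub>R w) (h *\<^sub>R w) = h * g'' (a + x *\<^sub>R v + y *\<^sub>R w) w" for h
      using linear_scale[OF has_derivative_linear[OF d]] by simp
    ultimately show ?thesis by (simp add: has_field_derivative_def mult_commute_abs)
  qed
  have "\<exists>x>0. x < t \<and> (g (a + t *\<^sub>R v + t *\<^sub>R w) - g (a + t *\<^sub>R v + 0 *\<^sub>R w))
      - (g (a + 0 *\<^sub>R v + t *\<^sub>R w) - g (a + 0 *\<^sub>R v + 0 *\<^sub>R w))
      = (t - 0) * (g' (a + x *\<^sub>R v + t *\<^sub>R w) v - g' (a + x *\<^sub>R v + 0 *\<^sub>R w) v)"
    using \<open>0 < t\<close> by (intro MVT2 DERIV_diff D1) auto
  then obtain x where x: "0 < x" "x < t"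
    and eq: "g (a + t *\<^sub>R v + t *\<^sub>R w) - g (a + t *\<^sub>R v) - g (a + t *\<^sub>R w) + g a
      = t * (g' (a + x *\<^sub>R v + t *\<^sub>R w) v - g' (a + x *\<^sub>R v + 0 *\<^sub>R w) v)"
    by auto
  have "\<exists>y>0. y < t \<and> g' (a + x *\<^sub>R v + t *\<^sub>R w) v - g' (a + x *\<^sub>R v + 0 *\<^sub>R w) v
      = (t - 0) * g'' (a + x *\<^sub>R v + y *\<^sub>R w) w"
    using \<open>0 < t\<close> x by (intro MVT2 D2) auto
  then show ?thesis using eq x by auto
qed

text \<open>The second difference does not change when \<open>v\<close> and \<open>w\<close> are
  exchanged, so the two mixed derivatives, taken at suitable points near \<open>a\<close>, agree
  exactly; continuity carries this to \<open>a\<close>.\<close>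

lemma symmetric_second_derivatives:
  fixes g :: "'a::real_normed_vector \<Rightarrow> real"
  assumes "open U" "a \<in> U"
    and g: "\<And>p. p \<in> U \<Longrightarrow> (g has_derivative g' p) (at p)"
    and gv: "\<And>p. p \<in> U \<Longrightarrow> ((\<lambda>p. g' p v) has_derivative gv p) (at p)"
    and gw: "\<And>p. p \<in> U \<Longrightarrow> ((\<lambda>p. g' p w) has_derivative gw p) (at p)"
    and cont: "continuous_on U (\<lambda>p. gv p w)" "continuous_on U (\<lambda>p. gw p v)"
  shows "gv a w = gw a v"
proof (rule ccontr)
  assume ne: "gv a w \<noteq> gw a v"
  \<comment> \<open>Half the gap: two numbers within \<open>e\<close> of \<open>gv a w\<close> and
    \<open>gw a v\<close> respectively cannot coincide.\<close>
  define e where "e = \<bar>gv a w - gw a v\<bar> / 2"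
  have "e > 0" using ne by (simp add: e_def)
  have "isCont (\<lambda>p. gv p w) a" "isCont (\<lambda>p. gw p v) a"
    using cont \<open>open U\<close> \<open>a \<in> U\<close> by (simp_all add: continuous_on_eq_continuous_at)
  then have "((\<lambda>p. gv p w) \<longlongrightarrow> gv a w) (nhds a)" "((\<lambda>p. gw p v) \<longlongrightarrow> gw a v) (nhds a)"
    by (simp_all add: isCont_def tendsto_at_iff_tendsto_nhds[of "\<lambda>p. gv p w" a]
        tendsto_at_iff_tendsto_nhds[of "\<lambda>p. gw p v" a])
  then have "eventually (\<lambda>p. dist (gv p w) (gv a w) < e) (nhds a)"
    "eventually (\<lambda>p. dist (gw p v) (gw a v) < e) (nhds a)"
    using \<open>e > 0\<close> by (auto dest: tendstoD)
  moreover have "eventually (\<lambda>p. p \<in> U) (nhds a)"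
    using assms(1,2) by (rule eventually_nhds_in_open)
  ultimately have "eventually (\<lambda>p. p \<in> U \<and> dist (gv p w) (gv a w) < e \<and> dist (gw p v) (gw a v) < e) (nhds a)"
    by eventually_elim auto
  then obtain d where d: "d > 0"
    "\<And>p. dist p a < d \<Longrightarrow> p \<in> U \<and> dist (gv p w) (gv a w) < e \<and> dist (gw p v) (gw a v) < e"
    unfolding eventually_nhds_metric by blast
  \<comment> \<open>Displacements by at most \<open>t\<close> along both directions move
    \<open>a\<close> by at most \<open>t * S\<close>, which is half of \<open>d\<close>; the summand
    \<open>1\<close> keeps \<open>S\<close> positive when both directions vanish.\<close>
  define S where "S = norm v + norm w + 1"
  define t where "t = d / S / 2"
  have pos: "0 < S" by (simp add: S_def add_nonneg_pos)
  have "0 < t" using d(1) pos by (simp add: t_def)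
  have near: "dist (a + x *\<^sub>R v + y *\<^sub>R w) a < d" if "0 \<le> x" "x \<le> t" "0 \<le> y" "y \<le> t" for x y
  proof -
    have "dist (a + x *\<^sub>R v + y *\<^sub>R w) a = norm (x *\<^sub>R v + y *\<^sub>R w)"
      by (simp add: dist_norm add.assoc)
    also have "\<dots> \<le> x * norm v + y * norm w"
      using that norm_triangle_ineq[of "x *\<^sub>R v" "y *\<^sub>R w"] by simp
    also have "\<dots> \<le> t * norm v + t * norm w"
      using that by (intro add_mono mult_right_mono) auto
    also have "\<dots> \<le> t * S"
      using \<open>0 < t\<close> by (simp add: S_def algebra_simps)
    also have "\<dots> = d / 2" using pos by (simp add: t_def)
    finally show ?thesis using d(1) by linarith
  qed
  then have near': "dist (a + x *\<^sub>R w + y *\<^sub>R v) a < d" if "0 \<le> x" "x \<le> t" "0 \<le> y" "y \<le> t" for x y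
    using near[of y x] that by (simp add: algebra_simps)
  obtain x y where xy: "0 < x" "x < t" "0 < y" "y < t"
    and 1: "g (a + t *\<^sub>R v + t *\<^sub>R w) - g (a + t *\<^sub>R v) - g (a + t *\<^sub>R w) + g a
      = t * t * gv (a + x *\<^sub>R v + y *\<^sub>R w) w"
    using mean_value_second_difference[of t U g g' v gv a w] \<open>0 < t\<close> g gv near d by blast
  obtain x' y' where xy': "0 < x'" "x' < t" "0 < y'" "y' < t"
    and 2: "g (a + t *\<^sub>R w + t *\<^sub>R v) - g (a + t *\<^sub>R w) - g (a + t *\<^sub>R v) + g a
      = t * t * gw (a + x' *\<^sub>R w + y' *\<^sub>R v) v"
    using mean_value_second_difference[of t U g g' w gw a v] \<open>0 < t\<close> g gw near' d by blast
  have "t * t * gv (a + x *\<^sub>R v + y *\<^sub>R w) w = t * t * gw (a + x' *\<^sub>R w + y' *\<^sub>R v) v"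
    using 1 2 by (simp add: algebra_simps)
  then have eq: "gv (a + x *\<^sub>R v + y *\<^sub>R w) w = gw (a + x' *\<^sub>R w + y' *\<^sub>R v) v"
    using \<open>0 < t\<close> by simp
  have "dist (gv (a + x *\<^sub>R v + y *\<^sub>R w) w) (gv a w) < e" "dist (gw (a + x' *\<^sub>R w + y' *\<^sub>R v) v) (gw a v) < e"
    using d(2)[OF near] d(2)[OF near'] xy xy' by auto
  then have "\<bar>gv a w - gw a v\<bar> < 2 * e"
    unfolding eq dist_real_def by linarith
  then show False by (simp add: e_def)
qed

section \<open>Closure properties of the classes \<open>Ck_on\<close> and
  \<open>smooth_on\<close>\<close>

lemma Ck_on_SucI:
  assumes "\<And>\<mu>. \<mu> \<in> U \<Longrightarrow> (f has_derivative (\<lambda>h. Re h *\<^sub>R fx \<mu> + Im h *\<^sub>R fy \<mu>)) (at \<mu>)"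
    and "Ck_on k U fx" "Ck_on k U fy"
  shows "Ck_on (Suc k) U f"
  using assms unfolding Ck_on.simps by (intro exI[of _ fx] exI[of _ fy]) simp

lemma Ck_on_cong:
  assumes "open U" "\<And>\<mu>. \<mu> \<in> U \<Longrightarrow> f \<mu> = g \<mu>" "Ck_on k U f"
  shows "Ck_on k U g"
proof (cases k)
  case 0
  then show ?thesis using assms continuous_on_cong[of U U f g] by simp
next
  case (Suc k')
  have "(g has_derivative D) (at \<mu>)" if "(f has_derivative D) (at \<mu>)" "\<mu> \<in> U" for D \<mu>
    using that(1) assms(1) that(2) by (rule has_derivative_transform_within_open) (fact assms(2))
  moreover obtain fx fy where "Ck_on k' U fx" "Ck_on k' U fy"
    "\<And>\<mu>. \<mu> \<in> U \<Longrightarrow> (f has_derivative (\<lambda>h. Re h *\<^sub>R fx \<mu> + Im h *\<^sub>R fy \<mu>)) (at \<mu>)"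
    using assms(3) unfolding Suc by auto
  ultimately show ?thesis unfolding Suc by (intro Ck_on_SucI[where fx = fx and fy = fy]) blast+
qed

lemma Ck_on_imp_continuous_on: "Ck_on k U f \<Longrightarrow> continuous_on U f"
proof (cases k)
  case (Suc k')
  assume "Ck_on k U f"
  then have "\<exists>D. (f has_derivative D) (at \<mu>)" if "\<mu> \<in> U" for \<mu>
    using that unfolding Suc by auto
  then have "isCont f \<mu>" if "\<mu> \<in> U" for \<mu>
    by (rule exE) (use that in \<open>auto intro: has_derivative_continuous\<close>)
  then show ?thesis by (simp add: continuous_at_imp_continuous_on)
qed simp

text \<open>Needed for product rules, where an undifferentiated factor of class \<open>Suc k\<close>
  stands beside a derivative of class \<open>k\<close>.\<close>

lemma Ck_on_SucD: "Ck_on (Suc k) U f \<Longrightarrow> Ck_on k U f"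
proof (induction k arbitrary: f)
  case 0
  then show ?case using Ck_on_imp_continuous_on[OF 0] by simp
next
  case (Suc k)
  from iffD1[OF Ck_on.simps(2) Suc.prems] obtain fx fy
    where "(\<forall>\<mu>\<in>U. (f has_derivative (\<lambda>h. Re h *\<^sub>R fx \<mu> + Im h *\<^sub>R fy \<mu>)) (at \<mu>))
      \<and> Ck_on (Suc k) U fx \<and> Ck_on (Suc k) U fy"
    by (elim exE)
  note f = this[THEN conjunct1] this[THEN conjunct2, THEN conjunct1] this[THEN conjunct2, THEN conjunct2]
  show ?case
    by (rule Ck_on_SucI[OF f(1)[rule_format] Suc.IH[OF f(2)] Suc.IH[OF f(3)]])
qed

lemma Ck_on_subset: "Ck_on k U f \<Longrightarrow> V \<subseteq> U \<Longrightarrow> Ck_on k V f"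
proof (induction k arbitrary: f)
  case (Suc k)
  from Suc.prems(1) obtain fx fy where "Ck_on k U fx" "Ck_on k U fy"
    "\<And>\<mu>. \<mu> \<in> U \<Longrightarrow> (f has_derivative (\<lambda>h. Re h *\<^sub>R fx \<mu> + Im h *\<^sub>R fy \<mu>)) (at \<mu>)"
    by auto
  then show ?case
    using Suc.prems(2) by (intro Ck_on_SucI[where fx = fx and fy = fy] Suc.IH) auto
qed (simp add: continuous_on_subset)

lemma Ck_on_const: "Ck_on k U (\<lambda>_. c)"
proof (induction k arbitrary: c)
  case (Suc k)
  show ?case by (rule Ck_on_SucI[OF _ Suc[of 0] Suc[of 0]]) simp
qed simp

lemma Ck_on_add: "Ck_on k U f \<Longrightarrow> Ck_on k U g \<Longrightarrow> Ck_on k U (\<lambda>\<mu>. f \<mu> + g \<mu>)"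
proof (induction k arbitrary: f g)
  case (Suc k)
  obtain fx fy where f: "Ck_on k U fx" "Ck_on k U fy"
    "\<And>\<mu>. \<mu> \<in> U \<Longrightarrow> (f has_derivative (\<lambda>h. Re h *\<^sub>R fx \<mu> + Im h *\<^sub>R fy \<mu>)) (at \<mu>)"
    using Suc.prems(1) by auto
  obtain gx gy where g: "Ck_on k U gx" "Ck_on k U gy"
    "\<And>\<mu>. \<mu> \<in> U \<Longrightarrow> (g has_derivative (\<lambda>h. Re h *\<^sub>R gx \<mu> + Im h *\<^sub>R gy \<mu>)) (at \<mu>)"
    using Suc.prems(2) by auto
  have "((\<lambda>\<mu>. f \<mu> + g \<mu>) has_derivative
      (\<lambda>h. Re h *\<^sub>R (fx \<mu> + gx \<mu>) + Im h *\<^sub>R (fy \<mu> + gy \<mu>))) (at \<mu>)" if "\<mu> \<in> U" for \<mu>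
    using has_derivative_add[OF f(3)[OF that] g(3)[OF that]] by (simp add: algebra_simps)
  then show ?case using Suc.IH[OF f(1) g(1)] Suc.IH[OF f(2) g(2)] by (rule Ck_on_SucI)
qed (simp add: continuous_on_add)

lemma Ck_on_bounded_linear:
  assumes "bounded_linear L"
  shows "Ck_on k U f \<Longrightarrow> Ck_on k U (\<lambda>\<mu>. L (f \<mu>))"
proof (induction k arbitrary: f)
  case 0
  then show ?case using assms by (simp add: bounded_linear.continuous_on)
next
  case (Suc k)
  obtain fx fy where f: "Ck_on k U fx" "Ck_on k U fy"
    "\<And>\<mu>. \<mu> \<in> U \<Longrightarrow> (f has_derivative (\<lambda>h. Re h *\<^sub>R fx \<mu> + Im h *\<^sub>R fy \<mu>)) (at \<mu>)"
    using Suc.prems(1) by auto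
  have "((\<lambda>\<mu>. L (f \<mu>)) has_derivative (\<lambda>h. Re h *\<^sub>R L (fx \<mu>) + Im h *\<^sub>R L (fy \<mu>))) (at \<mu>)"
    if "\<mu> \<in> U" for \<mu>
    using bounded_linear.has_derivative[OF assms f(3)[OF that]]
    by (simp add: linear_add linear_scale bounded_linear.linear[OF assms])
  then show ?case using Suc.IH[OF f(1)] Suc.IH[OF f(2)] by (rule Ck_on_SucI)
qed

lemma Ck_on_bounded_bilinear:
  assumes "bounded_bilinear B"
  shows "Ck_on k U f \<Longrightarrow> Ck_on k U g \<Longrightarrow> Ck_on k U (\<lambda>\<mu>. B (f \<mu>) (g \<mu>))"
proof (induction k arbitrary: f g)
  case 0
  then show ?case using assms by (simp add: bounded_bilinear.continuous_on)
next
  case (Suc k)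
  interpret bounded_bilinear B by fact
  obtain fx fy where f: "Ck_on k U fx" "Ck_on k U fy"
    "\<And>\<mu>. \<mu> \<in> U \<Longrightarrow> (f has_derivative (\<lambda>h. Re h *\<^sub>R fx \<mu> + Im h *\<^sub>R fy \<mu>)) (at \<mu>)"
    using Suc.prems(1) by auto
  obtain gx gy where g: "Ck_on k U gx" "Ck_on k U gy"
    "\<And>\<mu>. \<mu> \<in> U \<Longrightarrow> (g has_derivative (\<lambda>h. Re h *\<^sub>R gx \<mu> + Im h *\<^sub>R gy \<mu>)) (at \<mu>)"
    using Suc.prems(2) by auto
  have "((\<lambda>\<mu>. B (f \<mu>) (g \<mu>)) has_derivative
      (\<lambda>h. Re h *\<^sub>R (B (f \<mu>) (gx \<mu>) + B (fx \<mu>) (g \<mu>))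
        + Im h *\<^sub>R (B (f \<mu>) (gy \<mu>) + B (fy \<mu>) (g \<mu>)))) (at \<mu>)" if "\<mu> \<in> U" for \<mu>
    using FDERIV[OF f(3)[OF that] g(3)[OF that]]
    by (simp add: add_left add_right scaleR_left scaleR_right algebra_simps)
  moreover note f' = Ck_on_SucD[OF Suc.prems(1)] and g' = Ck_on_SucD[OF Suc.prems(2)]
  ultimately show ?case
    using Ck_on_add[OF Suc.IH[OF f' g(1)] Suc.IH[OF f(1) g']]
      Ck_on_add[OF Suc.IH[OF f' g(2)] Suc.IH[OF f(2) g']]
    by (intro Ck_on_SucI[where fx = "\<lambda>\<mu>. B (f \<mu>) (gx \<mu>) + B (fx \<mu>) (g \<mu>)"
          and fy = "\<lambda>\<mu>. B (f \<mu>) (gy \<mu>) + B (fy \<mu>) (g \<mu>)"])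
qed

text \<open>The derivative of f^(-1/2) is -1/2 times the cube of this same function times the
  derivative of \<open>f\<close>. Being expressed through the function itself, it lets the induction
  on \<open>k\<close> close.\<close>

lemma Ck_on_inverse_sqrt:
  fixes f :: "complex \<Rightarrow> real"
  assumes pos: "\<And>\<mu>. \<mu> \<in> U \<Longrightarrow> 0 < f \<mu>"
  shows "Ck_on k U f \<Longrightarrow> Ck_on k U (\<lambda>\<mu>. 1 / sqrt (f \<mu>))"
proof (induction k)
  case 0
  then show ?case using pos by (auto intro!: continuous_intros simp: less_imp_neq[symmetric] dest: pos)
next
  case (Suc k)
  let ?u = "\<lambda>\<mu>. 1 / sqrt (f \<mu>)"
  obtain fx fy where f: "Ck_on k U fx" "Ck_on k U fy"
    "\<And>\<mu>. \<mu> \<in> U \<Longrightarrow> (f has_derivative (\<lambda>h. Re h *\<^sub>R fx \<mu> + Im h *\<^sub>R fy \<mu>)) (at \<mu>)"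
    using Suc.prems(1) by auto
  let ?c = "\<lambda>\<mu>. - 1 / 2 * (?u \<mu> * (?u \<mu> * ?u \<mu>))"
  have "(?u has_derivative (\<lambda>h. Re h *\<^sub>R (?c \<mu> * fx \<mu>) + Im h *\<^sub>R (?c \<mu> * fy \<mu>))) (at \<mu>)"
    if "\<mu> \<in> U" for \<mu>
  proof -
    have "DERIV (\<lambda>x. 1 / sqrt x) (f \<mu>) :> ?c \<mu>"
      using pos[OF that] by (auto intro!: derivative_eq_intros simp: field_simps power2_eq_square)
    then have "((\<lambda>x. 1 / sqrt x) has_derivative (\<lambda>h. ?c \<mu> * h)) (at (f \<mu>))"
      unfolding has_field_derivative_def .
    from has_derivative_compose[OF f(3)[OF that] this]
    have "(?u has_derivative (\<lambda>h. ?c \<mu> * (Re h *\<^sub>R fx \<mu> + Im h *\<^sub>R fy \<mu>))) (at \<mu>)" .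
    moreover have "(\<lambda>h. ?c \<mu> * (Re h *\<^sub>R fx \<mu> + Im h *\<^sub>R fy \<mu>))
        = (\<lambda>h. Re h *\<^sub>R (?c \<mu> * fx \<mu>) + Im h *\<^sub>R (?c \<mu> * fy \<mu>))"
      by (simp only: distrib_left mult_scaleR_right)
    ultimately show ?thesis by simp
  qed
  moreover have u: "Ck_on k U ?u" using Suc.IH Ck_on_SucD[OF Suc.prems] by blast
  have c: "Ck_on k U ?c"
    by (rule Ck_on_bounded_bilinear[OF bounded_bilinear_mult Ck_on_const
        Ck_on_bounded_bilinear[OF bounded_bilinear_mult u Ck_on_bounded_bilinear[OF bounded_bilinear_mult u u]]])
  ultimately show ?case
    using Ck_on_bounded_bilinear[OF bounded_bilinear_mult c f(1)]
      Ck_on_bounded_bilinear[OF bounded_bilinear_mult c f(2)]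
    by (intro Ck_on_SucI[where fx = "\<lambda>\<mu>. ?c \<mu> * fx \<mu>" and fy = "\<lambda>\<mu>. ?c \<mu> * fy \<mu>"])
qed

lemma smooth_on_cong: "open U \<Longrightarrow> (\<And>\<mu>. \<mu> \<in> U \<Longrightarrow> f \<mu> = g \<mu>) \<Longrightarrow> smooth_on U f \<Longrightarrow> smooth_on U g"
  unfolding smooth_on_def using Ck_on_cong by blast

lemma smooth_on_subset: "smooth_on U f \<Longrightarrow> V \<subseteq> U \<Longrightarrow> smooth_on V f"
  unfolding smooth_on_def using Ck_on_subset by blast

lemma smooth_on_const: "smooth_on U (\<lambda>_. c)"
  by (simp add: smooth_on_def Ck_on_const)

lemma smooth_on_add: "smooth_on U f \<Longrightarrow> smooth_on U g \<Longrightarrow> smooth_on U (\<lambda>\<mu>. f \<mu> + g \<mu>)"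
  by (simp add: smooth_on_def Ck_on_add)

lemma smooth_on_sum: "(\<And>i. i \<in> I \<Longrightarrow> smooth_on U (f i)) \<Longrightarrow> smooth_on U (\<lambda>\<mu>. \<Sum>i\<in>I. f i \<mu>)"
  by (induction I rule: infinite_finite_induct) (simp_all add: smooth_on_const smooth_on_add)

lemma smooth_on_bounded_linear: "bounded_linear L \<Longrightarrow> smooth_on U f \<Longrightarrow> smooth_on U (\<lambda>\<mu>. L (f \<mu>))"
  by (simp add: smooth_on_def Ck_on_bounded_linear)

lemma smooth_on_scaleC: "smooth_on U f \<Longrightarrow> smooth_on U g \<Longrightarrow> smooth_on U (\<lambda>\<mu>. f \<mu> *\<^sub>C g \<mu>)"
  by (simp add: smooth_on_def Ck_on_bounded_bilinear[OF bounded_bilinear_scaleC])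

lemma smooth_on_mult:
  fixes f :: "complex \<Rightarrow> complex"
  shows "smooth_on U f \<Longrightarrow> smooth_on U g \<Longrightarrow> smooth_on U (\<lambda>\<mu>. f \<mu> * g \<mu>)"
  by (simp add: smooth_on_def Ck_on_bounded_bilinear[OF bounded_bilinear_mult])

lemma smooth_on_cinner: "smooth_on U f \<Longrightarrow> smooth_on U g \<Longrightarrow> smooth_on U (\<lambda>\<mu>. cinner (f \<mu>) (g \<mu>))"
  by (simp add: smooth_on_def Ck_on_bounded_bilinear[OF bounded_bilinear_cinner])

lemma smooth_on_diff:
  fixes f :: "complex \<Rightarrow> 'a::complex_inner"
  assumes "smooth_on U f" "smooth_on U g"
  shows "smooth_on U (\<lambda>\<mu>. f \<mu> - g \<mu>)"
  using smooth_on_add[OF assms(1) smooth_on_bounded_linear[OF bounded_linear_minus[OF bounded_linear_ident] assms(2)]]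
  by simp

text \<open>\<open>Ck_on\<close> chooses partial derivatives anew for each \<open>k\<close>.
  Identifying them with values of the Frechet derivative makes the choice independent of
  \<open>k\<close>, so that the partial derivatives are themselves smooth.\<close>

lemma smooth_on_frechet:
  assumes "smooth_on U f" "open U"
  shows "\<mu> \<in> U \<Longrightarrow> f differentiable at \<mu>"
    and "smooth_on U (\<lambda>\<mu>. frechet_derivative f (at \<mu>) 1)"
    and "smooth_on U (\<lambda>\<mu>. frechet_derivative f (at \<mu>) \<i>)"
proof -
  have *: "\<exists>fx fy. (\<forall>\<mu>\<in>U. (f has_derivative (\<lambda>h. Re h *\<^sub>R fx \<mu> + Im h *\<^sub>R fy \<mu>)) (at \<mu>))
     \<and> Ck_on k U fx \<and> Ck_on k U fy" for k
    using assms(1) unfolding smooth_on_def Ck_on.simps(2)[symmetric] by blast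
  show "\<mu> \<in> U \<Longrightarrow> f differentiable at \<mu>"
    using *[of 0] unfolding differentiable_def by blast
  have "Ck_on k U (\<lambda>\<mu>. frechet_derivative f (at \<mu>) 1) \<and> Ck_on k U (\<lambda>\<mu>. frechet_derivative f (at \<mu>) \<i>)" for k
  proof -
    obtain fx fy where f: "Ck_on k U fx" "Ck_on k U fy"
      "\<And>\<mu>. \<mu> \<in> U \<Longrightarrow> (f has_derivative (\<lambda>h. Re h *\<^sub>R fx \<mu> + Im h *\<^sub>R fy \<mu>)) (at \<mu>)"
      using *[of k] by blast
    have "frechet_derivative f (at \<mu>) = (\<lambda>h. Re h *\<^sub>R fx \<mu> + Im h *\<^sub>R fy \<mu>)" if "\<mu> \<in> U" for \<mu>
      using frechet_derivative_at[OF f(3)[OF that]] by simp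
    then show ?thesis
      using Ck_on_cong[OF assms(2) _ f(1), of "\<lambda>\<mu>. frechet_derivative f (at \<mu>) 1"]
        Ck_on_cong[OF assms(2) _ f(2), of "\<lambda>\<mu>. frechet_derivative f (at \<mu>) \<i>"] by simp
  qed
  then show "smooth_on U (\<lambda>\<mu>. frechet_derivative f (at \<mu>) 1)"
    "smooth_on U (\<lambda>\<mu>. frechet_derivative f (at \<mu>) \<i>)"
    unfolding smooth_on_def by auto
qed

lemma smooth_on_imp_continuous_on: "smooth_on U f \<Longrightarrow> continuous_on U f"
  unfolding smooth_on_def using Ck_on.simps(1) by blast

lemma frechet_derivative_commute_real:
  fixes f :: "complex \<Rightarrow> real"
  assumes "smooth_on U f" "open U" "\<mu> \<in> U"
  shows "frechet_derivative (\<lambda>\<mu>. frechet_derivative f (at \<mu>) 1) (at \<mu>) \<i>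
    = frechet_derivative (\<lambda>\<mu>. frechet_derivative f (at \<mu>) \<i>) (at \<mu>) 1"
  using assms(2,3)
proof (rule symmetric_second_derivatives[where g = f and v = 1 and w = \<i>])
  note s = smooth_on_frechet[OF assms(1,2)]
  show "(f has_derivative frechet_derivative f (at p)) (at p)" if "p \<in> U" for p
    using s(1)[OF that] by (simp add: frechet_derivative_works)
  show "((\<lambda>\<mu>. frechet_derivative f (at \<mu>) 1) has_derivative
      frechet_derivative (\<lambda>\<mu>. frechet_derivative f (at \<mu>) 1) (at p)) (at p)" if "p \<in> U" for p
    using smooth_on_frechet(1)[OF s(2) assms(2) that] by (simp add: frechet_derivative_works)
  show "((\<lambda>\<mu>. frechet_derivative f (at \<mu>) \<i>) has_derivative
      frechet_derivative (\<lambda>\<mu>. frechet_derivative f (at \<mu>) \<i>) (at p)) (at p)" if "p \<in> U" for p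
    using smooth_on_frechet(1)[OF s(3) assms(2) that] by (simp add: frechet_derivative_works)
  show "continuous_on U (\<lambda>p. frechet_derivative (\<lambda>\<mu>. frechet_derivative f (at \<mu>) 1) (at p) \<i>)"
    "continuous_on U (\<lambda>p. frechet_derivative (\<lambda>\<mu>. frechet_derivative f (at \<mu>) \<i>) (at p) 1)"
    using smooth_on_frechet(3)[OF s(2) assms(2)] smooth_on_frechet(2)[OF s(3) assms(2)]
    by (auto intro: smooth_on_imp_continuous_on)
qed

lemma frechet_derivative_bounded_linear:
  assumes "bounded_linear L" "f differentiable at \<mu>"
  shows "frechet_derivative (\<lambda>\<mu>. L (f \<mu>)) (at \<mu>) h = L (frechet_derivative f (at \<mu>) h)"
proof -
  have "((\<lambda>\<mu>. L (f \<mu>)) has_derivative (\<lambda>h. L (frechet_derivative f (at \<mu>) h))) (at \<mu>)"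
    using assms by (intro bounded_linear.has_derivative[OF assms(1)])
      (simp add: frechet_derivative_works[symmetric])
  from frechet_derivative_at[OF this] show ?thesis by metis
qed

lemma frechet_derivative_cong:
  assumes "open U" "\<mu> \<in> U" "\<And>\<nu>. \<nu> \<in> U \<Longrightarrow> f \<nu> = g \<nu>"
  shows "frechet_derivative f (at \<mu>) = frechet_derivative g (at \<mu>)"
proof -
  have "(f has_derivative D) (at \<mu>) \<longleftrightarrow> (g has_derivative D) (at \<mu>)" for D
    using has_derivative_transform_within_open[OF _ assms(1,2), of f D UNIV g]
      has_derivative_transform_within_open[OF _ assms(1,2), of g D UNIV f] assms(3) by auto
  then show ?thesis unfolding frechet_derivative_def by simp
qed

text \<open>The mean value argument behind the symmetry is real, so real and imaginary part are
  treated separately, as bounded linear images of \<open>f\<close>.\<close>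

lemma frechet_derivative_commute:
  fixes f :: "complex \<Rightarrow> complex"
  assumes f: "smooth_on U f" "open U" "\<mu> \<in> U"
  shows "frechet_derivative (\<lambda>\<mu>. frechet_derivative f (at \<mu>) 1) (at \<mu>) \<i>
    = frechet_derivative (\<lambda>\<mu>. frechet_derivative f (at \<mu>) \<i>) (at \<mu>) 1"
proof -
  note s = smooth_on_frechet[OF assms(1,2)]
  have "L (frechet_derivative (\<lambda>\<mu>. frechet_derivative f (at \<mu>) 1) (at \<mu>) \<i>)
    = L (frechet_derivative (\<lambda>\<mu>. frechet_derivative f (at \<mu>) \<i>) (at \<mu>) 1)"
    if L: "bounded_linear L" for L :: "complex \<Rightarrow> real"
  proof -
    have L1: "L (frechet_derivative (\<lambda>\<mu>. frechet_derivative f (at \<mu>) h) (at \<mu>) k)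
      = frechet_derivative (\<lambda>\<mu>. frechet_derivative (\<lambda>\<mu>. L (f \<mu>)) (at \<mu>) h) (at \<mu>) k"
      if h: "smooth_on U (\<lambda>\<mu>. frechet_derivative f (at \<mu>) h)" for h k
    proof -
      have "frechet_derivative (\<lambda>\<mu>. frechet_derivative (\<lambda>\<mu>. L (f \<mu>)) (at \<mu>) h) (at \<mu>)
          = frechet_derivative (\<lambda>\<mu>. L (frechet_derivative f (at \<mu>) h)) (at \<mu>)"
        by (rule frechet_derivative_cong[OF f(2,3)])
          (simp add: frechet_derivative_bounded_linear[OF L] s(1))
      then show ?thesis
        using frechet_derivative_bounded_linear[OF L smooth_on_frechet(1)[OF h f(2,3)]] by simp
    qed
    show ?thesis
      unfolding L1[OF s(2)] L1[OF s(3)]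
      by (rule frechet_derivative_commute_real[OF smooth_on_bounded_linear[OF L f(1)] f(2,3)])
  qed
  from this[OF bounded_linear_Re] this[OF bounded_linear_Im] show ?thesis
    by (rule complex_eqI)
qed

section \<open>Wirtinger calculus\<close>

lemma wirt_eqI:
  assumes "(f has_derivative D) (at \<mu>)"
  shows "wirt f \<mu> = (1/2) *\<^sub>C (D 1 - \<i> *\<^sub>C D \<i>)" "wirt_bar f \<mu> = (1/2) *\<^sub>C (D 1 + \<i> *\<^sub>C D \<i>)"
  using frechet_derivative_at[OF assms] by (simp_all add: wirt_def wirt_bar_def)

lemma wirt_add:
  assumes "f differentiable at \<mu>" "g differentiable at \<mu>"
  shows "wirt (\<lambda>\<nu>. f \<nu> + g \<nu>) \<mu> = wirt f \<mu> + wirt g \<mu>"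
    "wirt_bar (\<lambda>\<nu>. f \<nu> + g \<nu>) \<mu> = wirt_bar f \<mu> + wirt_bar g \<mu>"
proof -
  note d = has_derivative_add[OF assms[unfolded frechet_derivative_works]]
  show "wirt (\<lambda>\<nu>. f \<nu> + g \<nu>) \<mu> = wirt f \<mu> + wirt g \<mu>"
    "wirt_bar (\<lambda>\<nu>. f \<nu> + g \<nu>) \<mu> = wirt_bar f \<mu> + wirt_bar g \<mu>"
    unfolding wirt_eqI[OF d] unfolding wirt_def wirt_bar_def
    by (simp_all add: scaleC_add_right scaleC_diff_right)
qed

lemma wirt_scaleC:
  fixes f :: "complex \<Rightarrow> complex" and g :: "complex \<Rightarrow> 'a::complex_inner"
  assumes "f differentiable at \<mu>" "g differentiable at \<mu>"
  shows "wirt (\<lambda>\<nu>. f \<nu> *\<^sub>C g \<nu>) \<mu> = wirt f \<mu> *\<^sub>C g \<mu> + f \<mu> *\<^sub>C wirt g \<mu>"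
    "wirt_bar (\<lambda>\<nu>. f \<nu> *\<^sub>C g \<nu>) \<mu> = wirt_bar f \<mu> *\<^sub>C g \<mu> + f \<mu> *\<^sub>C wirt_bar g \<mu>"
proof -
  note d = bounded_bilinear.FDERIV[OF bounded_bilinear_scaleC assms[unfolded frechet_derivative_works]]
  show "wirt (\<lambda>\<nu>. f \<nu> *\<^sub>C g \<nu>) \<mu> = wirt f \<mu> *\<^sub>C g \<mu> + f \<mu> *\<^sub>C wirt g \<mu>"
    "wirt_bar (\<lambda>\<nu>. f \<nu> *\<^sub>C g \<nu>) \<mu> = wirt_bar f \<mu> *\<^sub>C g \<mu> + f \<mu> *\<^sub>C wirt_bar g \<mu>"
    unfolding wirt_eqI[OF d] unfolding wirt_def wirt_bar_def scaleC_complex_def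
    by (simp_all add: scaleC_add_right scaleC_diff_right scaleC_scaleC scaleC_add_left
        scaleC_diff_left mult_ac distrib_left right_diff_distrib)
qed

lemma wirt_cinner:
  fixes f g :: "complex \<Rightarrow> 'a::complex_inner"
  assumes "f differentiable at \<mu>" "g differentiable at \<mu>"
  shows "wirt (\<lambda>\<nu>. cinner (f \<nu>) (g \<nu>)) \<mu> = cinner (wirt f \<mu>) (g \<mu>) + cinner (f \<mu>) (wirt_bar g \<mu>)"
    "wirt_bar (\<lambda>\<nu>. cinner (f \<nu>) (g \<nu>)) \<mu> = cinner (wirt_bar f \<mu>) (g \<mu>) + cinner (f \<mu>) (wirt g \<mu>)"
proof -
  note d = bounded_bilinear.FDERIV[OF bounded_bilinear_cinner assms[unfolded frechet_derivative_works]]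
  show "wirt (\<lambda>\<nu>. cinner (f \<nu>) (g \<nu>)) \<mu> = cinner (wirt f \<mu>) (g \<mu>) + cinner (f \<mu>) (wirt_bar g \<mu>)"
    "wirt_bar (\<lambda>\<nu>. cinner (f \<nu>) (g \<nu>)) \<mu> = cinner (wirt_bar f \<mu>) (g \<mu>) + cinner (f \<mu>) (wirt g \<mu>)"
    unfolding wirt_eqI[OF d] unfolding wirt_def wirt_bar_def
    by (simp_all add: scaleC_complex_def cinner_add_left cinner_add_right cinner_diff_left
        cinner_diff_right cinner_scaleC_left cinner_scaleC_right algebra_simps)
qed

lemma wirt_cong:
  assumes "open U" "\<mu> \<in> U" "\<And>\<nu>. \<nu> \<in> U \<Longrightarrow> f \<nu> = g \<nu>"
  shows "wirt f \<mu> = wirt g \<mu>" "wirt_bar f \<mu> = wirt_bar g \<mu>"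
  by (simp_all add: wirt_def wirt_bar_def frechet_derivative_cong[OF assms])

lemma wirt_zero: "wirt (\<lambda>_. 0) \<mu> = 0" "wirt_bar (\<lambda>_. 0) \<mu> = 0"
  using wirt_eqI[OF has_derivative_const[of 0 "at \<mu>"]] by simp_all

lemma wirt_sum:
  assumes "\<And>i. i \<in> I \<Longrightarrow> f i differentiable at \<mu>"
  shows "wirt (\<lambda>\<nu>. \<Sum>i\<in>I. f i \<nu>) \<mu> = (\<Sum>i\<in>I. wirt (f i) \<mu>)"
    "wirt_bar (\<lambda>\<nu>. \<Sum>i\<in>I. f i \<nu>) \<mu> = (\<Sum>i\<in>I. wirt_bar (f i) \<mu>)"
  using assms
  by (induction I rule: infinite_finite_induct) (simp_all add: wirt_zero wirt_add differentiable_sum)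

lemma smooth_on_wirt:
  assumes "smooth_on U f" "open U"
  shows "smooth_on U (wirt f)" "smooth_on U (wirt_bar f)"
proof -
  note scale = smooth_on_bounded_linear[OF bounded_linear_scaleC_right]
  note d = smooth_on_frechet(2,3)[OF assms]
  show "smooth_on U (wirt f)"
    unfolding wirt_def[abs_def] by (rule scale[OF smooth_on_diff[OF d(1) scale[OF d(2)]]])
  show "smooth_on U (wirt_bar f)"
    unfolding wirt_bar_def[abs_def] by (rule scale[OF smooth_on_add[OF d(1) scale[OF d(2)]]])
qed

lemma wirt_antiholomorphic: "antiholomorphic_on U f \<Longrightarrow> \<mu> \<in> U \<Longrightarrow> wirt f \<mu> = 0"
proof -
  assume "antiholomorphic_on U f" "\<mu> \<in> U"
  then obtain d where "(f has_derivative (\<lambda>h. cnj h *\<^sub>C d)) (at \<mu>)"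
    unfolding antiholomorphic_on_def by blast
  from wirt_eqI(1)[OF this] show ?thesis by (simp add: scaleC_scaleC)
qed

text \<open>Both sides are a quarter of the Laplacian: the two terms with mixed second derivatives
  cancel by symmetry.\<close>

lemma wirt_commute:
  fixes f :: "complex \<Rightarrow> complex"
  assumes "smooth_on U f" "open U" "\<mu> \<in> U"
  shows "wirt (wirt_bar f) \<mu> = wirt_bar (wirt f) \<mu>"
proof -
  let ?x = "\<lambda>\<mu>. frechet_derivative f (at \<mu>) 1" and ?y = "\<lambda>\<mu>. frechet_derivative f (at \<mu>) \<i>"
  note s = smooth_on_frechet(2,3)[OF assms(1,2)]
  note d = smooth_on_frechet(1)[OF s(1) assms(2,3), unfolded frechet_derivative_works]
    smooth_on_frechet(1)[OF s(2) assms(2,3), unfolded frechet_derivative_works]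
  have "((\<lambda>\<mu>. (1/2) * (?x \<mu> + c * ?y \<mu>)) has_derivative
      (\<lambda>h. (1/2) * (frechet_derivative ?x (at \<mu>) h + c * frechet_derivative ?y (at \<mu>) h))) (at \<mu>)" for c
    by (auto intro!: derivative_eq_intros d)
  \<comment> \<open>The choice \<open>\<i>\<close> gives the function \<open>wirt_bar f\<close>, and
    \<open>- \<i>\<close> gives \<open>wirt f\<close>.\<close>
  note D = this[of "\<i>", folded scaleC_complex_def] this[of "- \<i>", folded scaleC_complex_def]
  have "wirt f = (\<lambda>\<mu>. (1/2) *\<^sub>C (?x \<mu> + (- \<i>) *\<^sub>C ?y \<mu>))"
    "wirt_bar f = (\<lambda>\<mu>. (1/2) *\<^sub>C (?x \<mu> + \<i> *\<^sub>C ?y \<mu>))"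
    by (simp_all add: wirt_def[abs_def] wirt_bar_def[abs_def] scaleC_minus_left)
  then show ?thesis
    using wirt_eqI(1)[OF D(1)] wirt_eqI(2)[OF D(2)] frechet_derivative_commute[OF assms]
    by (simp add: scaleC_complex_def algebra_simps)
qed

section \<open>Bundles with an orthogonal conformal frame\<close>

lemma smooth_section_subset:
  "smooth_section U E \<sigma> \<Longrightarrow> V \<subseteq> U \<Longrightarrow> smooth_section V E \<sigma>"
  unfolding smooth_section_def using smooth_on_subset by blast

lemma connectionD:
  assumes "is_connection G E D1 D2" "open U" "U \<subseteq> G" "\<mu> \<in> U" "smooth_section U E \<sigma>"
  shows "smooth_section U E (D1 \<sigma>)" "smooth_section U E (D2 \<sigma>)"
    and "smooth_section U E \<tau> \<Longrightarrow> D1 (\<lambda>\<nu>. \<sigma> \<nu> + \<tau> \<nu>) \<mu> = D1 \<sigma> \<mu> + D1 \<tau> \<mu>"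
      "smooth_section U E \<tau> \<Longrightarrow> D2 (\<lambda>\<nu>. \<sigma> \<nu> + \<tau> \<nu>) \<mu> = D2 \<sigma> \<mu> + D2 \<tau> \<mu>"
    and "(\<And>\<nu>. \<nu> \<in> U \<Longrightarrow> \<sigma> \<nu> = \<tau> \<nu>) \<Longrightarrow> D1 \<tau> \<mu> = D1 \<sigma> \<mu>"
      "(\<And>\<nu>. \<nu> \<in> U \<Longrightarrow> \<sigma> \<nu> = \<tau> \<nu>) \<Longrightarrow> D2 \<tau> \<mu> = D2 \<sigma> \<mu>"
    and "smooth_on U f \<Longrightarrow> D1 (\<lambda>\<nu>. f \<nu> *\<^sub>C \<sigma> \<nu>) \<mu> = wirt f \<mu> *\<^sub>C \<sigma> \<mu> + f \<mu> *\<^sub>C D1 \<sigma> \<mu>"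
      "smooth_on U f \<Longrightarrow> D2 (\<lambda>\<nu>. f \<nu> *\<^sub>C \<sigma> \<nu>) \<mu> = wirt_bar f \<mu> *\<^sub>C \<sigma> \<mu> + f \<mu> *\<^sub>C D2 \<sigma> \<mu>"
proof -
  note c = assms(1)[unfolded is_connection_def, rule_format, OF conjI[OF assms(2,3)]]
  note c1 = c[THEN conjunct1] and c2 = c[THEN conjunct2, THEN conjunct1]
    and c3 = c[THEN conjunct2, THEN conjunct2, THEN conjunct1]
    and c4 = c[THEN conjunct2, THEN conjunct2, THEN conjunct2]
  show "smooth_section U E (D1 \<sigma>)" "smooth_section U E (D2 \<sigma>)" using c1 assms(5) by auto
  show "smooth_section U E \<tau> \<Longrightarrow> D1 (\<lambda>\<nu>. \<sigma> \<nu> + \<tau> \<nu>) \<mu> = D1 \<sigma> \<mu> + D1 \<tau> \<mu>"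
      "smooth_section U E \<tau> \<Longrightarrow> D2 (\<lambda>\<nu>. \<sigma> \<nu> + \<tau> \<nu>) \<mu> = D2 \<sigma> \<mu> + D2 \<tau> \<mu>"
    using c2[rule_format, OF conjI[OF assms(5)] assms(4)] by auto
  show "(\<And>\<nu>. \<nu> \<in> U \<Longrightarrow> \<sigma> \<nu> = \<tau> \<nu>) \<Longrightarrow> D1 \<tau> \<mu> = D1 \<sigma> \<mu>"
      "(\<And>\<nu>. \<nu> \<in> U \<Longrightarrow> \<sigma> \<nu> = \<tau> \<nu>) \<Longrightarrow> D2 \<tau> \<mu> = D2 \<sigma> \<mu>"
    using c3[rule_format, of \<sigma> \<tau>, OF conjI[OF assms(5)] assms(4)] by auto
  show "smooth_on U f \<Longrightarrow> D1 (\<lambda>\<nu>. f \<nu> *\<^sub>C \<sigma> \<nu>) \<mu> = wirt f \<mu> *\<^sub>C \<sigma> \<mu> + f \<mu> *\<^sub>C D1 \<sigma> \<mu>"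
      "smooth_on U f \<Longrightarrow> D2 (\<lambda>\<nu>. f \<nu> *\<^sub>C \<sigma> \<nu>) \<mu> = wirt_bar f \<mu> *\<^sub>C \<sigma> \<mu> + f \<mu> *\<^sub>C D2 \<sigma> \<mu>"
    using c4[rule_format, of f \<sigma>, OF conjI[OF _ assms(5)] assms(4)] by auto
qed

lemma smooth_section_scaleC:
  assumes "\<And>\<mu>. \<mu> \<in> U \<Longrightarrow> csubspace (E \<mu>)" "smooth_on U f" "smooth_section U E \<sigma>"
  shows "smooth_section U E (\<lambda>\<nu>. f \<nu> *\<^sub>C \<sigma> \<nu>)"
  using assms unfolding smooth_section_def by (auto intro: smooth_on_scaleC csubspace_scale)

lemma smooth_section_add:
  assumes "\<And>\<mu>. \<mu> \<in> U \<Longrightarrow> csubspace (E \<mu>)" "smooth_section U E \<sigma>" "smooth_section U E \<tau>"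
  shows "smooth_section U E (\<lambda>\<nu>. \<sigma> \<nu> + \<tau> \<nu>)"
  using assms unfolding smooth_section_def by (auto intro: smooth_on_add csubspace_add)

text \<open>The second-order terms of \<open>f\<close> cancel, as the Wirtinger derivatives commute.\<close>

lemma curvature_scaleC:
  assumes conn: "is_connection G E D1 D2" and U: "open U" "U \<subseteq> G"
    and E: "\<And>\<mu>. \<mu> \<in> G \<Longrightarrow> csubspace (E \<mu>)"
    and f: "smooth_on U f" and \<sigma>: "smooth_section U E \<sigma>" and \<mu>: "\<mu> \<in> U"
  shows "curvature D1 D2 (\<lambda>\<nu>. f \<nu> *\<^sub>C \<sigma> \<nu>) \<mu> = f \<mu> *\<^sub>C curvature D1 D2 \<sigma> \<mu>"
proof -
  note c = connectionD[OF conn U]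
  have E': "csubspace (E \<mu>)" if "\<mu> \<in> U" for \<mu> using E U(2) that by auto
  note fx = smooth_on_wirt(1)[OF f U(1)] and fy = smooth_on_wirt(2)[OF f U(1)]
  note D1\<sigma> = c(1)[OF \<mu> \<sigma>] and D2\<sigma> = c(2)[OF \<mu> \<sigma>]
  have "D1 (D2 (\<lambda>\<nu>. f \<nu> *\<^sub>C \<sigma> \<nu>)) \<mu> = D1 (\<lambda>\<nu>. wirt_bar f \<nu> *\<^sub>C \<sigma> \<nu> + f \<nu> *\<^sub>C D2 \<sigma> \<nu>) \<mu>"
    by (rule c(5)[OF \<mu>]) (auto intro!: smooth_section_add smooth_section_scaleC fy f \<sigma> D2\<sigma> E' simp: c(8)[OF _ \<sigma> f])
  also have "\<dots> = wirt (wirt_bar f) \<mu> *\<^sub>C \<sigma> \<mu> + wirt_bar f \<mu> *\<^sub>C D1 \<sigma> \<mu>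
      + (wirt f \<mu> *\<^sub>C D2 \<sigma> \<mu> + f \<mu> *\<^sub>C D1 (D2 \<sigma>) \<mu>)"
    by (subst c(3)[OF \<mu>])
      (auto intro!: smooth_section_scaleC fy f \<sigma> D2\<sigma> E' simp: c(7)[OF \<mu> \<sigma> fy] c(7)[OF \<mu> D2\<sigma> f])
  finally have 1: "D1 (D2 (\<lambda>\<nu>. f \<nu> *\<^sub>C \<sigma> \<nu>)) \<mu> = \<dots>" .
  have "D2 (D1 (\<lambda>\<nu>. f \<nu> *\<^sub>C \<sigma> \<nu>)) \<mu> = D2 (\<lambda>\<nu>. wirt f \<nu> *\<^sub>C \<sigma> \<nu> + f \<nu> *\<^sub>C D1 \<sigma> \<nu>) \<mu>"
    by (rule c(6)[OF \<mu>]) (auto intro!: smooth_section_add smooth_section_scaleC fx f \<sigma> D1\<sigma> E' simp: c(7)[OF _ \<sigma> f])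
  also have "\<dots> = wirt_bar (wirt f) \<mu> *\<^sub>C \<sigma> \<mu> + wirt f \<mu> *\<^sub>C D2 \<sigma> \<mu>
      + (wirt_bar f \<mu> *\<^sub>C D1 \<sigma> \<mu> + f \<mu> *\<^sub>C D2 (D1 \<sigma>) \<mu>)"
    by (subst c(4)[OF \<mu>])
      (auto intro!: smooth_section_scaleC fx f \<sigma> D1\<sigma> E' simp: c(8)[OF \<mu> \<sigma> fx] c(8)[OF \<mu> D1\<sigma> f])
  finally have 2: "D2 (D1 (\<lambda>\<nu>. f \<nu> *\<^sub>C \<sigma> \<nu>)) \<mu> = \<dots>" .
  show ?thesis
    unfolding curvature_def 1 2 wirt_commute[OF f U(1) \<mu>] by (simp add: scaleC_diff_right)
qed

lemma curvature_add:
  assumes conn: "is_connection G E D1 D2" and U: "open U" "U \<subseteq> G"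
    and E: "\<And>\<mu>. \<mu> \<in> G \<Longrightarrow> csubspace (E \<mu>)"
    and \<sigma>: "smooth_section U E \<sigma>" and \<tau>: "smooth_section U E \<tau>" and \<mu>: "\<mu> \<in> U"
  shows "curvature D1 D2 (\<lambda>\<nu>. \<sigma> \<nu> + \<tau> \<nu>) \<mu> = curvature D1 D2 \<sigma> \<mu> + curvature D1 D2 \<tau> \<mu>"
proof -
  note c = connectionD[OF conn U]
  have E': "csubspace (E \<mu>)" if "\<mu> \<in> U" for \<mu> using E U(2) that by auto
  have "D1 (D2 (\<lambda>\<nu>. \<sigma> \<nu> + \<tau> \<nu>)) \<mu> = D1 (\<lambda>\<nu>. D2 \<sigma> \<nu> + D2 \<tau> \<nu>) \<mu>"
    by (rule c(5)[OF \<mu>]) (auto intro!: smooth_section_add E' c(2)[OF \<mu> \<sigma>] c(2)[OF \<mu> \<tau>] simp: c(4)[OF _ \<sigma> \<tau>])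
  moreover have "D2 (D1 (\<lambda>\<nu>. \<sigma> \<nu> + \<tau> \<nu>)) \<mu> = D2 (\<lambda>\<nu>. D1 \<sigma> \<nu> + D1 \<tau> \<nu>) \<mu>"
    by (rule c(6)[OF \<mu>]) (auto intro!: smooth_section_add E' c(1)[OF \<mu> \<sigma>] c(1)[OF \<mu> \<tau>] simp: c(3)[OF _ \<sigma> \<tau>])
  ultimately show ?thesis
    unfolding curvature_def
    by (simp add: c(3)[OF \<mu> c(2)[OF \<mu> \<sigma>] c(2)[OF \<mu> \<tau>]] c(4)[OF \<mu> c(1)[OF \<mu> \<sigma>] c(1)[OF \<mu> \<tau>]])
qed


section \<open>The matrix algebra of a single scalar block\<close>

lemma diag_block_mat_replicate:
  fixes A :: "complex mat"
  assumes "A \<in> carrier_mat 1 1"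
  shows "diag_block_mat (replicate n A) = A $$ (0, 0) \<cdot>\<^sub>m 1\<^sub>m n"
proof (induction n)
  case (Suc n)
  have "dim_row A = 1" "dim_col A = 1" using assms by auto
  then show ?case
    by (simp add: Suc four_block_mat_def Let_def) (rule eq_matI, auto)
qed (auto intro!: eq_matI)

lemma block_algebra_scalar: "block_algebra [1] [n] = {c \<cdot>\<^sub>m 1\<^sub>m n | c. True}"
proof -
  have "block_algebra [1] [n] = {diag_block_mat (replicate n A) | A. A \<in> carrier_mat 1 1}"
    unfolding block_algebra_def
    by (auto simp: length_Suc_conv) (rule exI[of _ "[_]"], simp)
  also have "\<dots> = {c \<cdot>\<^sub>m 1\<^sub>m n | c. True}"
  proof (intro subset_antisym subsetI)
    fix X assume "X \<in> {diag_block_mat (replicate n A) | A :: complex mat. A \<in> carrier_mat 1 1}"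
    then show "X \<in> {c \<cdot>\<^sub>m 1\<^sub>m n | c. True}"
      using diag_block_mat_replicate by blast
  next
    fix X :: "complex mat" assume "X \<in> {c \<cdot>\<^sub>m 1\<^sub>m n | c. True}"
    then obtain c where "X = c \<cdot>\<^sub>m 1\<^sub>m n" by blast
    moreover have "mat 1 1 (\<lambda>_. c) \<in> carrier_mat 1 1" by simp
    moreover note diag_block_mat_replicate[OF this, of n]
    ultimately have "X = diag_block_mat (replicate n (mat 1 1 (\<lambda>_. c))) \<and> mat 1 1 (\<lambda>_. c) \<in> carrier_mat 1 1"
      by simp
    then show "X \<in> {diag_block_mat (replicate n A) | A. A \<in> carrier_mat 1 1}" by blast
  qed
  finally show ?thesis .
qed

section \<open>The canonical connection in an orthogonal frame of equal norms\<close>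

lemma antiholomorphic_on_imp_differentiable:
  "antiholomorphic_on U f \<Longrightarrow> \<mu> \<in> U \<Longrightarrow> f differentiable at \<mu>"
  unfolding antiholomorphic_on_def differentiable_def by blast

text \<open>Orthogonality and equal norms say that the Gram matrix is a scalar function times the
  identity. Smoothness is a separate assumption because \<open>antiholomorphic_on\<close> asks only
  for a first derivative; in the application both come from a power series.\<close>

locale conformal_frame =
  fixes n :: nat and G :: "complex set" and E :: "complex \<Rightarrow> 'a::complex_inner set"
    and e :: "nat \<Rightarrow> complex \<Rightarrow> 'a"
  assumes n_pos: "0 < n" and open_G: "open G"
    and frame: "antiholomorphic_frame n G E e"
    and smooth_e: "j < n \<Longrightarrow> smooth_on G (e j)"
    and orth_e: "orthogonal_family n G e"
    and norm_e: "\<mu> \<in> G \<Longrightarrow> j < n \<Longrightarrow> cinner (e j \<mu>) (e j \<mu>) = cinner (e 0 \<mu>) (e 0 \<mu>)"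
begin

definition h where "h \<mu> = cinner (e 0 \<mu>) (e 0 \<mu>)"
text \<open>The inverse square root of \<open>h\<close>, real but of complex type so that it can
  multiply the frame vectors.\<close>

definition u :: "complex \<Rightarrow> complex" where "u \<mu> = of_real (1 / sqrt (inner (e 0 \<mu>) (e 0 \<mu>)))"
definition s where "s j \<mu> = u \<mu> *\<^sub>C e j \<mu>"
text \<open>Over \<open>G\<close> this is the orthogonal projection onto the fibre
  \<open>E \<mu>\<close>, written out in a frame so that its smooth dependence on
  \<open>\<mu>\<close> is visible.\<close>

definition P where "P \<mu> x = (\<Sum>j<n. cinner x (s j \<mu>) *\<^sub>C s j \<mu>)"

abbreviation "D1 \<equiv> wirt"
text \<open>The antiholomorphic analogue of the Chern connection of a subbundle: the derivative is
  taken in the fixed ambient space and projected back to the fibre. \<open>D1\<close> needs no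
  projection, as \<open>wirt\<close> already preserves sections.\<close>

definition D2 :: "(complex \<Rightarrow> 'a) \<Rightarrow> complex \<Rightarrow> 'a" where "D2 \<sigma> \<mu> = P \<mu> (wirt_bar \<sigma> \<mu>)"

lemma e_basis: "\<mu> \<in> G \<Longrightarrow> basis_family n (\<lambda>j. e j \<mu>) (E \<mu>)"
  using frame by (simp add: antiholomorphic_frame_def)

lemma E_eq: "\<mu> \<in> G \<Longrightarrow> E \<mu> = cspan ((\<lambda>j. e j \<mu>) ` {..<n})"
  using e_basis by (simp add: basis_family_def)

lemma csubspace_E: "\<mu> \<in> G \<Longrightarrow> csubspace (E \<mu>)"
  by (simp add: E_eq complex_vec.subspace_span)

lemma e_in: "\<mu> \<in> G \<Longrightarrow> j < n \<Longrightarrow> e j \<mu> \<in> E \<mu>"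
  by (auto simp: E_eq intro: complex_vec.span_base)

lemma e_nonzero: "\<mu> \<in> G \<Longrightarrow> j < n \<Longrightarrow> e j \<mu> \<noteq> 0"
proof
  assume \<mu>: "\<mu> \<in> G" and j: "j < n" and "e j \<mu> = 0"
  then have "0 \<in> (\<lambda>j. e j \<mu>) ` {..<n}" by (intro image_eqI[of _ _ j]) auto
  then have "cdependent ((\<lambda>j. e j \<mu>) ` {..<n})" by (rule complex_vec.dependent_zero)
  then show False using e_basis[OF \<mu>] by (simp add: basis_family_def)
qed

lemma e_antiholomorphic: "j < n \<Longrightarrow> antiholomorphic_on G (e j)"
  using frame by (simp add: antiholomorphic_frame_def antiholomorphic_section_def)

lemma wirt_e: "\<mu> \<in> G \<Longrightarrow> j < n \<Longrightarrow> wirt (e j) \<mu> = 0"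
  using wirt_antiholomorphic[OF e_antiholomorphic] .

lemma smooth_section_e: "j < n \<Longrightarrow> smooth_section G E (e j)"
  by (simp add: smooth_section_def smooth_e e_in)

lemma inner_e_pos: "\<mu> \<in> G \<Longrightarrow> 0 < inner (e 0 \<mu>) (e 0 \<mu>)"
  using e_nonzero n_pos by simp

lemma u_nonzero: "\<mu> \<in> G \<Longrightarrow> u \<mu> \<noteq> 0"
  using e_nonzero n_pos by (simp add: u_def)

lemma cnj_u: "cnj (u \<mu>) = u \<mu>" by (simp add: u_def)

lemma h_eq: "h \<mu> = of_real (inner (e 0 \<mu>) (e 0 \<mu>))"
  unfolding h_def cinner_self_norm power2_norm_eq_inner ..

lemma u_u_h: "\<mu> \<in> G \<Longrightarrow> u \<mu> * u \<mu> * h \<mu> = 1"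
proof -
  define r where "r = inner (e 0 \<mu>) (e 0 \<mu>)"
  assume "\<mu> \<in> G"
  then have "r > 0" unfolding r_def by (rule inner_e_pos)
  then have "1 / sqrt r * (1 / sqrt r) * r = 1" by simp
  then show ?thesis
    unfolding u_def h_eq r_def[symmetric] of_real_mult[symmetric] by (simp only: of_real_1)
qed

lemma smooth_u: "smooth_on G u"
proof -
  have "smooth_on G (\<lambda>\<mu>. Re (cinner (e 0 \<mu>) (e 0 \<mu>)))"
    by (intro smooth_on_bounded_linear[OF bounded_linear_Re] smooth_on_cinner smooth_e n_pos)
  then have "smooth_on G (\<lambda>\<mu>. inner (e 0 \<mu>) (e 0 \<mu>))"
    by (simp add: inner_eq_Re_cinner)
  then have "Ck_on k G (\<lambda>\<mu>. 1 / sqrt (inner (e 0 \<mu>) (e 0 \<mu>)))" for k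
    unfolding smooth_on_def by (intro Ck_on_inverse_sqrt[OF inner_e_pos]) simp_all
  then have "smooth_on G (\<lambda>\<mu>. 1 / sqrt (inner (e 0 \<mu>) (e 0 \<mu>)))"
    by (simp add: smooth_on_def)
  then show ?thesis
    unfolding u_def[abs_def] by (rule smooth_on_bounded_linear[OF bounded_linear_of_real])
qed

lemma s_orthonormal: "\<mu> \<in> G \<Longrightarrow> i < n \<Longrightarrow> j < n \<Longrightarrow> cinner (s i \<mu>) (s j \<mu>) = (if i = j then 1 else 0)"
proof -
  assume \<mu>: "\<mu> \<in> G" and ij: "i < n" "j < n"
  have "cinner (s i \<mu>) (s j \<mu>) = u \<mu> * u \<mu> * cinner (e i \<mu>) (e j \<mu>)"
    by (simp add: s_def cinner_scaleC_left cinner_scaleC_right cnj_u)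
  moreover have "cinner (e i \<mu>) (e j \<mu>) = (if i = j then h \<mu> else 0)"
    using orth_e norm_e[OF \<mu> ij(1)] \<mu> ij by (cases "i = j") (simp_all add: orthogonal_family_def h_def)
  ultimately show ?thesis using u_u_h[OF \<mu>] by simp
qed

lemma s_in: "\<mu> \<in> G \<Longrightarrow> j < n \<Longrightarrow> s j \<mu> \<in> E \<mu>"
  by (simp add: s_def csubspace_scale csubspace_E e_in)

lemma P_in: "\<mu> \<in> G \<Longrightarrow> P \<mu> x \<in> E \<mu>"
  unfolding P_def by (auto intro!: csubspace_sum csubspace_scale csubspace_E s_in)

lemma P_add: "P \<mu> (x + y) = P \<mu> x + P \<mu> y"
  by (simp add: P_def cinner_add_left scaleC_add_left sum.distrib)

lemma P_scaleC: "P \<mu> (c *\<^sub>C x) = c *\<^sub>C P \<mu> x"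
  by (simp add: P_def cinner_scaleC_left scaleC_sum_right scaleC_scaleC)

lemma P_zero [simp]: "P \<mu> 0 = 0" by (simp add: P_def)

lemma P_s: "\<mu> \<in> G \<Longrightarrow> i < n \<Longrightarrow> P \<mu> (s i \<mu>) = s i \<mu>"
  by (simp add: P_def s_orthonormal if_distrib[of "\<lambda>c. c *\<^sub>C _"] sum.delta cong: if_cong)

lemma e_eq_s: "\<mu> \<in> G \<Longrightarrow> e i \<mu> = (1 / u \<mu>) *\<^sub>C s i \<mu>"
  by (simp add: s_def scaleC_scaleC u_nonzero)

lemma P_fix:
  assumes "\<mu> \<in> G" "x \<in> E \<mu>" shows "P \<mu> x = x"
proof -
  have "csubspace {x. P \<mu> x = x}"
    by (rule csubspaceI) (simp_all add: P_add P_scaleC)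
  moreover have "(\<lambda>j. e j \<mu>) ` {..<n} \<subseteq> {x. P \<mu> x = x}"
    using assms(1) by (auto simp: e_eq_s P_scaleC P_s)
  ultimately show ?thesis
    using complex_vec.span_minimal assms unfolding E_eq[OF assms(1)] by blast
qed

lemma cinner_P: "cinner (P \<mu> x) y = cinner x (P \<mu> y)"
  unfolding P_def cinner_sum_left cinner_sum_right cinner_scaleC_left cinner_scaleC_right
    cinner_commute[of "s j \<mu>" y for j]
  by (intro sum.cong refl) simp

lemma smooth_s: "j < n \<Longrightarrow> smooth_on G (s j)"
  unfolding s_def[abs_def] by (intro smooth_on_scaleC smooth_u smooth_e)

lemma smooth_P:
  assumes "smooth_on U f" "U \<subseteq> G" shows "smooth_on U (\<lambda>\<mu>. P \<mu> (f \<mu>))"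
  unfolding P_def
  by (intro smooth_on_sum smooth_on_scaleC smooth_on_cinner assms)
    (use smooth_on_subset[OF smooth_s assms(2)] in auto)

text \<open>A section is its own projection, so its coordinates in \<open>s\<close> are inner
  products; the factor \<open>u \<mu>\<close> converts them to the frame \<open>e\<close>, which is
  preferred because \<open>wirt\<close> annihilates it.\<close>

lemma coordinates:
  assumes "smooth_section U E \<sigma>" "open U" "U \<subseteq> G"
  obtains f where "\<And>j. j < n \<Longrightarrow> smooth_on U (f j)" "\<And>\<mu>. \<mu> \<in> U \<Longrightarrow> \<sigma> \<mu> = (\<Sum>j<n. f j \<mu> *\<^sub>C e j \<mu>)"
proof
  show "smooth_on U (\<lambda>\<mu>. cinner (\<sigma> \<mu>) (s j \<mu>) * u \<mu>)" if "j < n" for j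
    using assms that smooth_on_subset[OF smooth_s assms(3)] smooth_on_subset[OF smooth_u assms(3)]
    by (intro smooth_on_mult smooth_on_cinner) (auto simp: smooth_section_def)
  show "\<sigma> \<mu> = (\<Sum>j<n. (cinner (\<sigma> \<mu>) (s j \<mu>) * u \<mu>) *\<^sub>C e j \<mu>)" if "\<mu> \<in> U" for \<mu>
    using P_fix[of \<mu> "\<sigma> \<mu>"] assms that
    by (auto simp: smooth_section_def P_def scaleC_scaleC[symmetric] s_def[symmetric])
qed

text \<open>In the frame \<open>e\<close> the operator \<open>wirt\<close> differentiates only the
  coordinates, so the derivative stays in the fibre.\<close>

lemma smooth_section_D1:
  assumes \<sigma>: "smooth_section U E \<sigma>" and U: "open U" "U \<subseteq> G"
  shows "smooth_section U E (D1 \<sigma>)"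
  unfolding smooth_section_def
proof (intro conjI ballI)
  show "smooth_on U (wirt \<sigma>)"
    using \<sigma> unfolding smooth_section_def by (intro smooth_on_wirt U) simp
  fix \<mu> assume \<mu>: "\<mu> \<in> U"
  obtain f where f: "\<And>j. j < n \<Longrightarrow> smooth_on U (f j)"
    "\<And>\<mu>. \<mu> \<in> U \<Longrightarrow> \<sigma> \<mu> = (\<Sum>j<n. f j \<mu> *\<^sub>C e j \<mu>)"
    using coordinates[OF \<sigma> U] by blast
  have fd: "f j differentiable at \<mu>" "e j differentiable at \<mu>" if "j < n" for j
    using smooth_on_frechet(1)[OF f(1) U(1)] smooth_on_frechet(1)[OF smooth_e open_G] \<mu> U(2) that by auto
  have fe: "(\<lambda>\<nu>. f j \<nu> *\<^sub>C e j \<nu>) differentiable at \<mu>" if "j < n" for j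
    using bounded_bilinear.FDERIV[OF bounded_bilinear_scaleC fd(1)[OF that, unfolded frechet_derivative_works]
        fd(2)[OF that, unfolded frechet_derivative_works]] unfolding differentiable_def by blast
  have "wirt \<sigma> \<mu> = wirt (\<lambda>\<nu>. \<Sum>j<n. f j \<nu> *\<^sub>C e j \<nu>) \<mu>"
    by (rule wirt_cong[OF U(1) \<mu> f(2)])
  also have "\<dots> = (\<Sum>j<n. wirt (\<lambda>\<nu>. f j \<nu> *\<^sub>C e j \<nu>) \<mu>)"
    by (rule wirt_sum) (use fe in simp)
  also have "\<dots> = (\<Sum>j<n. wirt (f j) \<mu> *\<^sub>C e j \<mu>)"
    using \<mu> U(2) by (intro sum.cong refl) (auto simp: wirt_scaleC fd wirt_e)
  also have "\<dots> \<in> E \<mu>"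
    using \<mu> U(2) by (intro csubspace_sum csubspace_scale csubspace_E e_in) auto
  finally show "wirt \<sigma> \<mu> \<in> E \<mu>" .
qed

lemma smooth_section_D2:
  assumes \<sigma>: "smooth_section U E \<sigma>" and U: "open U" "U \<subseteq> G"
  shows "smooth_section U E (D2 \<sigma>)"
  using assms smooth_P[OF smooth_on_wirt(2)] P_in
  by (auto simp: smooth_section_def D2_def[abs_def])

lemma section_differentiable:
  "smooth_section U E \<sigma> \<Longrightarrow> open U \<Longrightarrow> \<mu> \<in> U \<Longrightarrow> \<sigma> differentiable at \<mu>"
  unfolding smooth_section_def using smooth_on_frechet(1) by blast

lemma is_connection: "is_connection G E D1 D2"
  unfolding is_connection_def
proof (intro allI impI conjI ballI; (elim conjE)?)
  fix U \<sigma> assume U: "open U" "U \<subseteq> G" and \<sigma>: "smooth_section U E \<sigma>"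
  show "smooth_section U E (D1 \<sigma>)" "smooth_section U E (D2 \<sigma>)"
    by (fact smooth_section_D1[OF \<sigma> U] smooth_section_D2[OF \<sigma> U])+
  fix \<mu> assume \<mu>: "\<mu> \<in> U"
  then have \<mu>G: "\<mu> \<in> G" using U by auto
  have d\<sigma>: "\<sigma> differentiable at \<mu>" by (rule section_differentiable[OF \<sigma> U(1) \<mu>])
  {
    fix \<tau> assume \<tau>: "smooth_section U E \<tau>"
    note a = wirt_add[OF d\<sigma> section_differentiable[OF \<tau> U(1) \<mu>]]
    show "D1 (\<lambda>\<nu>. \<sigma> \<nu> + \<tau> \<nu>) \<mu> = D1 \<sigma> \<mu> + D1 \<tau> \<mu>" by (fact a)
    show "D2 (\<lambda>\<nu>. \<sigma> \<nu> + \<tau> \<nu>) \<mu> = D2 \<sigma> \<mu> + D2 \<tau> \<mu>" by (simp add: D2_def a P_add)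
  next
    fix \<tau> assume eq: "\<forall>\<nu>\<in>U. \<sigma> \<nu> = \<tau> \<nu>"
    have a: "wirt \<sigma> \<mu> = wirt \<tau> \<mu>" "wirt_bar \<sigma> \<mu> = wirt_bar \<tau> \<mu>"
      by (rule wirt_cong[OF U(1) \<mu>], simp add: eq)+
    show "D1 \<sigma> \<mu> = D1 \<tau> \<mu>" by (fact a)
    show "D2 \<sigma> \<mu> = D2 \<tau> \<mu>" by (simp add: D2_def a)
  next
    fix f :: "complex \<Rightarrow> complex" assume f: "smooth_on U f"
    note a = wirt_scaleC[OF smooth_on_frechet(1)[OF f U(1) \<mu>] d\<sigma>]
    show "D1 (\<lambda>\<nu>. f \<nu> *\<^sub>C \<sigma> \<nu>) \<mu> = wirt f \<mu> *\<^sub>C \<sigma> \<mu> + f \<mu> *\<^sub>C D1 \<sigma> \<mu>" by (fact a)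
    have "\<sigma> \<mu> \<in> E \<mu>" using \<sigma> \<mu> by (simp add: smooth_section_def)
    then show "D2 (\<lambda>\<nu>. f \<nu> *\<^sub>C \<sigma> \<nu>) \<mu> = wirt_bar f \<mu> *\<^sub>C \<sigma> \<mu> + f \<mu> *\<^sub>C D2 \<sigma> \<mu>"
      by (simp add: D2_def a P_add P_scaleC P_fix \<mu>G)
  }
qed

text \<open>Values of sections are fixed by the self-adjoint \<open>P\<close>, so the projection in
  \<open>D2\<close> is invisible in the inner products and only the product rule for
  \<open>cinner\<close> remains.\<close>

lemma metric_preserving: "metric_preserving G E D1 D2"
  unfolding metric_preserving_def
proof (intro allI impI ballI; elim conjE)
  fix U \<sigma> \<tau> \<mu>
  assume U: "open U" "U \<subseteq> G" and \<mu>: "\<mu> \<in> U"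
    and \<sigma>: "smooth_section U E \<sigma>" and \<tau>: "smooth_section U E \<tau>"
  have "\<mu> \<in> G" "\<sigma> \<mu> \<in> E \<mu>" "\<tau> \<mu> \<in> E \<mu>"
    using U \<mu> \<sigma> \<tau> by (auto simp: smooth_section_def)
  then have "cinner (\<sigma> \<mu>) (D2 \<tau> \<mu>) = cinner (\<sigma> \<mu>) (wirt_bar \<tau> \<mu>)"
    "cinner (D2 \<sigma> \<mu>) (\<tau> \<mu>) = cinner (wirt_bar \<sigma> \<mu>) (\<tau> \<mu>)"
    unfolding D2_def cinner_P[of \<mu> "wirt_bar \<sigma> \<mu>"] cinner_P[of \<mu> "\<sigma> \<mu>", symmetric]
    by (simp_all add: P_fix)
  with wirt_cinner[OF section_differentiable[OF \<sigma> U(1) \<mu>] section_differentiable[OF \<tau> U(1) \<mu>]]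
  show "wirt (\<lambda>\<nu>. cinner (\<sigma> \<nu>) (\<tau> \<nu>)) \<mu> = cinner (D1 \<sigma> \<mu>) (\<tau> \<mu>) + cinner (\<sigma> \<mu>) (D2 \<tau> \<mu>)
        \<and> wirt_bar (\<lambda>\<nu>. cinner (\<sigma> \<nu>) (\<tau> \<nu>)) \<mu>
            = cinner (D2 \<sigma> \<mu>) (\<tau> \<mu>) + cinner (\<sigma> \<mu>) (D1 \<tau> \<mu>)"
    by simp
qed

lemma canonical_connection: "canonical_connection G E D1 D2"
  unfolding canonical_connection_def antiholomorphic_section_def
  using is_connection metric_preserving wirt_antiholomorphic by blast

section \<open>Connection form and curvature\<close>

text \<open>The logarithmic derivative of \<open>h\<close> in the conjugate direction; over
  \<open>G\<close> the factor \<open>u \<mu> * u \<mu>\<close> is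
  \<open>1 / h \<mu>\<close>.\<close>

definition \<theta> :: "complex \<Rightarrow> complex" where "\<theta> \<mu> = u \<mu> * u \<mu> * wirt_bar h \<mu>"

lemma smooth_\<theta>: "smooth_on G \<theta>"
  unfolding \<theta>_def[abs_def] h_def[abs_def]
  by (intro smooth_on_mult smooth_u smooth_on_wirt smooth_on_cinner smooth_e n_pos open_G)

text \<open>In the conjugate derivative of \<open>cinner (e j \<nu>) (e i \<nu>)\<close> only the
  left factor contributes, since \<open>wirt (e i)\<close> vanishes. The inner products in
  \<open>P\<close> are thus derivatives of entries of the Gram matrix, which is diagonal.\<close>

lemma D2_e:
  assumes \<mu>: "\<mu> \<in> G" and j: "j < n"
  shows "D2 (e j) \<mu> = \<theta> \<mu> *\<^sub>C e j \<mu>"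
proof -
  have "cinner (wirt_bar (e j) \<mu>) (e i \<mu>) = (if i = j then wirt_bar h \<mu> else 0)" if i: "i < n" for i
  proof -
    have d: "e i differentiable at \<mu>" "e j differentiable at \<mu>"
      using i j \<mu> antiholomorphic_on_imp_differentiable[OF e_antiholomorphic] by auto
    have "cinner (wirt_bar (e j) \<mu>) (e i \<mu>) = wirt_bar (\<lambda>\<nu>. cinner (e j \<nu>) (e i \<nu>)) \<mu>"
      unfolding wirt_cinner(2)[OF d(2,1)] wirt_e[OF \<mu> i] by simp
    also have "\<dots> = wirt_bar (if i = j then h else (\<lambda>_. 0)) \<mu>"
    proof (rule wirt_cong[OF open_G \<mu>])
      fix \<nu> assume \<nu>: "\<nu> \<in> G"
      show "cinner (e j \<nu>) (e i \<nu>) = (if i = j then h else (\<lambda>_. 0)) \<nu>"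
        using orth_e norm_e[OF \<nu> j] i j \<nu> by (cases "i = j") (simp_all add: h_def orthogonal_family_def)
    qed
    finally show ?thesis by (simp add: wirt_zero)
  qed
  then have "D2 (e j) \<mu> = (\<Sum>i<n. if i = j then \<theta> \<mu> *\<^sub>C e j \<mu> else 0)"
    unfolding D2_def P_def
    by (intro sum.cong refl) (simp add: s_def cinner_scaleC_right cnj_u scaleC_scaleC \<theta>_def mult_ac)
  also have "\<dots> = \<theta> \<mu> *\<^sub>C e j \<mu>" using j by simp
  finally show ?thesis .
qed

text \<open>\<open>D1\<close> annihilates \<open>e j\<close>, so only \<open>D1 (D2 (e j))\<close>
  survives. The scalar is the mixed Wirtinger derivative of the logarithm of \<open>h\<close>, the
  same for all \<open>j\<close>.\<close>

lemma curvature_e: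
  assumes \<mu>: "\<mu> \<in> G" and j: "j < n"
  shows "curvature D1 D2 (e j) \<mu> = wirt \<theta> \<mu> *\<^sub>C e j \<mu>"
proof -
  have "D1 (D2 (e j)) \<mu> = D1 (\<lambda>\<nu>. \<theta> \<nu> *\<^sub>C e j \<nu>) \<mu>"
    by (rule wirt_cong[OF open_G \<mu> D2_e[OF _ j]])
  also have "\<dots> = wirt \<theta> \<mu> *\<^sub>C e j \<mu>"
    using smooth_on_frechet(1)[OF smooth_\<theta> open_G \<mu>] smooth_on_frechet(1)[OF smooth_e[OF j] open_G \<mu>]
    by (simp add: wirt_scaleC wirt_e[OF \<mu> j])
  moreover have "wirt_bar (D1 (e j)) \<mu> = wirt_bar (\<lambda>_. 0) \<mu>"
    by (rule wirt_cong[OF open_G \<mu>]) (rule wirt_e[OF _ j])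
  ultimately show ?thesis by (simp add: curvature_def D2_def wirt_zero)
qed

text \<open>The curvature is linear over smooth functions and acts on every \<open>e j\<close> by
  the same scalar, hence by that scalar on all sections.\<close>

lemma curvature_section:
  assumes U: "open U" "U \<subseteq> G" and \<sigma>: "smooth_section U E \<sigma>" and \<mu>: "\<mu> \<in> U"
  shows "curvature D1 D2 \<sigma> \<mu> = wirt \<theta> \<mu> *\<^sub>C \<sigma> \<mu>"
proof -
  obtain f where f: "\<And>j. j < n \<Longrightarrow> smooth_on U (f j)"
    "\<And>\<mu>. \<mu> \<in> U \<Longrightarrow> \<sigma> \<mu> = (\<Sum>j<n. f j \<mu> *\<^sub>C e j \<mu>)"
    using coordinates[OF \<sigma> U] by blast
  note E' = csubspace_E[OF subsetD[OF U(2)]]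
  note c = connectionD[OF is_connection U]
  have sec: "smooth_section U E (\<lambda>\<nu>. f j \<nu> *\<^sub>C e j \<nu>)" if "j < n" for j
    using that smooth_section_subset[OF smooth_section_e U(2)]
    by (intro smooth_section_scaleC E' f(1))
  have "smooth_section U E (\<lambda>\<nu>. \<Sum>j<k. f j \<nu> *\<^sub>C e j \<nu>) \<and> (\<forall>\<mu>\<in>U.
      curvature D1 D2 (\<lambda>\<nu>. \<Sum>j<k. f j \<nu> *\<^sub>C e j \<nu>) \<mu> = wirt \<theta> \<mu> *\<^sub>C (\<Sum>j<k. f j \<mu> *\<^sub>C e j \<mu>))"
    if "k \<le> n" for k
    using that
  proof (induction k)
    case 0
    have "wirt (\<lambda>_. 0 :: 'a) = (\<lambda>_. 0)" "D2 (\<lambda>_. 0) = (\<lambda>_. 0)"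
      by (auto simp: wirt_zero D2_def)
    then show ?case
      using E' by (simp add: curvature_def wirt_zero D2_def smooth_section_def smooth_on_const csubspace_0)
  next
    case (Suc k)
    then have k: "k < n" and IH: "smooth_section U E (\<lambda>\<nu>. \<Sum>j<k. f j \<nu> *\<^sub>C e j \<nu>)"
      "\<And>\<mu>. \<mu> \<in> U \<Longrightarrow> curvature D1 D2 (\<lambda>\<nu>. \<Sum>j<k. f j \<nu> *\<^sub>C e j \<nu>) \<mu> = wirt \<theta> \<mu> *\<^sub>C (\<Sum>j<k. f j \<mu> *\<^sub>C e j \<mu>)"
      by auto
    have "curvature D1 D2 (\<lambda>\<nu>. \<Sum>j<Suc k. f j \<nu> *\<^sub>C e j \<nu>) \<mu> = wirt \<theta> \<mu> *\<^sub>C (\<Sum>j<Suc k. f j \<mu> *\<^sub>C e j \<mu>)"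
      if \<mu>: "\<mu> \<in> U" for \<mu>
    proof -
      have "curvature D1 D2 (\<lambda>\<nu>. f k \<nu> *\<^sub>C e k \<nu>) \<mu> = f k \<mu> *\<^sub>C curvature D1 D2 (e k) \<mu>"
        by (rule curvature_scaleC[OF is_connection U csubspace_E f(1)[OF k] smooth_section_subset[OF smooth_section_e[OF k] U(2)] \<mu>])
      also have "\<dots> = wirt \<theta> \<mu> *\<^sub>C (f k \<mu> *\<^sub>C e k \<mu>)"
        using U(2) \<mu> k by (simp add: curvature_e subsetD scaleC_scaleC mult.commute)
      finally show ?thesis
        using curvature_add[OF is_connection U csubspace_E IH(1) sec[OF k] \<mu>] IH(2)[OF \<mu>]
        by (simp add: scaleC_add_right)
    qed
    moreover have "smooth_section U E (\<lambda>\<nu>. \<Sum>j<Suc k. f j \<nu> *\<^sub>C e j \<nu>)"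
      using smooth_section_add[OF E' IH(1) sec[OF k]] by simp
    ultimately show ?case by blast
  qed
  from this[of n] have sum: "smooth_section U E (\<lambda>\<nu>. \<Sum>j<n. f j \<nu> *\<^sub>C e j \<nu>)"
    "curvature D1 D2 (\<lambda>\<nu>. \<Sum>j<n. f j \<nu> *\<^sub>C e j \<nu>) \<mu> = wirt \<theta> \<mu> *\<^sub>C (\<Sum>j<n. f j \<mu> *\<^sub>C e j \<mu>)"
    using \<mu> by auto
  \<comment> \<open>\<open>\<sigma>\<close> equals its expansion on \<open>U\<close> only, so
    locality is used twice: for the inner derivative on all of \<open>U\<close>, then for the outer
    one at \<open>\<mu>\<close>.\<close>
  have "D1 (D2 \<sigma>) \<mu> = D1 (D2 (\<lambda>\<nu>. \<Sum>j<n. f j \<nu> *\<^sub>C e j \<nu>)) \<mu>"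
    by (rule c(5)[OF \<mu> c(2)[OF \<mu> sum(1)]]) (rule c(6)[OF _ sum(1), symmetric], auto simp: f(2))
  moreover have "D2 (D1 \<sigma>) \<mu> = D2 (D1 (\<lambda>\<nu>. \<Sum>j<n. f j \<nu> *\<^sub>C e j \<nu>)) \<mu>"
    by (rule c(6)[OF \<mu> c(1)[OF \<mu> sum(1)]]) (rule c(5)[OF _ sum(1), symmetric], auto simp: f(2))
  ultimately show ?thesis
    using sum(2) f(2)[OF \<mu>] by (simp add: curvature_def)
qed

section \<open>The curvature algebra acts by scalar functions\<close>

text \<open>One function \<open>\<phi>\<close> on all of \<open>G\<close> serves every section over
  every open subset. Its smoothness is included because commutators with \<open>D1\<close> and
  \<open>D2\<close> differentiate it.\<close>

definition acts_by :: "'a section_op \<Rightarrow> (complex \<Rightarrow> complex) \<Rightarrow> bool" where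
  "acts_by \<Phi> \<phi> \<longleftrightarrow> smooth_on G \<phi> \<and> (\<forall>U \<sigma>. open U \<and> U \<subseteq> G \<and> smooth_section U E \<sigma>
     \<longrightarrow> (\<forall>\<mu>\<in>U. \<Phi> \<sigma> \<mu> = \<phi> \<mu> *\<^sub>C \<sigma> \<mu>))"

lemma acts_byI:
  assumes "smooth_on G \<phi>" "\<And>U \<sigma> \<mu>. open U \<Longrightarrow> U \<subseteq> G \<Longrightarrow> smooth_section U E \<sigma> \<Longrightarrow> \<mu> \<in> U \<Longrightarrow> \<Phi> \<sigma> \<mu> = \<phi> \<mu> *\<^sub>C \<sigma> \<mu>"
  shows "acts_by \<Phi> \<phi>"
  unfolding acts_by_def by (intro conjI allI impI ballI assms(1); elim conjE; rule assms(2))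

lemma acts_byD:
  assumes "acts_by \<Phi> \<phi>" "open U" "U \<subseteq> G" "smooth_section U E \<sigma>" "\<mu> \<in> U"
  shows "\<Phi> \<sigma> \<mu> = \<phi> \<mu> *\<^sub>C \<sigma> \<mu>"
  using assms(1)[unfolded acts_by_def, THEN conjunct2, rule_format, of U \<sigma> \<mu>] assms(2-5) by simp

lemma acts_by_smooth: "acts_by \<Phi> \<phi> \<Longrightarrow> smooth_on G \<phi>"
  by (simp add: acts_by_def)

text \<open>By the Leibniz rule, applying \<open>D1\<close> or \<open>D2\<close> after
  multiplication by \<open>\<phi>\<close> differs from the opposite order by the derivative of
  \<open>\<phi>\<close> times the section, again a scalar action.\<close>

lemma acts_by_commutator:
  assumes \<Phi>: "acts_by \<Phi> \<phi>"
  shows "acts_by (op_commutator D1 \<Phi>) (wirt \<phi>)" "acts_by (op_commutator D2 \<Phi>) (wirt_bar \<phi>)"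
proof -
  have comm: "op_commutator D1 \<Phi> \<sigma> \<mu> = wirt \<phi> \<mu> *\<^sub>C \<sigma> \<mu> \<and> op_commutator D2 \<Phi> \<sigma> \<mu> = wirt_bar \<phi> \<mu> *\<^sub>C \<sigma> \<mu>"
    if U: "open U" "U \<subseteq> G" and \<sigma>: "smooth_section U E \<sigma>" and \<mu>: "\<mu> \<in> U" for U \<sigma> \<mu>
  proof -
    note c = connectionD[OF is_connection U \<mu>]
    note \<phi> = smooth_on_subset[OF acts_by_smooth[OF \<Phi>] U(2)]
    have sec: "smooth_section U E (\<lambda>\<nu>. \<phi> \<nu> *\<^sub>C \<sigma> \<nu>)"
      using U(2) by (intro smooth_section_scaleC csubspace_E \<phi> \<sigma>) auto
    have "D1 (\<Phi> \<sigma>) \<mu> = D1 (\<lambda>\<nu>. \<phi> \<nu> *\<^sub>C \<sigma> \<nu>) \<mu>" "D2 (\<Phi> \<sigma>) \<mu> = D2 (\<lambda>\<nu>. \<phi> \<nu> *\<^sub>C \<sigma> \<nu>) \<mu>"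
      using acts_byD[OF \<Phi> U \<sigma>] by (intro c(5)[OF sec] c(6)[OF sec]; simp)+
    moreover have "\<Phi> (D1 \<sigma>) \<mu> = \<phi> \<mu> *\<^sub>C D1 \<sigma> \<mu>" "\<Phi> (D2 \<sigma>) \<mu> = \<phi> \<mu> *\<^sub>C D2 \<sigma> \<mu>"
      using acts_byD[OF \<Phi> U c(1)[OF \<sigma>] \<mu>] acts_byD[OF \<Phi> U c(2)[OF \<sigma>] \<mu>] by auto
    ultimately show ?thesis
      by (simp add: op_commutator_def c(7)[OF \<sigma> \<phi>] c(8)[OF \<sigma> \<phi>])
  qed
  show "acts_by (op_commutator D1 \<Phi>) (wirt \<phi>)" "acts_by (op_commutator D2 \<Phi>) (wirt_bar \<phi>)"
    by (rule acts_byI[OF smooth_on_wirt(1)[OF acts_by_smooth[OF \<Phi>] open_G]],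
        erule (3) comm[THEN conjunct1])
      (rule acts_byI[OF smooth_on_wirt(2)[OF acts_by_smooth[OF \<Phi>] open_G]],
        erule (3) comm[THEN conjunct2])
qed

lemma curvature_derivatives_acts_by:
  "\<Phi> \<in> curvature_derivatives D1 D2 \<Longrightarrow> \<exists>\<phi>. acts_by \<Phi> \<phi>"
proof (induction rule: curvature_derivatives.induct)
  case 1
  have "acts_by (curvature D1 D2) (wirt \<theta>)"
    by (intro acts_byI smooth_on_wirt(1)[OF smooth_\<theta> open_G] curvature_section)
  then show ?case by blast
next
  case (2 \<Phi>)
  then obtain \<phi> where "acts_by \<Phi> \<phi>" by blast
  from acts_by_commutator(1)[OF this] show ?case by blast
next
  case (3 \<Phi>)
  then obtain \<phi> where "acts_by \<Phi> \<phi>" by blast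
  from acts_by_commutator(2)[OF this] show ?case by blast
qed

lemma curvature_algebra_acts_by:
  "\<Phi> \<in> curvature_algebra D1 D2 \<Longrightarrow> \<exists>\<phi>. acts_by \<Phi> \<phi>"
proof (induction rule: curvature_algebra.induct)
  case (1 \<Phi>)
  then show ?case by (rule curvature_derivatives_acts_by)
next
  case 2
  show ?case by (rule exI[of _ "\<lambda>_. 1"]) (simp add: acts_by_def smooth_on_const)
next
  case (3 \<Phi> \<Psi>)
  then obtain \<phi> \<psi> where \<Phi>: "acts_by \<Phi> \<phi>" and \<Psi>: "acts_by \<Psi> \<psi>" by blast
  have "acts_by (\<lambda>\<sigma> \<mu>. \<Phi> \<sigma> \<mu> + \<Psi> \<sigma> \<mu>) (\<lambda>\<mu>. \<phi> \<mu> + \<psi> \<mu>)"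
    by (rule acts_byI[OF smooth_on_add[OF acts_by_smooth[OF \<Phi>] acts_by_smooth[OF \<Psi>]]])
      (simp add: acts_byD[OF \<Phi>] acts_byD[OF \<Psi>] scaleC_add_left)
  then show ?case by blast
next
  case (4 \<Phi> c)
  then obtain \<phi> where \<Phi>: "acts_by \<Phi> \<phi>" by blast
  have "acts_by (\<lambda>\<sigma> \<mu>. c *\<^sub>C \<Phi> \<sigma> \<mu>) (\<lambda>\<mu>. c * \<phi> \<mu>)"
    by (rule acts_byI[OF smooth_on_mult[OF smooth_on_const acts_by_smooth[OF \<Phi>]]])
      (simp add: acts_byD[OF \<Phi>] scaleC_scaleC)
  then show ?case by blast
next
  case (5 \<Phi> \<Psi>)
  then obtain \<phi> \<psi> where \<Phi>: "acts_by \<Phi> \<phi>" and \<Psi>: "acts_by \<Psi> \<psi>" by blast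
  have "\<Phi> (\<Psi> \<sigma>) \<mu> = (\<phi> \<mu> * \<psi> \<mu>) *\<^sub>C \<sigma> \<mu>"
    if U: "open U" "U \<subseteq> G" and \<sigma>: "smooth_section U E \<sigma>" and \<mu>: "\<mu> \<in> U" for U \<sigma> \<mu>
  proof -
    have "smooth_on U \<sigma>" using \<sigma> by (simp add: smooth_section_def)
    with smooth_on_subset[OF acts_by_smooth[OF \<Psi>] U(2)]
    have \<psi>: "smooth_on U (\<lambda>\<nu>. \<psi> \<nu> *\<^sub>C \<sigma> \<nu>)" by (rule smooth_on_scaleC)
    \<comment> \<open>\<open>\<Psi> \<sigma>\<close> is controlled on \<open>U\<close> only, yet
      must be recognised as a smooth section there before \<open>\<Phi>\<close> can be applied to
      it.\<close>
    have "smooth_on U (\<Psi> \<sigma>)"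
      by (rule smooth_on_cong[OF U(1) _ \<psi>]) (simp add: acts_byD[OF \<Psi> U \<sigma>])
    moreover have "\<Psi> \<sigma> \<nu> \<in> E \<nu>" if "\<nu> \<in> U" for \<nu>
      using \<sigma> U(2) that unfolding acts_byD[OF \<Psi> U \<sigma> that] smooth_section_def
      by (intro csubspace_scale csubspace_E) auto
    ultimately have "smooth_section U E (\<Psi> \<sigma>)" by (simp add: smooth_section_def)
    then show ?thesis
      using acts_byD[OF \<Phi> U _ \<mu>] acts_byD[OF \<Psi> U \<sigma> \<mu>] by (simp add: scaleC_scaleC)
  qed
  then have "acts_by (\<lambda>\<sigma>. \<Phi> (\<Psi> \<sigma>)) (\<lambda>\<mu>. \<phi> \<mu> * \<psi> \<mu>)"
    by (intro acts_byI smooth_on_mult acts_by_smooth[OF \<Phi>] acts_by_smooth[OF \<Psi>])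
  then show ?case by blast
qed

lemma frame_matrix_scalar:
  assumes "\<And>j. j < n \<Longrightarrow> \<Phi> (s j) \<mu> = c *\<^sub>C s j \<mu>"
  shows "frame_matrix n s \<mu> \<Phi> (c \<cdot>\<^sub>m 1\<^sub>m n)"
proof -
  have "(\<Sum>i<n. (c \<cdot>\<^sub>m 1\<^sub>m n) $$ (i, j) *\<^sub>C s i \<mu>) = (\<Sum>i<n. if i = j then c *\<^sub>C s j \<mu> else 0)"
    if "j < n" for j
    using that by (intro sum.cong) auto
  then show ?thesis using assms by (simp add: frame_matrix_def)
qed

text \<open>Pairing with \<open>s i \<mu>\<close> recovers the entries. Hence a bundle map acting by
  a scalar has no other matrix than the scalar one.\<close>

lemma frame_matrix_unique:
  assumes "\<mu> \<in> G" "frame_matrix n s \<mu> \<Phi> A" "frame_matrix n s \<mu> \<Phi> B"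
  shows "A = B"
proof -
  have "C $$ (i, j) = cinner (\<Phi> (s j) \<mu>) (s i \<mu>)"
    if "frame_matrix n s \<mu> \<Phi> C" "i < n" "j < n" for C i j
  proof -
    have "cinner (\<Phi> (s j) \<mu>) (s i \<mu>) = (\<Sum>k<n. if k = i then C $$ (i, j) else 0)"
      using that assms(1) unfolding frame_matrix_def
      by (auto simp: cinner_sum_left cinner_scaleC_left s_orthonormal if_distrib[of "(*) _"]
          simp del: sum.delta intro!: sum.cong cong: if_cong)
    then show ?thesis using that by simp
  qed
  from this[OF assms(2)] this[OF assms(3)] show ?thesis
    using assms(2,3) unfolding frame_matrix_def by (intro eq_matI) auto
qed

lemma orthonormal_smooth_frame_s: "orthonormal_smooth_frame n G E s"
  unfolding orthonormal_smooth_frame_def orthogonal_family_def smooth_section_def basis_family_def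
proof (intro conjI allI impI ballI)
  fix \<mu> assume \<mu>: "\<mu> \<in> G"
  show "inj_on (\<lambda>j. s j \<mu>) {..<n}" "\<not> cdependent ((\<lambda>j. s j \<mu>) ` {..<n})"
    using orthogonal_independent[of n "\<lambda>j. s j \<mu>"] s_orthonormal[OF \<mu>]
    by (metis cinner_zero_left zero_neq_one)+
  show "cspan ((\<lambda>j. s j \<mu>) ` {..<n}) = E \<mu>"
  proof
    show "cspan ((\<lambda>j. s j \<mu>) ` {..<n}) \<subseteq> E \<mu>"
      by (intro complex_vec.span_minimal csubspace_E \<mu>) (auto simp: s_in \<mu>)
    show "E \<mu> \<subseteq> cspan ((\<lambda>j. s j \<mu>) ` {..<n})"
      unfolding E_eq[OF \<mu>]
      by (intro complex_vec.span_minimal complex_vec.subspace_span)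
        (auto simp: e_eq_s \<mu> intro!: complex_vec.span_scale intro: complex_vec.span_base)
  qed
qed (simp_all add: smooth_s s_in s_orthonormal)

text \<open>The normalized frame serves on all of \<open>G\<close>, so the exceptional set is empty.
  The algebra yields no nonscalar matrix, and it yields all scalar ones already as multiples of the
  identity, whatever the curvature is.\<close>

theorem block_diagonalization: "block_diagonalization G E [1] [n]"
proof -
  have "{A. \<exists>\<Phi>\<in>curvature_algebra D1 D2. frame_matrix n s \<mu> \<Phi> A} = block_algebra [1] [n]"
    if \<mu>: "\<mu> \<in> G" for \<mu>
  proof (intro subset_antisym subsetI)
    fix A assume "A \<in> {A. \<exists>\<Phi>\<in>curvature_algebra D1 D2. frame_matrix n s \<mu> \<Phi> A}"
    then obtain \<Phi> where \<Phi>: "\<Phi> \<in> curvature_algebra D1 D2" "frame_matrix n s \<mu> \<Phi> A" by blast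
    obtain \<phi> where \<phi>: "acts_by \<Phi> \<phi>" using curvature_algebra_acts_by[OF \<Phi>(1)] ..
    have "frame_matrix n s \<mu> \<Phi> (\<phi> \<mu> \<cdot>\<^sub>m 1\<^sub>m n)"
      using acts_byD[OF \<phi> open_G subset_refl _ \<mu>] smooth_s s_in
      by (intro frame_matrix_scalar) (auto simp: smooth_section_def)
    then show "A \<in> block_algebra [1] [n]"
      using frame_matrix_unique[OF \<mu> \<Phi>(2)] unfolding block_algebra_scalar by blast
  next
    fix A assume "A \<in> block_algebra [1] [n]"
    then obtain c where "A = c \<cdot>\<^sub>m 1\<^sub>m n" unfolding block_algebra_scalar by blast
    then have "frame_matrix n s \<mu> (\<lambda>\<sigma> \<mu>. c *\<^sub>C \<sigma> \<mu>) A"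
      using frame_matrix_scalar by simp
    moreover have "(\<lambda>\<sigma> \<mu>. c *\<^sub>C \<sigma> \<mu>) \<in> curvature_algebra D1 D2"
      using curvature_algebra.intros(4)[OF curvature_algebra.intros(2)] .
    ultimately show "A \<in> {A. \<exists>\<Phi>\<in>curvature_algebra D1 D2. frame_matrix n s \<mu> \<Phi> A}" by blast
  qed
  moreover have "\<exists>\<Theta>1\<in>block_algebra [1] [n]. frame_matrix n s \<mu> D1 \<Theta>1"
    and "\<exists>\<Theta>2\<in>block_algebra [1] [n]. frame_matrix n s \<mu> D2 \<Theta>2" if \<mu>: "\<mu> \<in> G" for \<mu>
  proof -
    note c = connectionD[OF is_connection open_G subset_refl \<mu> smooth_section_e]
    \<comment> \<open>\<open>D1\<close> sees only the factor \<open>u\<close> of \<open>s j\<close>;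
      dividing by \<open>u \<mu>\<close> returns from \<open>e j\<close> to
      \<open>s j\<close>.\<close>
    have "D1 (s j) \<mu> = (wirt u \<mu> / u \<mu>) *\<^sub>C s j \<mu>" if "j < n" for j
      using c(7)[OF that smooth_u] wirt_e[OF \<mu> that] u_nonzero[OF \<mu>]
      by (simp add: s_def[abs_def] scaleC_scaleC)
    then show "\<exists>\<Theta>1\<in>block_algebra [1] [n]. frame_matrix n s \<mu> D1 \<Theta>1"
      using frame_matrix_scalar unfolding block_algebra_scalar by blast
    have "D2 (s j) \<mu> = ((wirt_bar u \<mu> + u \<mu> * \<theta> \<mu>) / u \<mu>) *\<^sub>C s j \<mu>" if "j < n" for j
      using c(8)[OF that smooth_u] D2_e[OF \<mu> that] u_nonzero[OF \<mu>]
      by (simp add: s_def[abs_def] scaleC_scaleC scaleC_add_left)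
    then show "\<exists>\<Theta>2\<in>block_algebra [1] [n]. frame_matrix n s \<mu> D2 \<Theta>2"
      using frame_matrix_scalar unfolding block_algebra_scalar by blast
  qed
  ultimately have loc: "\<exists>U s. open U \<and> \<mu> \<in> U \<and> U \<subseteq> G \<and> orthonormal_smooth_frame n U E s
      \<and> (\<forall>\<nu>\<in>U. {A. \<exists>\<Phi>\<in>curvature_algebra D1 D2. frame_matrix n s \<nu> \<Phi> A} = block_algebra [1] [n]
          \<and> (\<exists>\<Theta>1\<in>block_algebra [1] [n]. frame_matrix n s \<nu> D1 \<Theta>1)
          \<and> (\<exists>\<Theta>2\<in>block_algebra [1] [n]. frame_matrix n s \<nu> D2 \<Theta>2))" if "\<mu> \<in> G - {}" for \<mu>
    using that open_G orthonormal_smooth_frame_s by (intro exI[of _ G] exI[of _ s]) simp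
  have n: "sum_list (map2 (*) [1] [n]) = n" by simp
  have antihol: "antiholomorphic_bundle n G E"
    unfolding antiholomorphic_bundle_def using open_G frame by blast
  show ?thesis
    unfolding block_diagonalization_def Let_def n
    by (intro conjI antihol, simp, simp, simp add: n_pos,
        rule exI[of _ D1], rule exI[of _ D2], rule exI[of _ "{}"],
        intro conjI canonical_connection ballI loc) simp_all
qed

end

section \<open>The Hardy space as a sequence space\<close>

lemma has_sum_product:
  fixes f :: "'a \<Rightarrow> complex" and g :: "'b \<Rightarrow> complex"
  assumes f: "(f has_sum a) A" and g: "(g has_sum b) B"
    and nf: "(\<lambda>x. norm (f x)) summable_on A" and ng: "(\<lambda>x. norm (g x)) summable_on B"
  shows "((\<lambda>(x, y). f x * g y) has_sum a * b) (A \<times> B)"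
proof (rule has_sum_SigmaI)
  show "((\<lambda>y. case (x, y) of (x, y) \<Rightarrow> f x * g y) has_sum f x * b) B" for x
    using has_sum_cmult_right[OF g] by simp
  show "((\<lambda>x. f x * b) has_sum a * b) A"
    by (rule has_sum_cmult_left[OF f])
  have "(\<lambda>p. norm (case p of (x, y) \<Rightarrow> f x * g y)) summable_on A \<times> B"
  proof (rule summable_on_SigmaI)
    show "((\<lambda>y. norm (case (x, y) of (x, y) \<Rightarrow> f x * g y)) has_sum norm (f x) * infsum (\<lambda>y. norm (g y)) B) B" for x
      using has_sum_cmult_right[OF has_sum_infsum[OF ng]] by (simp add: norm_mult)
    show "(\<lambda>x. norm (f x) * infsum (\<lambda>y. norm (g y)) B) summable_on A"
      by (rule summable_on_cmult_left[OF nf])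
  qed simp
  then show "(\<lambda>(x, y). f x * g y) summable_on A \<times> B"
    by (rule abs_summable_summable)
qed

lemma has_sum_geometric:
  fixes z :: complex assumes "norm z < 1"
  shows "((\<lambda>i. z ^ i) has_sum 1 / (1 - z)) UNIV" "(\<lambda>i. norm (z ^ i)) summable_on UNIV"
proof -
  have s: "summable (\<lambda>i. norm (z ^ i))" using assms by (simp add: norm_power summable_geometric)
  show "((\<lambda>i. z ^ i) has_sum 1 / (1 - z)) UNIV"
    by (rule norm_summable_imp_has_sum[OF s geometric_sums[OF assms]])
  show "(\<lambda>i. norm (z ^ i)) summable_on UNIV"
    using s by (simp add: summable_on_UNIV_nonneg_real_iff)
qed

lemma square_summableI:
  assumes "\<And>F. finite F \<Longrightarrow> (\<Sum>p\<in>F. (cmod (a p))\<^sup>2) \<le> K"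
  shows "square_summable a"
  unfolding square_summable_def
  using assms by (intro nonneg_bdd_above_summable_on bdd_aboveI2[where M = K]) auto

lemma square_summable_finite_support:
  assumes "finite {p. a p \<noteq> 0}"
  shows "square_summable a"
  unfolding square_summable_def
  by (rule finite_nonzero_values_imp_summable_on) (use assms in simp)

text \<open>Up to conjugation these are the Taylor coefficients of the reproducing kernel. Pairing
  with them shows that every square-summable array defines a convergent series on the
  bidisk.\<close>

lemma square_summable_monomials:
  assumes "z \<in> \<D>" "w \<in> \<D>"
  shows "square_summable (\<lambda>(i, j). z ^ i * w ^ j)"
proof -
  have *: "(\<lambda>i. (cmod (z ^ i))\<^sup>2) summable_on UNIV" if "z \<in> \<D>" for z
  proof -
    have "cmod (complex_of_real ((cmod z)\<^sup>2)) < 1"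
      using that unfolding norm_of_real abs_power2 by (simp add: abs_square_less_1)
    from has_sum_geometric(2)[OF this] show ?thesis
      by (simp add: norm_power power_mult[symmetric] mult.commute)
  qed
  have "(\<lambda>p. case p of (i, j) \<Rightarrow> (cmod (z ^ i))\<^sup>2 * (cmod (w ^ j))\<^sup>2) summable_on UNIV \<times> UNIV"
  proof (rule summable_on_SigmaI)
    show "((\<lambda>j. case (i, j) of (i, j) \<Rightarrow> (cmod (z ^ i))\<^sup>2 * (cmod (w ^ j))\<^sup>2) has_sum
        (cmod (z ^ i))\<^sup>2 * infsum (\<lambda>j. (cmod (w ^ j))\<^sup>2) UNIV) UNIV" for i
      using has_sum_cmult_right[OF has_sum_infsum[OF *[OF assms(2)]]] by simp
  qed (auto intro!: summable_on_cmult_left *[OF assms(1)])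
  then show ?thesis
    by (simp add: square_summable_def case_prod_unfold norm_mult power_mult_distrib)
qed

lemma taylor2_h2_of: "taylor2 a F \<Longrightarrow> taylor2 a (\<lambda>z w. if z \<in> \<D> \<and> w \<in> \<D> then F z w else 0)"
  by (simp add: taylor2_def)

lemma coef_h2_of:
  assumes "square_summable a" "taylor2 a F"
  shows "coef (h2_of F) = a"
proof (rule coef_eqI)
  have "h2_fun (h2_of F) = (\<lambda>z w. if z \<in> \<D> \<and> w \<in> \<D> then F z w else 0)"
    unfolding h2_of_def
    by (rule Abs_hardy2_inverse) (use assms taylor2_h2_of[OF assms(2)] in auto)
  then show "taylor2 a (h2_fun (h2_of F))"
    using taylor2_h2_of[OF assms(2)] by simp
qed

text \<open>A right inverse of \<open>coef\<close> on square-summable arrays, through which vectors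
  are constructed from their coefficients.\<close>

definition h2_coef :: "(nat \<times> nat \<Rightarrow> complex) \<Rightarrow> hardy2" where
  "h2_coef a = h2_of (\<lambda>z w. \<Sum>\<^sub>\<infinity>(i, j). a (i, j) * z ^ i * w ^ j)"

lemma coef_h2_coef:
  assumes "square_summable a"
  shows "coef (h2_coef a) = a"
  unfolding h2_coef_def
proof (rule coef_h2_of[OF assms])
  show "taylor2 a (\<lambda>z w. \<Sum>\<^sub>\<infinity>(i, j). a (i, j) * z ^ i * w ^ j)"
    unfolding taylor2_def
  proof (intro ballI has_sum_infsum)
    fix z w :: complex assume "z \<in> \<D>" "w \<in> \<D>"
    then have "square_summable (\<lambda>(i, j). cnj z ^ i * cnj w ^ j)"
      by (intro square_summable_monomials) auto
    from square_summable_prod[OF assms this]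
    show "(\<lambda>(i, j). a (i, j) * z ^ i * w ^ j) summable_on UNIV"
      by (simp add: case_prod_unfold mult.assoc)
  qed
qed

section \<open>Norm, coefficients and completeness\<close>

lemma coef_minus: "coef (- f) = (\<lambda>p. - coef f p)"
  unfolding uminus_hardy2_def coef_scaleC by simp

lemma coef_diff: "coef (f - g) = (\<lambda>p. coef f p - coef g p)"
  unfolding minus_hardy2_def coef_add coef_minus by simp

lemma coef_sum: "coef (sum f I) = (\<lambda>p. \<Sum>i\<in>I. coef (f i) p)"
  by (induction I rule: infinite_finite_induct) (auto simp: coef_zero coef_add)

lemma coef_scaleR: "coef (r *\<^sub>R f) = (\<lambda>p. of_real r * coef f p)"
  by (simp add: scaleR_eq_scaleC coef_scaleC)

lemma norm_hardy2_infsum: "(norm f)\<^sup>2 = (\<Sum>\<^sub>\<infinity>p. (cmod (coef f p))\<^sup>2)" for f :: hardy2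
proof -
  have "complex_of_real ((norm f)\<^sup>2) = of_real (\<Sum>\<^sub>\<infinity>p. (cmod (coef f p))\<^sup>2)"
    unfolding cinner_self_norm[symmetric] by (rule cinner_self)
  then show ?thesis by (simp only: of_real_eq_iff)
qed

lemma sum_coef_le_norm: "finite F \<Longrightarrow> (\<Sum>p\<in>F. (cmod (coef f p))\<^sup>2) \<le> (norm f)\<^sup>2"
  unfolding norm_hardy2_infsum
  using coef(1)[of f] by (intro finite_sum_le_infsum) (auto simp: square_summable_def)

lemma norm_le_coef:
  assumes "\<And>F. finite F \<Longrightarrow> (\<Sum>p\<in>F. (cmod (coef f p))\<^sup>2) \<le> K\<^sup>2" "0 \<le> K"
  shows "norm f \<le> K"
proof -
  have "(norm f)\<^sup>2 \<le> K\<^sup>2"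
    unfolding norm_hardy2_infsum using assms(1) coef(1)[of f]
    by (intro infsum_le_finite_sums) (auto simp: square_summable_def)
  then show ?thesis using assms(2) by (rule power2_le_imp_le)
qed

lemma cmod_coef_le: "cmod (coef f p) \<le> norm f"
  using sum_coef_le_norm[of "{p}" f] by (intro power2_le_imp_le[OF _ norm_ge_zero]) simp

lemma bounded_linear_coef: "bounded_linear (\<lambda>f. coef f p)"
  by (rule bounded_linear_intro[where K = 1])
    (simp_all add: coef_add coef_scaleR cmod_coef_le scaleR_conv_of_real)

text \<open>Coefficientwise limits exist; the Cauchy bound on finite partial sums passes to them and
  gives both square summability of the limit and convergence in norm.\<close>

instance hardy2 :: banach
proof
  fix X :: "nat \<Rightarrow> hardy2" assume X: "Cauchy X"
  have "Cauchy (\<lambda>k. coef (X k) p)" for p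
    using bounded_linear.Cauchy[OF bounded_linear_coef X] .
  then have "\<exists>c. (\<lambda>k. coef (X k) p) \<longlonglongrightarrow> c" for p
    by (simp add: Cauchy_convergent_iff convergent_def)
  then obtain a where a: "\<And>p. (\<lambda>k. coef (X k) p) \<longlonglongrightarrow> a p" by metis
  have bound: "(\<Sum>p\<in>F. (cmod (coef (X k) p - a p))\<^sup>2) \<le> e\<^sup>2"
    if N: "\<And>l. N \<le> l \<Longrightarrow> norm (X k - X l) \<le> e" and F: "finite F" for k e N F
  proof (rule tendsto_le[OF sequentially_bot tendsto_const])
    show "(\<lambda>l. \<Sum>p\<in>F. (cmod (coef (X k) p - coef (X l) p))\<^sup>2)
        \<longlonglongrightarrow> (\<Sum>p\<in>F. (cmod (coef (X k) p - a p))\<^sup>2)"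
      by (intro tendsto_intros a)
    have "(\<Sum>p\<in>F. (cmod (coef (X k) p - coef (X l) p))\<^sup>2) \<le> e\<^sup>2" if "N \<le> l" for l
    proof -
      have "(\<Sum>p\<in>F. (cmod (coef (X k) p - coef (X l) p))\<^sup>2) \<le> (norm (X k - X l))\<^sup>2"
        using sum_coef_le_norm[OF F, of "X k - X l"] by (simp add: coef_diff)
      also have "\<dots> \<le> e\<^sup>2" using N[OF that] by (intro power_mono) auto
      finally show ?thesis .
    qed
    then show "\<forall>\<^sub>F l in sequentially. (\<Sum>p\<in>F. (cmod (coef (X k) p - coef (X l) p))\<^sup>2) \<le> e\<^sup>2"
      by (rule eventually_sequentiallyI)
  qed
  obtain N where N: "\<forall>k\<ge>N. \<forall>l\<ge>N. norm (X k - X l) < 1"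
    using CauchyD[OF X, of 1] by auto
  have "norm (X N - X l) \<le> 1" if "N \<le> l" for l
    using N that by (simp add: less_imp_le)
  from square_summableI[OF bound[OF this]]
  have "square_summable (\<lambda>p. coef (X N) p - a p)" by simp
  \<comment> \<open>Only the difference to \<open>coef (X N)\<close> is controlled, so
    \<open>a\<close> is recovered as \<open>coef (X N)\<close> minus that difference.\<close>
  from square_summable_add[OF coef(1)[of "X N"] square_summable_scale[OF this, of "-1"]]
  have "square_summable (\<lambda>p. coef (X N) p + -1 * (coef (X N) p - a p))" .
  moreover have "(\<lambda>p. coef (X N) p + -1 * (coef (X N) p - a p)) = a" by auto
  ultimately have "square_summable a" by (simp only:)
  then have f: "coef (h2_coef a) = a" by (rule coef_h2_coef)
  have "X \<longlonglongrightarrow> h2_coef a"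
  proof (rule LIMSEQ_I)
    fix r :: real assume "0 < r"
    then obtain N where N: "\<forall>k\<ge>N. \<forall>l\<ge>N. norm (X k - X l) < r / 2"
      using CauchyD[OF X half_gt_zero[OF \<open>0 < r\<close>]] by blast
    have "norm (X k - h2_coef a) < r" if "N \<le> k" for k
    proof -
      have "norm (X k - X l) \<le> r / 2" if "N \<le> l" for l
        using N \<open>N \<le> k\<close> that by (simp add: less_imp_le)
      from bound[OF this] have "norm (X k - h2_coef a) \<le> r / 2"
        using \<open>0 < r\<close> by (intro norm_le_coef) (simp_all add: coef_diff f)
      then show ?thesis using \<open>0 < r\<close> by simp
    qed
    then show "\<exists>N. \<forall>k\<ge>N. norm (X k - h2_coef a) < r" by blast
  qed
  then show "convergent X" by (rule convergentI)
qed

section \<open>Reindexing operators\<close>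

text \<open>Reindexing along a partial injection with domain \<open>D\<close>. The backward shift,
  multiplication by \<open>z\<close>, the restriction to a residue class and the matrix units of the
  commutant all have this form, so norm bounds and adjoints are obtained once.\<close>

definition pull :: "(nat \<times> nat) set \<Rightarrow> (nat \<times> nat \<Rightarrow> nat \<times> nat) \<Rightarrow> hardy2 \<Rightarrow> hardy2" where
  "pull D \<pi> f = h2_coef (\<lambda>p. if p \<in> D then coef f (\<pi> p) else 0)"

lemma sum_pull_le:
  assumes "inj_on \<pi> D" "finite F"
  shows "(\<Sum>p\<in>F. (cmod (if p \<in> D then coef f (\<pi> p) else 0))\<^sup>2) \<le> (norm f)\<^sup>2"
proof -
  have "(\<Sum>p\<in>F. (cmod (if p \<in> D then coef f (\<pi> p) else 0))\<^sup>2) = (\<Sum>p\<in>F \<inter> D. (cmod (coef f (\<pi> p)))\<^sup>2)"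
    using assms(2) by (subst sum.inter_restrict) (auto intro!: sum.cong)
  also have "\<dots> = (\<Sum>q\<in>\<pi> ` (F \<inter> D). (cmod (coef f q))\<^sup>2)"
    using assms(1) by (subst sum.reindex) (auto intro: inj_on_subset)
  also have "\<dots> \<le> (norm f)\<^sup>2" using assms(2) by (intro sum_coef_le_norm) simp
  finally show ?thesis .
qed

lemma coef_pull:
  assumes "inj_on \<pi> D"
  shows "coef (pull D \<pi> f) = (\<lambda>p. if p \<in> D then coef f (\<pi> p) else 0)"
  unfolding pull_def by (rule coef_h2_coef[OF square_summableI[OF sum_pull_le[OF assms]]])

lemma norm_pull_le: "inj_on \<pi> D \<Longrightarrow> norm (pull D \<pi> f) \<le> norm f"
  by (intro norm_le_coef) (simp_all add: coef_pull sum_pull_le)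

lemma pull_add: "inj_on \<pi> D \<Longrightarrow> pull D \<pi> (f + g) = pull D \<pi> f + pull D \<pi> g"
  and pull_scaleC: "inj_on \<pi> D \<Longrightarrow> pull D \<pi> (c *\<^sub>C f) = c *\<^sub>C pull D \<pi> f"
  by (rule coef_inject, rule ext, simp add: coef_pull coef_add coef_scaleC)+

text \<open>For a bijection from \<open>D\<close> to \<open>D'\<close>, reindexing along the inverse
  is the adjoint: the same products are summed over \<open>D\<close> or over
  \<open>D'\<close>.\<close>

lemma cinner_pull:
  assumes "\<And>p. p \<in> D \<Longrightarrow> \<pi> p \<in> D' \<and> \<rho> (\<pi> p) = p" "\<And>q. q \<in> D' \<Longrightarrow> \<rho> q \<in> D \<and> \<pi> (\<rho> q) = q"
  shows "cinner (pull D \<pi> x) y = cinner x (pull D' \<rho> y)"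
proof -
  have inj: "inj_on \<pi> D" "inj_on \<rho> D'"
    using assms by (auto intro: inj_on_inverseI[where g = \<rho>] inj_on_inverseI[where g = \<pi>])
  have "cinner (pull D \<pi> x) y = (\<Sum>\<^sub>\<infinity>p\<in>D. coef x (\<pi> p) * cnj (coef y p))"
    unfolding cinner_hardy2_def coef_pull[OF inj(1)] by (rule infsum_cong_neutral) auto
  also have "\<dots> = (\<Sum>\<^sub>\<infinity>q\<in>D'. coef x q * cnj (coef y (\<rho> q)))"
    using assms by (intro infsum_reindex_bij_witness[where i = \<rho> and j = \<pi>]) auto
  also have "\<dots> = cinner x (pull D' \<rho> y)"
    unfolding cinner_hardy2_def coef_pull[OF inj(2)] by (rule infsum_cong_neutral) auto
  finally show ?thesis .
qed

lemma cinner_finite_support: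
  assumes "finite F" "\<And>p. p \<notin> F \<Longrightarrow> coef y p = 0"
  shows "cinner x y = (\<Sum>p\<in>F. coef x p * cnj (coef y p))"
proof -
  have "cinner x y = (\<Sum>\<^sub>\<infinity>p\<in>F. coef x p * cnj (coef y p))"
    unfolding cinner_hardy2_def using assms(2) by (intro infsum_cong_neutral) auto
  then show ?thesis using assms(1) by simp
qed

section \<open>Polynomials and the coefficient criterion for the quotient module\<close>

text \<open>Polynomials are nested with \<open>w\<close> outside, so the outer index is the exponent
  of \<open>w\<close> and the inner one that of \<open>z\<close>. The swap in \<open>S\<close>
  restores the order used for Taylor coefficients.\<close>

lemma taylor2_eval_zw: "taylor2 (\<lambda>(i, j). coeff (coeff r j) i) (eval_zw r)"
  unfolding taylor2_def
proof (intro ballI)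
  fix z w :: complex
  define S where "S = prod.swap ` (SIGMA j:{..degree r}. {..degree (coeff r j)})"
  have "eval_zw r z w = (\<Sum>j\<le>degree r. poly (coeff r j) z * w ^ j)"
    unfolding eval_zw_def poly_altdef[of r] by (simp add: poly_sum poly_power)
  also have "\<dots> = (\<Sum>j\<le>degree r. \<Sum>i\<le>degree (coeff r j). coeff (coeff r j) i * z ^ i * w ^ j)"
    by (simp add: poly_altdef sum_distrib_right)
  also have "\<dots> = (\<Sum>(j, i)\<in>(SIGMA j:{..degree r}. {..degree (coeff r j)}). coeff (coeff r j) i * z ^ i * w ^ j)"
    by (rule sum.Sigma) auto
  also have "\<dots> = (\<Sum>(i, j)\<in>S. coeff (coeff r j) i * z ^ i * w ^ j)"
    unfolding S_def by (subst sum.reindex) (auto simp: case_prod_unfold)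
  finally have "((\<lambda>(i, j). coeff (coeff r j) i * z ^ i * w ^ j) has_sum eval_zw r z w) S"
    by (intro has_sum_finiteI) (auto simp: S_def)
  moreover have "coeff (coeff r j) i = 0" if "(i, j) \<notin> S" for i j
  proof (rule ccontr)
    assume nz: "coeff (coeff r j) i \<noteq> 0"
    then have "i \<le> degree (coeff r j)" by (rule le_degree)
    moreover have "j \<le> degree r" using nz by (intro le_degree) auto
    ultimately have "(j, i) \<in> (SIGMA j:{..degree r}. {..degree (coeff r j)})" by auto
    then have "(i, j) \<in> S" unfolding S_def by (intro image_eqI[of _ _ "(j, i)"]) auto
    with that show False by simp
  qed
  ultimately show "((\<lambda>(i, j). (case (i, j) of (i, j) \<Rightarrow> coeff (coeff r j) i) * z ^ i * w ^ j)
      has_sum eval_zw r z w) UNIV"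
    by (subst has_sum_cong_neutral[where T = S]) auto
qed

lemma coef_h2_of_eval_zw: "coef (h2_of (eval_zw r)) = (\<lambda>(i, j). coeff (coeff r j) i)"
proof (rule coef_h2_of[OF _ taylor2_eval_zw])
  have "{p. (case p of (i, j) \<Rightarrow> coeff (coeff r j) i) \<noteq> 0}
      \<subseteq> prod.swap ` (SIGMA j:{..degree r}. {..degree (coeff r j)})"
  proof
    fix p assume "p \<in> {p. (case p of (i, j) \<Rightarrow> coeff (coeff r j) i) \<noteq> 0}"
    moreover obtain i j where p: "p = (i, j)" by (cases p)
    ultimately have nz: "coeff (coeff r j) i \<noteq> 0" by simp
    then have "i \<le> degree (coeff r j)" by (rule le_degree)
    moreover have "j \<le> degree r" using nz by (intro le_degree) auto
    ultimately show "p \<in> prod.swap ` (SIGMA j:{..degree r}. {..degree (coeff r j)})"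
      unfolding p by (intro image_eqI[of _ _ "(j, i)"]) auto
  qed
  then show "square_summable (\<lambda>(i, j). coeff (coeff r j) i)"
    by (intro square_summable_finite_support) (erule finite_subset, auto)
qed

lemma cinner_monomial:
  "cinner x (h2_of (eval_zw (monom (monom c i) j))) = cnj c * coef x (i, j)"
  by (subst cinner_finite_support[of "{(i, j)}"]) (auto simp: coef_h2_of_eval_zw split: if_splits)

lemma h2_of_eval_zw_add: "h2_of (eval_zw (p + q)) = h2_of (eval_zw p) + h2_of (eval_zw q)"
  and h2_of_eval_zw_diff: "h2_of (eval_zw (p - q)) = h2_of (eval_zw p) - h2_of (eval_zw q)"
  by (rule coef_inject, rule ext, simp add: coef_h2_of_eval_zw coef_add coef_diff case_prod_unfold)+

lemma var_z_power: "var_z ^ m = monom (monom 1 m) 0"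
proof -
  have v: "var_z = monom (monom 1 1) 0" by (simp add: var_z_def monom_0 monom_Suc)
  have "var_z * monom (monom 1 m) 0 = monom (monom 1 (Suc m)) 0" for m
    unfolding v mult_monom by simp
  then show ?thesis by (induction m) (simp_all add: monom_0 one_pCons)
qed

lemma var_w_power: "var_w ^ n = monom 1 n"
proof -
  have v: "var_w = monom 1 1" by (simp add: var_w_def monom_0 monom_Suc)
  have "var_w * monom 1 n = monom 1 (Suc n)" for n
    unfolding v mult_monom by simp
  then show ?thesis by (induction n) (simp_all add: monom_0 one_pCons)
qed

lemma mem_quotient_N: "x \<in> quotient_N m n \<longleftrightarrow> (\<forall>i k. coef x (i + m, k) = coef x (i, k + n))"
proof -
  let ?p = "var_z ^ m - var_w ^ n"
  have mono: "cinner x (h2_of (eval_zw (?p * monom (monom c i) k)))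
      = cnj c * (coef x (i + m, k) - coef x (i, k + n))" for c i k
  proof -
    have "?p * monom (monom c i) k = monom (monom c (i + m)) k - monom (monom c i) (k + n)"
      unfolding left_diff_distrib var_z_power var_w_power mult_monom by (simp add: add.commute)
    then show ?thesis
      by (simp add: h2_of_eval_zw_diff cinner_diff_right cinner_monomial right_diff_distrib)
  qed
  have "x \<in> quotient_N m n \<longleftrightarrow> (\<forall>q. cinner x (h2_of (eval_zw (?p * q))) = 0)"
    unfolding quotient_N_def poly_submodule_def orth_compl_closure by (auto simp: orth_compl_def)
  also have "\<dots> \<longleftrightarrow> (\<forall>i k. coef x (i + m, k) = coef x (i, k + n))"
  proof
    assume "\<forall>q. cinner x (h2_of (eval_zw (?p * q))) = 0"
    then have "cnj 1 * (coef x (i + m, k) - coef x (i, k + n)) = 0" for i k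
      unfolding mono[symmetric] by blast
    then show "\<forall>i k. coef x (i + m, k) = coef x (i, k + n)" by simp
  next
    assume eq: "\<forall>i k. coef x (i + m, k) = coef x (i, k + n)"
    \<comment> \<open>\<open>Z\<close> is only shown to be additive; this suffices, because the
      monomials placed in it carry arbitrary coefficients \<open>c\<close>.\<close>
    define Z where "Z = {q. cinner x (h2_of (eval_zw (?p * q))) = 0}"
    have "0 \<in> Z" using mono[of 0 0 0] by (simp add: Z_def)
    moreover have "q + r \<in> Z" if "q \<in> Z" "r \<in> Z" for q r
      using that by (simp add: Z_def distrib_left h2_of_eval_zw_add cinner_add_right)
    ultimately have Z_sum: "sum f {..d} \<in> Z" if "\<And>i. f i \<in> Z" for f and d :: nat
      by (induction d) (simp_all add: that)
    have "q \<in> Z" for q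
    proof -
      have Z1: "monom (monom c i) k \<in> Z" for c i k using mono eq by (simp add: Z_def)
      have "monom (coeff q k) k \<in> Z" for k
      proof -
        have "(\<Sum>i\<le>degree (coeff q k). monom (monom (coeff (coeff q k) i) i) k)
            = monom (\<Sum>i\<le>degree (coeff q k). monom (coeff (coeff q k) i) i) k"
          by (rule poly_eqI) (simp add: coeff_sum)
        then have "monom (coeff q k) k = (\<Sum>i\<le>degree (coeff q k). monom (monom (coeff (coeff q k) i) i) k)"
          by (simp only: poly_as_sum_of_monoms)
        also have "\<dots> \<in> Z" by (rule Z_sum) (rule Z1)
        finally show ?thesis .
      qed
      then have "(\<Sum>k\<le>degree q. monom (coeff q k) k) \<in> Z" by (rule Z_sum)
      then show ?thesis by (simp only: poly_as_sum_of_monoms)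
    qed
    then show "\<forall>q. cinner x (h2_of (eval_zw (?p * q))) = 0" by (simp add: Z_def)
  qed
  finally show ?thesis .
qed

lemma coef_mult_z: "coef (mult_z f) = (\<lambda>(i, k). if 0 < i then coef f (i - 1, k) else 0)"
proof -
  have inj: "inj_on (\<lambda>(i, k). (i - 1, k)) {p :: nat \<times> nat. 0 < fst p}"
    by (auto simp: inj_on_def)
  have "square_summable (\<lambda>p. if 0 < fst p then coef f (fst p - 1, snd p) else 0)"
    using coef(1)[of "pull {p. 0 < fst p} (\<lambda>(i, k). (i - 1, k)) f"]
    unfolding coef_pull[OF inj] by (simp only: case_prod_unfold mem_Collect_eq)
  moreover have "taylor2 (\<lambda>p. if 0 < fst p then coef f (fst p - 1, snd p) else 0) (\<lambda>z w. z * h2_fun f z w)"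
    unfolding taylor2_def
  proof (intro ballI)
    fix z w assume "z \<in> \<D>" "w \<in> \<D>"
    then have "((\<lambda>(i, k). coef f (i, k) * z ^ i * w ^ k) has_sum h2_fun f z w) UNIV"
      using coef(2)[of f] by (simp add: taylor2_def)
    from has_sum_cmult_right[OF this, of z]
    have "((\<lambda>(i, k). coef f (i - 1, k) * z ^ i * w ^ k) has_sum z * h2_fun f z w) {p. 0 < fst p}"
      by (subst has_sum_reindex_bij_witness[where i = "\<lambda>(i, k). (i + 1, k)" and j = "\<lambda>(i, k). (i - 1, k)" and T = UNIV
            and h = "\<lambda>p. z * (case p of (i, k) \<Rightarrow> coef f (i, k) * z ^ i * w ^ k)" and s' = "z * h2_fun f z w"])
         (auto simp: power_eq_if)
    then show "((\<lambda>(i, j). (if 0 < fst (i, j) then coef f (fst (i, j) - 1, snd (i, j)) else 0) * z ^ i * w ^ j)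
        has_sum z * h2_fun f z w) UNIV"
      by (rule has_sum_cong_neutral[THEN iffD1, rotated -1]) auto
  qed
  ultimately show ?thesis
    unfolding mult_z_def by (subst coef_h2_of) (auto simp: case_prod_unfold)
qed

section \<open>Power series with vector coefficients\<close>

definition conj_powser :: "(nat \<Rightarrow> 'a::{complex_inner, banach}) \<Rightarrow> complex \<Rightarrow> 'a" where
  "conj_powser v \<mu> = (\<Sum>l. cnj \<mu> ^ l *\<^sub>C v l)"

text \<open>Here \<open>r\<close> takes both signs, the form in which
  \<open>termdiff_converges\<close> consumes convergence of a series to yield that of its
  derivative.\<close>

definition disk_summable :: "(nat \<Rightarrow> 'a::{complex_inner, banach}) \<Rightarrow> bool" where
  "disk_summable v \<longleftrightarrow> (\<forall>r::real. norm r < 1 \<longrightarrow> summable (\<lambda>l. norm (v l) * r ^ l))"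

lemma conj_powser_sums:
  assumes "disk_summable v" "\<mu> \<in> \<D>"
  shows "(\<lambda>l. cnj \<mu> ^ l *\<^sub>C v l) sums conj_powser v \<mu>"
proof -
  have "summable (\<lambda>l. norm (v l) * cmod \<mu> ^ l)"
    using assms by (simp add: disk_summable_def)
  then have "summable (\<lambda>l. norm (cnj \<mu> ^ l *\<^sub>C v l))"
    by (simp add: norm_scaleC norm_power mult.commute)
  then show ?thesis
    unfolding conj_powser_def by (rule summable_sums[OF summable_norm_cancel])
qed

lemma disk_summable_diffs:
  assumes "disk_summable v"
  shows "disk_summable (\<lambda>l. of_nat (Suc l) *\<^sub>C v (Suc l))"
  unfolding disk_summable_def
proof (intro allI impI)
  fix r :: real assume "norm r < 1"
  then have "summable (\<lambda>l. diffs (\<lambda>l. norm (v l)) l * r ^ l)"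
    using assms by (intro termdiff_converges[where K = 1]) (auto simp: disk_summable_def)
  moreover have "norm (of_nat (Suc l) *\<^sub>C v (Suc l)) = diffs (\<lambda>l. norm (v l)) l" for l
    unfolding diffs_def norm_scaleC norm_of_nat ..
  ultimately show "summable (\<lambda>l. norm (of_nat (Suc l) *\<^sub>C v (Suc l)) * r ^ l)"
    by (simp only:)
qed

text \<open>Termwise differentiation on a smaller disk of radius \<open>r\<close> between
  \<open>cmod \<mu>\<close> and \<open>1\<close>, where the differentiated series converges
  uniformly by the Weierstrass test.\<close>

lemma conj_powser_has_derivative:
  assumes v: "disk_summable v" and \<mu>: "\<mu> \<in> \<D>"
  shows "(conj_powser v has_derivative
    (\<lambda>h. cnj h *\<^sub>C conj_powser (\<lambda>l. of_nat (Suc l) *\<^sub>C v (Suc l)) \<mu>)) (at \<mu>)"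
proof -
  let ?v' = "\<lambda>l. of_nat (Suc l) *\<^sub>C v (Suc l)"
  obtain r where r: "cmod \<mu> < r" "r < 1" using \<mu> dense[of "cmod \<mu>" 1] by auto
  then have "0 \<le> r" using norm_ge_zero[of \<mu>] by linarith
  define S where "S = ball (0::complex) r"
  have S: "x \<in> \<D>" if "x \<in> S" for x using that r by (simp add: S_def)
  \<comment> \<open>For \<open>l = 0\<close> the truncated exponent is harmless, as the factor
    \<open>of_nat l\<close> vanishes; the series of derivatives may therefore start at
    \<open>0\<close>.\<close>
  define f' where "f' l x = (of_nat l * cnj x ^ (l - 1)) *\<^sub>C v l" for l x
  have f'_Suc: "f' (Suc l) x = cnj x ^ l *\<^sub>C ?v' l" for l x
    by (simp only: f'_def scaleC_scaleC diff_Suc_1 mult.commute)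
  have f'_sums: "(\<lambda>l. f' l x) sums conj_powser ?v' x" if "x \<in> \<D>" for x
  proof -
    have "(\<lambda>l. f' (Suc l) x) sums conj_powser ?v' x"
      unfolding f'_Suc by (rule conj_powser_sums[OF disk_summable_diffs[OF v] that])
    then show ?thesis by (subst (asm) sums_Suc_iff) (simp add: f'_def)
  qed
  have "summable (\<lambda>l. norm (?v' l) * r ^ l)"
    using disk_summable_diffs[OF v] r \<open>0 \<le> r\<close> by (simp add: disk_summable_def)
  then have sM: "summable (\<lambda>l. of_nat l * r ^ (l - 1) * norm (v l))"
    by (subst summable_Suc_iff[symmetric]) (simp add: norm_scaleC mult_ac del: of_nat_Suc)
  have "uniform_limit S (\<lambda>n x. \<Sum>l<n. f' l x) (\<lambda>x. \<Sum>l. f' l x) sequentially"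
  proof (rule Weierstrass_m_test[OF _ sM])
    fix l x assume "x \<in> S"
    then have "cmod x ^ (l - 1) \<le> r ^ (l - 1)" by (intro power_mono) (auto simp: S_def)
    then show "norm (f' l x) \<le> of_nat l * r ^ (l - 1) * norm (v l)"
      by (simp add: f'_def norm_scaleC norm_mult norm_power mult_right_mono mult_left_mono)
  qed
  then have unif: "uniform_limit S (\<lambda>n x. \<Sum>l<n. f' l x) (conj_powser ?v') sequentially"
    using sums_unique[OF f'_sums[OF S]] by (simp add: uniform_limit_iff)
  have "\<exists>F. \<forall>x\<in>S. (\<lambda>l. cnj x ^ l *\<^sub>C v l) sums F x
      \<and> (F has_derivative (\<lambda>h. cnj h *\<^sub>C conj_powser ?v' x)) (at x within S)"
  proof (rule has_derivative_series)
    show "convex S" by (simp add: S_def)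
    show "((\<lambda>x. cnj x ^ l *\<^sub>C v l) has_derivative (\<lambda>h. cnj h *\<^sub>C f' l x)) (at x within S)" for l x
    proof -
      have "((\<lambda>x. cnj x ^ l) has_derivative (\<lambda>h. of_nat l * cnj h * cnj x ^ (l - 1))) (at x within S)"
        by (intro has_derivative_power bounded_linear.has_derivative[OF bounded_linear_cnj] has_derivative_ident)
      from bounded_linear.has_derivative[OF bounded_linear_scaleC_left this, of "v l"]
      show ?thesis by (simp add: f'_def scaleC_scaleC mult_ac)
    qed
    show "\<forall>\<^sub>F k in sequentially. \<forall>x\<in>S. \<forall>h.
        norm ((\<Sum>l<k. cnj h *\<^sub>C f' l x) - cnj h *\<^sub>C conj_powser ?v' x) \<le> e * norm h"
      if "e > 0" for e :: real
    proof -
      have "\<forall>\<^sub>F k in sequentially. \<forall>x\<in>S. dist (\<Sum>l<k. f' l x) (conj_powser ?v' x) < e"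
        using unif that by (simp add: uniform_limit_iff)
      then show ?thesis
      proof (rule eventually_mono, intro ballI allI)
        fix k x and h :: complex
        assume "\<forall>x\<in>S. dist (\<Sum>l<k. f' l x) (conj_powser ?v' x) < e" "x \<in> S"
        then have "norm ((\<Sum>l<k. f' l x) - conj_powser ?v' x) \<le> e" by (auto simp: dist_norm less_imp_le)
        then have "cmod h * norm ((\<Sum>l<k. f' l x) - conj_powser ?v' x) \<le> cmod h * e"
          by (intro mult_left_mono) auto
        then show "norm ((\<Sum>l<k. cnj h *\<^sub>C f' l x) - cnj h *\<^sub>C conj_powser ?v' x) \<le> e * norm h"
          by (simp add: scaleC_sum_right[symmetric] scaleC_diff_right[symmetric] norm_scaleC mult.commute)
      qed
    qed
    show "\<mu> \<in> S" using r by (simp add: S_def)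
    show "(\<lambda>l. cnj \<mu> ^ l *\<^sub>C v l) sums conj_powser v \<mu>" by (rule conj_powser_sums[OF v \<mu>])
  qed
  then obtain F where "\<forall>x\<in>S. (\<lambda>l. cnj x ^ l *\<^sub>C v l) sums F x
      \<and> (F has_derivative (\<lambda>h. cnj h *\<^sub>C conj_powser ?v' x)) (at x within S)" ..
  then have F: "(\<lambda>l. cnj x ^ l *\<^sub>C v l) sums F x"
    "(F has_derivative (\<lambda>h. cnj h *\<^sub>C conj_powser ?v' x)) (at x within S)" if "x \<in> S" for x
    using that by simp_all
  have "open S" "\<mu> \<in> S" using r by (simp_all add: S_def)
  then have "(F has_derivative (\<lambda>h. cnj h *\<^sub>C conj_powser ?v' \<mu>)) (at \<mu>)"
    using F(2)[of \<mu>] by (simp only: at_within_open)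
  then show ?thesis
    using \<open>open S\<close> \<open>\<mu> \<in> S\<close>
  proof (rule has_derivative_transform_within_open)
    show "F x = conj_powser v x" if "x \<in> S" for x
      using sums_unique2[OF F(1)[OF that] conj_powser_sums[OF v S[OF that]]] .
  qed
qed

text \<open>Both partial derivatives are constant multiples of a series of the same kind, so an
  induction over all coefficient sequences gives every order.\<close>

lemma conj_powser_smooth: "disk_summable v \<Longrightarrow> smooth_on \<D> (conj_powser v)"
proof -
  have "disk_summable v \<Longrightarrow> Ck_on k \<D> (conj_powser v)" for k
  proof (induction k arbitrary: v)
    case 0
    have "isCont (conj_powser v) \<mu>" if "\<mu> \<in> \<D>" for \<mu>
      by (rule has_derivative_continuous[OF conj_powser_has_derivative[OF 0 that]])
    then show ?case by (simp add: continuous_at_imp_continuous_on)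
  next
    case (Suc k)
    let ?v' = "\<lambda>l. of_nat (Suc l) *\<^sub>C v (Suc l)"
    note C = Suc.IH[OF disk_summable_diffs[OF Suc.prems]]
    have "cnj h *\<^sub>C x = Re h *\<^sub>R x + Im h *\<^sub>R (- \<i>) *\<^sub>C x" for h and x :: 'a
      unfolding scaleR_eq_scaleC scaleC_scaleC scaleC_add_left[symmetric]
      by (rule arg_cong[of _ _ "\<lambda>c. c *\<^sub>C x"]) (simp add: complex_eq_iff)
    then show ?case
      using conj_powser_has_derivative[OF Suc.prems] C
        Ck_on_bounded_linear[OF bounded_linear_scaleC_right[of "- \<i>"] C]
      by (intro Ck_on_SucI[where fx = "conj_powser ?v'" and fy = "\<lambda>\<mu>. (- \<i>) *\<^sub>C conj_powser ?v' \<mu>"]) simp_all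
  qed
  then show "disk_summable v \<Longrightarrow> smooth_on \<D> (conj_powser v)" by (simp add: smooth_on_def)
qed

section \<open>The quotient module as a direct sum of weighted sequence spaces\<close>

lemma cinner_disjoint_support:
  fixes x y :: hardy2
  assumes "\<And>p. coef x p = 0 \<or> coef y p = 0"
  shows "cinner x y = 0"
proof -
  have "coef x p * cnj (coef y p) = 0" for p using assms[of p] by auto
  then show ?thesis unfolding cinner_hardy2_def by (rule infsum_0)
qed

text \<open>Writing \<open>k = j + n * q\<close> identifies the residue class with the set of all
  \<open>q\<close>. This turns \<open>w ^ j\<close> times a series in \<open>w ^ n\<close> into a
  series over all exponents of \<open>w\<close>.\<close>

lemma has_sum_residue_class:
  fixes c :: "nat \<Rightarrow> 'a::{comm_monoid_add, topological_space}"
  assumes "(c has_sum s) UNIV" "j < n"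
  shows "((\<lambda>k. if k mod n = j then c (k div n) else 0) has_sum s) UNIV"
proof -
  have "((\<lambda>k. c (k div n)) has_sum s) {k. k mod n = j} \<longleftrightarrow> (c has_sum s) UNIV"
    by (rule has_sum_reindex_bij_witness[where i = "\<lambda>q. j + n * q" and j = "\<lambda>k. k div n"])
      (use assms(2) in \<open>auto simp: mod_mult_div_eq\<close>)
  with assms(1) have "((\<lambda>k. c (k div n)) has_sum s) {k. k mod n = j}" by simp
  then show ?thesis by (rule has_sum_cong_neutral[THEN iffD1, rotated -1]) auto
qed

text \<open>Each new square is at most \<open>cmod w\<close> times the previous one plus the square
  of \<open>b i\<close> over \<open>1 - cmod w\<close>. After summation the first contribution is
  absorbed on the left, so \<open>L\<close> enters the bound only through the sum over
  \<open>b\<close>.\<close>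

lemma recurrence_square_sum:
  fixes y b :: "nat \<Rightarrow> complex"
  assumes rec: "\<And>i. y (Suc i) = w * y i + b i" and r: "cmod w < 1"
  shows "(1 - cmod w) * (\<Sum>i<L. (cmod (y i))\<^sup>2)
    \<le> (cmod (y 0))\<^sup>2 + (\<Sum>i<L. (cmod (b i))\<^sup>2) / (1 - cmod w)"
proof -
  let ?r = "cmod w" and ?Y = "\<Sum>i<L. (cmod (y i))\<^sup>2"
  text \<open>Convexity of the square, with weights \<open>r\<close> and \<open>1 - r\<close>.\<close>
  have convex: "(a * s + (1 - a) * t)\<^sup>2 = a * s\<^sup>2 + (1 - a) * t\<^sup>2 - a * (1 - a) * (s - t)\<^sup>2" for a s t :: real
    by (simp add: power2_eq_square algebra_simps)
  have step: "(cmod (y (Suc i)))\<^sup>2 \<le> ?r * (cmod (y i))\<^sup>2 + (cmod (b i))\<^sup>2 / (1 - ?r)" for i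
  proof -
    let ?s = "cmod (y i)" and ?t = "cmod (b i) / (1 - ?r)"
    have "cmod (y (Suc i)) \<le> ?r * ?s + cmod (b i)"
      unfolding rec using norm_triangle_ineq[of "w * y i" "b i"] by (simp add: norm_mult)
    also have "\<dots> = ?r * ?s + (1 - ?r) * ?t" using r by simp
    finally have "(cmod (y (Suc i)))\<^sup>2 \<le> (?r * ?s + (1 - ?r) * ?t)\<^sup>2" by (intro power_mono) auto
    also have "\<dots> = ?r * ?s\<^sup>2 + (1 - ?r) * ?t\<^sup>2 - ?r * (1 - ?r) * (?s - ?t)\<^sup>2"
      by (rule convex)
    also have "\<dots> \<le> ?r * ?s\<^sup>2 + (1 - ?r) * ?t\<^sup>2" using r by simp
    also have "(1 - ?r) * ?t\<^sup>2 = (cmod (b i))\<^sup>2 / (1 - ?r)"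
      using r by (simp add: power2_eq_square)
    finally show ?thesis .
  qed
  have "?Y \<le> (\<Sum>i<Suc L. (cmod (y i))\<^sup>2)" by simp
  also have "\<dots> = (cmod (y 0))\<^sup>2 + (\<Sum>i<L. (cmod (y (Suc i)))\<^sup>2)" by (rule sum.lessThan_Suc_shift)
  also have "(\<Sum>i<L. (cmod (y (Suc i)))\<^sup>2) \<le> (\<Sum>i<L. ?r * (cmod (y i))\<^sup>2 + (cmod (b i))\<^sup>2 / (1 - ?r))"
    by (intro sum_mono step)
  also have "\<dots> = ?r * ?Y + (\<Sum>i<L. (cmod (b i))\<^sup>2) / (1 - ?r)"
    by (simp add: sum.distrib sum_distrib_left sum_divide_distrib)
  finally show ?thesis by (simp add: algebra_simps)
qed

locale monomial_quotient =
  fixes m n :: nat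
  assumes m_pos: "0 < m" and n_pos: "0 < n"
begin

abbreviation "N \<equiv> quotient_N m n"
abbreviation "S \<equiv> S_z m n"
abbreviation "e \<equiv> e_vec m n"

lemma csubspace_N: "csubspace N" and closed_N: "closed N"
  by (simp_all add: quotient_N_def csubspace_orth_compl closed_orth_compl)

lemma complete_N: "complete N"
  using closed_N by (simp add: complete_eq_closed)

text \<open>Passing from \<open>k\<close> to \<open>k mod n\<close> trades \<open>k div n\<close>
  steps of length \<open>n\<close> in the exponent of \<open>w\<close> for as many steps of length
  \<open>m\<close> in that of \<open>z\<close>.\<close>

lemma coef_N:
  assumes "x \<in> N"
  shows "coef x (i, k) = coef x (i + m * (k div n), k mod n)"
proof -
  have "coef x (i, j + n * q) = coef x (i + m * q, j)" for i j q
  proof (induction q arbitrary: i)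
    case (Suc q)
    have "coef x (i, j + n * Suc q) = coef x (i + m, j + n * q)"
      using assms unfolding mem_quotient_N by (simp add: algebra_simps)
    then show ?case using Suc[of "i + m"] by (simp add: algebra_simps)
  qed simp
  from this[of i "k mod n" "k div n"] show ?thesis by simp
qed

lemma N_eqI:
  assumes "x \<in> N" "y \<in> N" "\<And>l j. j < n \<Longrightarrow> coef x (l, j) = coef y (l, j)"
  shows "x = y"
proof (intro coef_inject ext)
  fix p show "coef x p = coef y p"
    using coef_N[OF assms(1)] coef_N[OF assms(2)] assms(3) n_pos by (cases p) simp
qed

section \<open>The orthogonal basis of the quotient module\<close>

definition fib :: "nat \<Rightarrow> (nat \<times> nat) set" where "fib l = {(i, q). i + m * q = l}"
definition d :: "nat \<Rightarrow> nat" where "d l = card (fib l)"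
definition supp :: "nat \<Rightarrow> nat \<Rightarrow> (nat \<times> nat) set" where
  "supp j l = {(i, k). k mod n = j \<and> i + m * (k div n) = l}"
text \<open>For \<open>j < n\<close>, as a function, the sum of z^i w^(j + n q) over i + m q = l.
  These vectors form an orthogonal basis of \<open>N\<close> with squared norms \<open>d l\<close>,
  in which \<open>x\<close> has the coordinates \<open>coef x (l, j)\<close>.\<close>

definition g :: "nat \<Rightarrow> nat \<Rightarrow> hardy2" where
  "g j l = h2_coef (\<lambda>p. if p \<in> supp j l then 1 else 0)"

lemma inj_fst_fib: "inj_on fst (fib l)"
  using m_pos by (auto simp: inj_on_def fib_def)

lemma fst_fib: "fst ` fib l \<subseteq> {..l}" by (auto simp: fib_def)

lemma finite_fib: "finite (fib l)"
  using finite_subset[OF fst_fib] finite_imageD[OF _ inj_fst_fib] by blast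

lemma d_pos: "0 < d l"
proof -
  have "(l, 0) \<in> fib l" by (simp add: fib_def)
  then show ?thesis using finite_fib unfolding d_def card_gt_0_iff by blast
qed

lemma d_le: "d l \<le> Suc l"
  using card_inj_on_le[OF inj_fst_fib fst_fib] by (simp add: d_def)

lemma supp_eq: "j < n \<Longrightarrow> supp j l = (\<lambda>(i, q). (i, j + n * q)) ` fib l"
  by (auto simp: supp_def fib_def image_iff) (metis mod_mult_div_eq)

lemma finite_supp: "j < n \<Longrightarrow> finite (supp j l)"
  by (simp add: supp_eq finite_fib)

lemma card_supp: "j < n \<Longrightarrow> card (supp j l) = d l"
  unfolding supp_eq d_def using n_pos by (intro card_image) (auto simp: inj_on_def)

lemma coef_g: "j < n \<Longrightarrow> coef (g j l) = (\<lambda>p. if p \<in> supp j l then 1 else 0)"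
  unfolding g_def
  by (intro coef_h2_coef square_summable_finite_support) (simp add: finite_supp)

lemma coef_g': "j < n \<Longrightarrow> j' < n \<Longrightarrow> coef (g j l) (l', j') = (if j' = j \<and> l' = l then 1 else 0)"
  by (auto simp: coef_g supp_def)

lemma g_in_N: "j < n \<Longrightarrow> g j l \<in> N"
  using n_pos by (simp add: mem_quotient_N coef_g supp_def algebra_simps)

text \<open>The coefficients of \<open>x\<close> are constant on \<open>supp j l\<close>, a set of
  \<open>d l\<close> elements whose indicator is the coefficient array of
  \<open>g j l\<close>.\<close>

lemma cinner_g:
  assumes "x \<in> N" "j < n"
  shows "cinner x (g j l) = of_nat (d l) * coef x (l, j)"
proof -
  have "cinner x (g j l) = (\<Sum>p\<in>supp j l. coef x p * cnj (coef (g j l) p))"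
    by (rule cinner_finite_support) (simp_all add: finite_supp assms coef_g)
  also have "\<dots> = (\<Sum>p\<in>supp j l. coef x (l, j))"
  proof (rule sum.cong[OF refl])
    fix p assume p: "p \<in> supp j l"
    then show "coef x p * cnj (coef (g j l) p) = coef x (l, j)"
      using coef_N[OF assms(1), of "fst p" "snd p"] by (simp add: coef_g assms supp_def case_prod_unfold)
  qed
  also have "\<dots> = of_nat (d l) * coef x (l, j)" by (simp add: card_supp assms)
  finally show ?thesis .
qed

text \<open>The squared norm is \<open>d l\<close>, at most \<open>l + 1\<close> and so at most its
  square. A crude polynomial bound is all that convergence inside the disk needs.\<close>

lemma norm_g_le: "j < n \<Longrightarrow> norm (g j l) \<le> real (Suc l)"
proof -
  assume j: "j < n"
  have "complex_of_real ((norm (g j l))\<^sup>2) = of_real (real (d l))"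
    unfolding cinner_self_norm[symmetric] using cinner_g[OF g_in_N[OF j] j] j by (simp add: coef_g')
  then have "(norm (g j l))\<^sup>2 = real (d l)" by (simp only: of_real_eq_iff)
  also have "\<dots> \<le> (real (Suc l))\<^sup>2"
    using d_le[of l] by (simp add: power2_eq_square) (metis (no_types) le_square of_nat_le_iff of_nat_mult order_trans of_nat_Suc)
  finally show ?thesis by (rule power2_le_imp_le) simp
qed

lemma disk_summable_g: "j < n \<Longrightarrow> disk_summable (g j)"
  unfolding disk_summable_def
proof (intro allI impI)
  fix r :: real assume j: "j < n" and r: "norm r < 1"
  have "summable (\<lambda>l. of_nat (Suc l) * norm r ^ l)"
    using geometric_deriv_sums[of "norm r"] r by (auto simp: sums_iff)
  then have "summable (\<lambda>l. norm (norm (g j l) * r ^ l))"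
  proof (rule summable_comparison_test')
    show "norm (norm (norm (g j l) * r ^ l)) \<le> of_nat (Suc l) * norm r ^ l" for l
      using norm_g_le[OF j, of l] by (simp add: abs_mult power_abs mult_right_mono del: of_nat_Suc)
  qed
  then show "summable (\<lambda>l. norm (g j l) * r ^ l)" by (rule summable_norm_cancel)
qed

section \<open>The vectors \<open>e j \<mu>\<close>: expansion, norms and totality\<close>

text \<open>Two geometric series: the exponent \<open>i\<close> of \<open>z\<close> contributes
  \<open>cnj \<mu> ^ i\<close>, and \<open>j + n * q\<close> of \<open>w\<close> contributes
  \<open>cnj \<mu> ^ (m * q)\<close>. Their product sees only \<open>i + m * q\<close>, which is why
  \<open>e j \<mu>\<close> lies in \<open>N\<close>.\<close>

lemma coef_e:
  assumes \<mu>: "\<mu> \<in> \<D>" and j: "j < n"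
  shows "coef (e j \<mu>) = (\<lambda>(i, k). if k mod n = j then cnj \<mu> ^ (i + m * (k div n)) else 0)"
  unfolding e_vec_def
proof (rule coef_h2_of)
  let ?a = "\<lambda>(i, k). if k mod n = j then cnj \<mu> ^ (i + m * (k div n)) else 0"
  have \<mu>m: "cmod (\<mu> ^ m) < 1"
    using \<mu> m_pos by (simp add: norm_power power_less_one_iff)
  show "square_summable ?a"
  proof -
    have *: "summable (\<lambda>i. (cmod z)\<^sup>2 ^ i)" if "cmod z < 1" for z
      using that by (intro summable_geometric) (simp add: abs_square_less_1)
    have row: "(\<lambda>i. (cmod \<mu>)\<^sup>2 ^ i) summable_on UNIV"
      using *[of \<mu>] \<mu> by (simp add: summable_on_UNIV_nonneg_real_iff)
    have "(\<lambda>q. (cmod (\<mu> ^ m))\<^sup>2 ^ q) summable_on UNIV"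
      using *[OF \<mu>m] by (simp add: summable_on_UNIV_nonneg_real_iff)
    note col = has_sum_residue_class[OF has_sum_infsum[OF this] j]
    have "(\<lambda>p. case p of (i, k) \<Rightarrow> (cmod \<mu>)\<^sup>2 ^ i * (if k mod n = j then (cmod (\<mu> ^ m))\<^sup>2 ^ (k div n) else 0))
        summable_on UNIV \<times> UNIV"
    proof (rule summable_on_SigmaI)
      show "((\<lambda>k. case (i, k) of (i, k) \<Rightarrow> (cmod \<mu>)\<^sup>2 ^ i * (if k mod n = j then (cmod (\<mu> ^ m))\<^sup>2 ^ (k div n) else 0))
          has_sum (cmod \<mu>)\<^sup>2 ^ i * (\<Sum>\<^sub>\<infinity>q. (cmod (\<mu> ^ m))\<^sup>2 ^ q)) UNIV" for i
        using has_sum_cmult_right[OF col] by simp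
    qed (auto intro!: summable_on_cmult_left row)
    moreover have "(case p of (i, k) \<Rightarrow> (cmod \<mu>)\<^sup>2 ^ i * (if k mod n = j then (cmod (\<mu> ^ m))\<^sup>2 ^ (k div n) else 0))
        = (cmod (?a p))\<^sup>2" for p
      by (cases p) (simp add: norm_mult norm_power power_add power_mult_distrib mult_ac flip: power_mult)
    ultimately show ?thesis by (simp add: square_summable_def)
  qed
  show "taylor2 ?a (\<lambda>z w. 1 / (1 - cnj \<mu> * z) * (w ^ j / (1 - cnj \<mu> ^ m * w ^ n)))"
    unfolding taylor2_def
  proof (intro ballI)
    fix z w :: complex assume z: "z \<in> \<D>" and w: "w \<in> \<D>"
    let ?b = "\<lambda>k. if k mod n = j then w ^ j * (cnj \<mu> ^ m * w ^ n) ^ (k div n) else 0"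
    have z1: "cmod (cnj \<mu> * z) < 1"
      using \<mu> z mult_strict_mono'[of "cmod \<mu>" 1 "cmod z" 1] by (simp add: norm_mult)
    have w1: "cmod (cnj \<mu> ^ m * w ^ n) < 1"
      using \<mu>m w n_pos mult_strict_mono'[of "cmod (\<mu> ^ m)" 1 "cmod (w ^ n)" 1]
      by (simp add: norm_mult norm_power power_less_one_iff)
    note zs = has_sum_geometric[OF z1] and ws = has_sum_geometric[OF w1]
    have "(?b has_sum w ^ j * (1 / (1 - cnj \<mu> ^ m * w ^ n))) UNIV"
      by (rule has_sum_residue_class[OF has_sum_cmult_right[OF ws(1)] j])
    moreover have "(\<lambda>k. norm (?b k)) summable_on UNIV"
    proof -
      have "(\<lambda>q. norm (w ^ j * (cnj \<mu> ^ m * w ^ n) ^ q)) summable_on UNIV"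
        unfolding norm_mult[of "w ^ j"] by (rule summable_on_cmult_right[OF ws(2)])
      from has_sum_residue_class[OF has_sum_infsum[OF this] j]
      show ?thesis by (simp add: if_distrib[of norm] has_sum_imp_summable cong: if_cong)
    qed
    ultimately have "((\<lambda>(i, k). (cnj \<mu> * z) ^ i * ?b k) has_sum
        1 / (1 - cnj \<mu> * z) * (w ^ j * (1 / (1 - cnj \<mu> ^ m * w ^ n)))) (UNIV \<times> UNIV)"
      by (intro has_sum_product zs)
    moreover have "(cnj \<mu> * z) ^ i * ?b k = ?a (i, k) * z ^ i * w ^ k" for i k
    proof (cases "k mod n = j")
      case True
      have "w ^ k = w ^ (j + n * (k div n))" using True mod_mult_div_eq[of k n] by auto
      with True show ?thesis
        by (simp add: power_add power_mult power_mult_distrib mult_ac)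
    qed simp
    ultimately show "((\<lambda>(i, k). ?a (i, k) * z ^ i * w ^ k) has_sum
        1 / (1 - cnj \<mu> * z) * (w ^ j / (1 - cnj \<mu> ^ m * w ^ n))) UNIV"
      by simp
  qed
qed

lemma coef_e': "\<mu> \<in> \<D> \<Longrightarrow> j < n \<Longrightarrow> j' < n \<Longrightarrow> coef (e j \<mu>) (l, j') = (if j' = j then cnj \<mu> ^ l else 0)"
  by (simp add: coef_e)

lemma e_in_N: "\<mu> \<in> \<D> \<Longrightarrow> j < n \<Longrightarrow> e j \<mu> \<in> N"
  using n_pos by (simp add: mem_quotient_N coef_e algebra_simps)

text \<open>An index pair lies in \<open>supp j l\<close> for at most one \<open>l\<close>, so each
  coefficient of the series comes from a single term. This expansion is the source of both the
  antiholomorphy and the smoothness of the frame.\<close>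

lemma e_eq_conj_powser:
  assumes \<mu>: "\<mu> \<in> \<D>" and j: "j < n"
  shows "e j \<mu> = conj_powser (g j) \<mu>"
proof (intro coef_inject ext)
  fix p :: "nat \<times> nat"
  obtain i k where p: "p = (i, k)" by (cases p)
  let ?l = "i + m * (k div n)"
  have "(\<lambda>l. coef (cnj \<mu> ^ l *\<^sub>C g j l) p) sums coef (conj_powser (g j) \<mu>) p"
    by (rule bounded_linear.sums[OF bounded_linear_coef conj_powser_sums[OF disk_summable_g[OF j] \<mu>]])
  moreover have "coef (cnj \<mu> ^ l *\<^sub>C g j l) p = (if l = ?l then coef (e j \<mu>) p else 0)" for l
    using j by (auto simp: coef_scaleC coef_g coef_e[OF \<mu> j] p supp_def)
  ultimately have "(\<lambda>l. if l = ?l then coef (e j \<mu>) p else 0) sums coef (conj_powser (g j) \<mu>) p"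
    by simp
  from sums_unique2[OF sums_single[of ?l "\<lambda>_. coef (e j \<mu>) p"] this]
  show "coef (e j \<mu>) p = coef (conj_powser (g j) \<mu>) p" .
qed

lemma cinner_e_sums:
  assumes "\<mu> \<in> \<D>" "j < n"
  shows "(\<lambda>l. cnj \<mu> ^ l * cinner (g j l) x) sums cinner (e j \<mu>) x"
  using bounded_linear.sums[OF bounded_linear_cinner_left conj_powser_sums[OF disk_summable_g[OF assms(2)] assms(1)]]
  by (simp add: e_eq_conj_powser[OF assms] cinner_scaleC_left)

lemma orthogonal_e: "\<mu> \<in> \<D> \<Longrightarrow> i < n \<Longrightarrow> j < n \<Longrightarrow> i \<noteq> j \<Longrightarrow> cinner (e i \<mu>) (e j \<mu>) = 0"
  by (rule cinner_disjoint_support) (auto simp: coef_e)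

text \<open>Both sides are the series of \<open>d l\<close> times the \<open>l\<close>-th power of
  the squared modulus of \<open>\<mu>\<close>; the weight does not depend on
  \<open>j\<close>.\<close>

lemma norm_e_eq:
  assumes \<mu>: "\<mu> \<in> \<D>" and j: "j < n"
  shows "cinner (e j \<mu>) (e j \<mu>) = cinner (e 0 \<mu>) (e 0 \<mu>)"
proof -
  have "(\<lambda>l. cnj \<mu> ^ l * (of_nat (d l) * \<mu> ^ l)) sums cinner (e j \<mu>) (e j \<mu>)" if j: "j < n" for j
  proof -
    have "cinner (g j l) (e j \<mu>) = of_nat (d l) * \<mu> ^ l" for l
      unfolding cinner_commute[of "g j l"] using cinner_g[OF e_in_N[OF \<mu> j] j]
      by (simp add: coef_e'[OF \<mu> j j])
    with cinner_e_sums[OF \<mu> j, of "e j \<mu>"] show ?thesis by simp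
  qed
  from sums_unique2[OF this[OF j] this[OF n_pos]] show ?thesis .
qed

text \<open>\<open>cinner (e j \<mu>) x\<close> is a power series in \<open>cnj \<mu>\<close> with
  coefficients \<open>cinner (g j l) x\<close>. Evaluated at \<open>\<mu> = cnj z\<close>, it is an
  ordinary power series in \<open>z\<close> vanishing on the disk.\<close>

lemma orth_e_imp_coef_0:
  assumes x: "x \<in> N" and j: "j < n" and orth: "\<And>\<mu>. \<mu> \<in> \<D> \<Longrightarrow> cinner x (e j \<mu>) = 0"
  shows "coef x (l, j) = 0"
proof -
  have "cinner (g j l) x = 0"
  proof (rule powser_unique_0)
    fix z :: complex assume "z \<in> \<D>"
    then have "cnj z \<in> \<D>" by simp
    moreover have "cinner (e j (cnj z)) x = 0"
      using orth[OF \<open>cnj z \<in> \<D>\<close>] cinner_zero_commute by blast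
    ultimately show "(\<lambda>l. cinner (g j l) x * z ^ l) sums 0"
      using cinner_e_sums[of "cnj z" j x] j by (simp add: mult.commute)
  qed
  then have "cinner x (g j l) = 0" using cinner_zero_commute by blast
  then show ?thesis using cinner_g[OF x j] d_pos[of l] by simp
qed

section \<open>The backward shift and its adjoint on the quotient\<close>

text \<open>On the whole Hardy space this is the adjoint of \<open>mult_z\<close>. It leaves
  \<open>N\<close> invariant, so on \<open>N\<close> it is the adjoint of \<open>S\<close> with no
  projection involved.\<close>

definition bshift :: "hardy2 \<Rightarrow> hardy2" where "bshift = pull UNIV (\<lambda>(i, k). (Suc i, k))"

lemma inj_bshift: "inj_on (\<lambda>(i, k). (Suc i, k)) A"
  by (auto simp: inj_on_def)

lemma coef_bshift: "coef (bshift x) (i, k) = coef x (Suc i, k)"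
  by (simp add: bshift_def coef_pull[OF inj_bshift])

lemma bshift_add: "bshift (x + y) = bshift x + bshift y"
  and bshift_scaleC: "bshift (c *\<^sub>C x) = c *\<^sub>C bshift x"
  by (simp_all add: bshift_def pull_add pull_scaleC inj_bshift)

lemma bshift_diff: "bshift (x - y) = bshift x - bshift y"
  by (rule coef_inject) (auto simp: coef_bshift coef_diff)

lemma norm_bshift_le: "norm (bshift x) \<le> norm x"
  unfolding bshift_def by (rule norm_pull_le[OF inj_bshift])

lemma bshift_in_N: "x \<in> N \<Longrightarrow> bshift x \<in> N"
  by (simp add: mem_quotient_N coef_bshift flip: add_Suc)

lemma cinner_mult_z: "cinner (mult_z x) y = cinner x (bshift y)"
proof -
  have inj: "inj_on (\<lambda>(i, k). (i - 1, k)) {p :: nat \<times> nat. 0 < fst p}"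
    by (auto simp: inj_on_def)
  have "mult_z x = pull {p. 0 < fst p} (\<lambda>(i, k). (i - 1, k)) x"
    by (rule coef_inject, unfold coef_mult_z coef_pull[OF inj]) (auto simp: fun_eq_iff)
  then show ?thesis
    unfolding bshift_def by (simp only:) (rule cinner_pull, auto)
qed

lemma S_outside: "x \<notin> N \<Longrightarrow> S x = 0"
  by (simp add: S_z_def compression_def)

lemma S_in_N: "S x \<in> N"
  using orth_proj(1)[OF csubspace_N complete_N] csubspace_0[OF csubspace_N]
  by (simp add: S_z_def compression_def)

lemma cinner_S: "x \<in> N \<Longrightarrow> y \<in> N \<Longrightarrow> cinner (S x) y = cinner x (bshift y)"
  using orth_proj(2)[OF csubspace_N complete_N] by (simp add: S_z_def compression_def cinner_mult_z)

lemma cinner_S_right: "x \<in> N \<Longrightarrow> y \<in> N \<Longrightarrow> cinner y (S x) = cinner (bshift y) x"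
  using cinner_S[of x y] unfolding cinner_commute[of y "S x"] cinner_commute[of "bshift y" x] by simp

lemma S_adj_eq: "S_z_adj m n y = (if y \<in> N then bshift y else 0)"
proof (cases "y \<in> N")
  case True
  then have "adj N S y = bshift y"
    by (intro adj_eqI csubspace_N bshift_in_N cinner_S)
  with True show ?thesis by (simp add: S_z_adj_def)
qed (simp add: S_z_adj_def adj_def)

lemma adj_S_eq: "adj N S y = (if y \<in> N then bshift y else 0)"
  using S_adj_eq by (simp add: S_z_adj_def)

lemma bshift_g: "j < n \<Longrightarrow> bshift (g j (Suc l)) = g j l" "j < n \<Longrightarrow> bshift (g j 0) = 0"
  by (rule N_eqI; simp add: bshift_in_N g_in_N coef_bshift coef_g' coef_zero csubspace_0[OF csubspace_N])+

text \<open>Pairing with \<open>v\<close> and moving \<open>S\<close> across as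
  \<open>bshift\<close> gives \<open>d l\<close> times a coefficient at index \<open>l + 1\<close>,
  where pairing with \<open>g j (Suc l)\<close> would produce the factor \<open>d (Suc l)\<close>.
  The quotient of the two is the weight of the shift.\<close>

lemma S_g:
  assumes j: "j < n"
  shows "S (g j l) = (of_nat (d l) / of_nat (d (Suc l))) *\<^sub>C g j (Suc l)"
proof (rule csubspace_eqI_cinner[OF csubspace_N S_in_N])
  show "(of_nat (d l) / of_nat (d (Suc l))) *\<^sub>C g j (Suc l) \<in> N"
    by (intro csubspace_scale csubspace_N g_in_N j)
  fix v assume v: "v \<in> N"
  then show "cinner v (S (g j l)) = cinner v ((of_nat (d l) / of_nat (d (Suc l))) *\<^sub>C g j (Suc l))"
    using d_pos[of "Suc l"]
    by (simp add: cinner_S_right g_in_N j cinner_scaleC_right cinner_g bshift_in_N coef_bshift)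
qed

text \<open>All weights are nonzero, so \<open>S\<close> reaches every \<open>g j l\<close> from
  \<open>g j 0\<close> up to scalars; this drives the inductions on \<open>l\<close>.\<close>

lemma g_Suc: "j < n \<Longrightarrow> g j (Suc l) = (of_nat (d (Suc l)) / of_nat (d l)) *\<^sub>C S (g j l)"
  using d_pos[of l] d_pos[of "Suc l"] by (simp add: S_g scaleC_scaleC)

section \<open>The reducing components and their minimality\<close>

text \<open>A description of \<open>H_space m n j\<close> by vanishing coefficients, on which
  invariance can be checked directly; the two agree for \<open>j < n\<close>.\<close>

definition comp :: "nat \<Rightarrow> hardy2 set" where
  "comp j = {x \<in> N. \<forall>i k. k mod n \<noteq> j \<longrightarrow> coef x (i, k) = 0}"

lemma comp_subset: "comp j \<subseteq> N" by (auto simp: comp_def)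

lemma csubspace_comp: "csubspace (comp j)"
  using csubspace_N by (intro csubspaceI)
    (auto simp: comp_def coef_zero coef_add coef_scaleC csubspace_0 csubspace_add csubspace_scale)

lemma closed_comp: "closed (comp j)"
proof -
  have "comp j = N \<inter> (\<Inter>p\<in>{p. snd p mod n \<noteq> j}. {x. coef x p = 0})"
    by (auto simp: comp_def)
  moreover have "closed {x. coef x p = 0}" for p
    by (intro closed_Collect_eq continuous_intros linear_continuous_on bounded_linear_coef)
  ultimately show ?thesis using closed_N by (auto intro!: closed_Int closed_INT)
qed

lemma comp_eqI:
  assumes "j < n" "x \<in> comp j" "y \<in> comp j" "\<And>l. coef x (l, j) = coef y (l, j)"
  shows "x = y"
proof (rule N_eqI)
  show "coef x (l, j') = coef y (l, j')" if "j' < n" for l j'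
    using assms that by (cases "j' = j") (auto simp: comp_def)
qed (use assms comp_subset in auto)

lemma g_in_comp: "j < n \<Longrightarrow> g j l \<in> comp j"
  by (auto simp: comp_def g_in_N coef_g supp_def)

lemma e_in_comp: "\<mu> \<in> \<D> \<Longrightarrow> j < n \<Longrightarrow> e j \<mu> \<in> comp j"
  by (auto simp: comp_def e_in_N coef_e)

lemma comp_orthogonal: "i \<noteq> j \<Longrightarrow> x \<in> comp i \<Longrightarrow> y \<in> comp j \<Longrightarrow> cinner x y = 0"
proof (rule cinner_disjoint_support)
  fix p assume "i \<noteq> j" "x \<in> comp i" "y \<in> comp j"
  then show "coef x p = 0 \<or> coef y p = 0"
    by (cases p, cases "snd p mod n = i") (auto simp: comp_def)
qed

text \<open>A vector of \<open>N\<close> orthogonal to all \<open>e j \<mu>\<close> has no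
  coefficients in class \<open>j\<close>, by uniqueness of power series; in \<open>comp j\<close>
  there are no others.\<close>

lemma H_space_eq: "j < n \<Longrightarrow> H_space m n j = comp j"
proof -
  assume j: "j < n"
  show ?thesis
    unfolding H_space_def
  proof (rule closed_subspace_eqI[OF csubspace_closed_cspan])
    show "complete (closed_cspan (e j ` \<D>))"
      by (simp add: complete_eq_closed closed_closed_cspan)
    show "closed_cspan (e j ` \<D>) \<subseteq> comp j"
      using e_in_comp[OF _ j] by (intro closed_cspan_minimal csubspace_comp closed_comp) blast
    fix x assume x: "x \<in> comp j" and orth: "\<And>v. v \<in> closed_cspan (e j ` \<D>) \<Longrightarrow> cinner x v = 0"
    have "x \<in> N" using x comp_subset by blast
    moreover have "cinner x (e j \<mu>) = 0" if "\<mu> \<in> \<D>" for \<mu>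
      using that by (intro orth closed_cspan_superset[THEN subsetD] imageI)
    ultimately have "coef x (l, j) = 0" for l
      by (rule orth_e_imp_coef_0[OF _ j])
    then show "x = 0"
      by (intro comp_eqI[OF j x csubspace_0[OF csubspace_comp]]) (simp add: coef_zero)
  qed (rule csubspace_comp)
qed

lemma closed_subspace_eq_comp:
  assumes "csubspace M" "closed M" "M \<subseteq> comp j" "j < n" "\<And>l. g j l \<in> M"
  shows "M = comp j"
proof (rule closed_subspace_eqI[OF assms(1) _ assms(3) csubspace_comp])
  show "complete M" using assms(2) by (simp add: complete_eq_closed)
  fix x assume x: "x \<in> comp j" and orth: "\<And>v. v \<in> M \<Longrightarrow> cinner x v = 0"
  have xN: "x \<in> N" using x comp_subset by blast
  have "coef x (l, j) = 0" for l
    using orth[OF assms(5), of l] cinner_g[OF xN assms(4), of l] d_pos[of l] by simp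
  then show "x = 0"
    by (intro comp_eqI[OF assms(4) x csubspace_0[OF csubspace_comp]]) (simp add: coef_zero)
qed

lemma closed_subspace_eq_N:
  assumes "csubspace M" "closed M" "M \<subseteq> N" "\<And>j l. j < n \<Longrightarrow> g j l \<in> M"
  shows "M = N"
proof (rule closed_subspace_eqI[OF assms(1) _ assms(3) csubspace_N])
  show "complete M" using assms(2) by (simp add: complete_eq_closed)
  fix x assume x: "x \<in> N" and orth: "\<And>v. v \<in> M \<Longrightarrow> cinner x v = 0"
  have "coef x (l, j) = 0" if "j < n" for j l
    using orth[OF assms(4)[OF that], of l] cinner_g[OF x that, of l] d_pos[of l] by simp
  then show "x = 0"
    by (intro N_eqI[OF x csubspace_0[OF csubspace_N]]) (simp add: coef_zero)
qed

lemma bshift_in_comp: "x \<in> comp j \<Longrightarrow> bshift x \<in> comp j"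
  by (simp add: comp_def bshift_in_N coef_bshift)

text \<open>Coefficients of \<open>S x\<close> in another class \<open>j'\<close> are read off by
  pairing with \<open>g j' l\<close>; moved across, this pairs \<open>x\<close> with a vector of
  \<open>comp j'\<close>.\<close>

lemma S_in_comp:
  assumes j: "j < n" and x: "x \<in> comp j"
  shows "S x \<in> comp j"
proof -
  have xN: "x \<in> N" using x comp_subset by blast
  have "coef (S x) (l, j') = 0" if j': "j' < n" "j' \<noteq> j" for l j'
  proof -
    have "of_nat (d l) * coef (S x) (l, j') = cinner x (bshift (g j' l))"
      unfolding cinner_g[OF S_in_N j'(1), symmetric] by (rule cinner_S[OF xN g_in_N[OF j'(1)]])
    also have "\<dots> = 0"
      using comp_orthogonal[OF _ x bshift_in_comp[OF g_in_comp[OF j'(1)]]] j'(2) by simp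
    finally show ?thesis using d_pos[of l] by simp
  qed
  then have "coef (S x) (i, k) = 0" if "k mod n \<noteq> j" for i k
    using that n_pos by (subst coef_N[OF S_in_N]) simp
  then show ?thesis by (simp add: comp_def S_in_N)
qed

lemma reducing_comp: "j < n \<Longrightarrow> reducing_subspace N S (comp j)"
  unfolding reducing_subspace_def adj_S_eq
  using comp_subset csubspace_comp closed_comp S_in_comp bshift_in_comp by auto

text \<open>The kernel of the adjoint on \<open>comp j\<close> is spanned by \<open>g j 0\<close>. Both components of
  \<open>g j 0\<close> along \<open>M\<close> and its complement lie in that kernel, so \<open>g j 0\<close> belongs to \<open>M\<close> or is
  orthogonal to it.\<close>

lemma minimal_comp:
  assumes j: "j < n"
  shows "minimal_reducing_subspace N S (comp j)"
  unfolding minimal_reducing_subspace_def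
proof (intro conjI allI impI reducing_comp[OF j]; elim conjE)
  fix M assume red: "reducing_subspace N S M" and sub: "M \<subseteq> comp j"
  have M: "csubspace M" "closed M" "M \<subseteq> N" and S_M: "\<And>x. x \<in> M \<Longrightarrow> S x \<in> M"
    and adj_M: "\<And>x. x \<in> M \<Longrightarrow> adj N S x \<in> M"
    using red unfolding reducing_subspace_def by auto
  have bshift_M: "bshift x \<in> M" if "x \<in> M" for x
    using adj_M[OF that] M(3) that by (auto simp: adj_S_eq)
  define w where "w = g j 0"
  have w: "w \<in> comp j" "w \<in> N" "bshift w = 0"
    using g_in_comp[OF j] g_in_N[OF j] bshift_g(2)[OF j] by (simp_all add: w_def)
  obtain y where y: "y \<in> M" "\<And>v. v \<in> M \<Longrightarrow> cinner (w - y) v = 0"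
    using orthogonal_projection[OF M(1)] M(2) by (metis complete_eq_closed)
  have yN: "y \<in> N" "w - y \<in> N" using y M w csubspace_diff[OF csubspace_N] by auto
  \<comment> \<open>As \<open>bshift w = 0\<close>, one factor may be replaced by
    \<open>- bshift (w - y)\<close>. Moving the shift across puts \<open>S (bshift y)\<close>, a
    member of \<open>M\<close>, against \<open>w - y\<close>, which is orthogonal to
    \<open>M\<close>.\<close>
  have "cinner (bshift y) (bshift y) = - cinner (bshift (w - y)) (bshift y)"
    by (simp add: bshift_diff w cinner_minus_left)
  also have "\<dots> = - cinner (w - y) (S (bshift y))"
    using cinner_S_right[OF bshift_in_N[OF yN(1)] yN(2)] by simp
  also have "\<dots> = 0" by (simp add: y S_M bshift_M)
  finally have "bshift y = 0" by simp
  then have y_Suc: "coef y (Suc l, j) = 0" for l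
    using coef_bshift[of y l j] by (simp add: coef_zero)
  define a where "a = coef y (0, j)"
  have y_eq: "y = a *\<^sub>C w"
  proof (rule comp_eqI[OF j])
    show "coef y (l, j) = coef (a *\<^sub>C w) (l, j)" for l
      using y_Suc by (cases l) (simp_all add: a_def coef_scaleC w_def coef_g' j)
  qed (use y sub w csubspace_scale[OF csubspace_comp] in auto)
  \<comment> \<open>\<open>d 0 = 1\<close> makes \<open>w\<close> a unit vector. With
    \<open>y = a *\<^sub>C w\<close>, the orthogonality of \<open>w - y\<close> to \<open>y\<close>
    then leaves only the values \<open>1\<close> and \<open>0\<close> for \<open>a\<close>.\<close>
  have "cinner w w = 1"
    using cinner_g[OF w(2) j, of 0] d_pos[of 0] d_le[of 0] by (simp add: w_def coef_g' j)
  then have "(1 - a) * cnj a = 0"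
    using y(2)[OF y(1)] by (simp add: y_eq cinner_diff_left cinner_scaleC_left cinner_scaleC_right algebra_simps)
  then consider "a = 1" | "a = 0" by auto
  then show "M = comp j \<or> M = {0}"
  proof cases
    case 1
    have "g j l \<in> M" for l
    proof (induction l)
      case 0
      show ?case using y(1) y_eq 1 by (simp add: w_def)
    next
      case (Suc l)
      then show ?case by (simp add: g_Suc[OF j] csubspace_scale M(1) S_M)
    qed
    then show ?thesis using closed_subspace_eq_comp[OF M(1,2) sub j] by blast
  next
    case 2
    \<comment> \<open>\<open>bshift\<close> lowers the index by one without leaving
      \<open>M\<close>, so vanishing at index \<open>0\<close> propagates to all indices.\<close>
    have "coef x (l, j) = 0" if "x \<in> M" for x l
      using that
    proof (induction l arbitrary: x)
      case 0
      have "cinner w x = 0"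
        using y(2)[OF 0] y_eq 2 by simp
      then have "cinner x w = 0" by (subst cinner_zero_commute)
      then show ?case
        using cinner_g[of x j 0] M(3) 0 j d_pos[of 0] by (auto simp: w_def)
    next
      case (Suc l)
      from Suc.IH[OF bshift_M[OF Suc.prems]] show ?case by (simp add: coef_bshift)
    qed
    then have "x = 0" if "x \<in> M" for x
      using that sub by (intro comp_eqI[OF j _ csubspace_0[OF csubspace_comp]]) (auto simp: coef_zero)
    then show ?thesis using csubspace_0[OF M(1)] by auto
  qed
qed

lemma N_eq_sum_comp: "N = {\<Sum>j<n. x j | x. \<forall>j<n. x j \<in> comp j}"
proof
  show "{\<Sum>j<n. x j | x. \<forall>j<n. x j \<in> comp j} \<subseteq> N"
    using comp_subset by (auto intro!: csubspace_sum[OF csubspace_N])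
  show "N \<subseteq> {\<Sum>j<n. x j | x. \<forall>j<n. x j \<in> comp j}"
  proof
    fix x assume x: "x \<in> N"
    \<comment> \<open>Coefficients are cut down to one residue class of exponents of
      \<open>w\<close>; the relation defining \<open>N\<close> moves this exponent by
      \<open>n\<close> and so respects the class.\<close>
    define y where "y j = pull {p. snd p mod n = j} id x" for j
    have y: "coef (y j) (i, k) = (if k mod n = j then coef x (i, k) else 0)" for j i k
      by (simp add: y_def coef_pull)
    have "y j \<in> comp j" for j
      using x by (simp add: comp_def mem_quotient_N y)
    moreover have "x = (\<Sum>j<n. y j)"
      using n_pos by (intro coef_inject ext) (auto simp: coef_sum y sum.delta)
    ultimately show "x \<in> {\<Sum>j<n. x j | x. \<forall>j<n. x j \<in> comp j}" by blast
  qed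
qed

section \<open>Eigenvectors and the antiholomorphic frame\<close>

text \<open>The eigenvalue equation is a one-term recurrence in \<open>l\<close>, so the
  \<open>n\<close> values \<open>coef x (0, j)\<close> determine \<open>x\<close> and are its
  coordinates in the \<open>e j \<mu>\<close>.\<close>

lemma eigenspace_eq:
  assumes \<mu>: "\<mu> \<in> \<D>"
  shows "eigenspace N (S_z_adj m n) (cnj \<mu>) = cspan ((\<lambda>j. e j \<mu>) ` {..<n})"
proof
  let ?E = "eigenspace N (S_z_adj m n) (cnj \<mu>)"
  have E: "x \<in> ?E \<longleftrightarrow> x \<in> N \<and> bshift x = cnj \<mu> *\<^sub>C x" for x
    by (auto simp: eigenspace_def S_adj_eq)
  have e_E: "e j \<mu> \<in> ?E" if j: "j < n" for j
    unfolding E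
    by (intro conjI e_in_N N_eqI bshift_in_N csubspace_scale[OF csubspace_N] \<mu> j)
      (simp add: coef_bshift coef_scaleC coef_e'[OF \<mu> j])
  have "csubspace ?E"
    by (rule csubspaceI)
      (auto simp: E csubspace_0 csubspace_add csubspace_scale csubspace_N bshift_add bshift_scaleC
        scaleC_add_right scaleC_scaleC mult.commute intro!: coef_inject simp: coef_zero coef_bshift)
  then show "cspan ((\<lambda>j. e j \<mu>) ` {..<n}) \<subseteq> ?E"
    using e_E by (intro complex_vec.span_minimal) auto
  show "?E \<subseteq> cspan ((\<lambda>j. e j \<mu>) ` {..<n})"
  proof
    fix x assume "x \<in> ?E"
    then have x: "x \<in> N" and shift: "bshift x = cnj \<mu> *\<^sub>C x" by (simp_all add: E)
    have coef_x: "coef x (l, j) = cnj \<mu> ^ l * coef x (0, j)" for l j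
    proof (induction l)
      case (Suc l)
      have "coef x (Suc l, j) = cnj \<mu> * coef x (l, j)"
        unfolding coef_bshift[symmetric] shift coef_scaleC ..
      then show ?case using Suc by simp
    qed simp
    have "x = (\<Sum>j<n. coef x (0, j) *\<^sub>C e j \<mu>)"
    proof (rule N_eqI[OF x])
      show "(\<Sum>j<n. coef x (0, j) *\<^sub>C e j \<mu>) \<in> N"
        by (intro csubspace_sum csubspace_scale csubspace_N e_in_N \<mu>) simp
      fix l j assume j: "j < n"
      have "coef (\<Sum>j<n. coef x (0, j) *\<^sub>C e j \<mu>) (l, j) = (\<Sum>i<n. if i = j then coef x (0, j) * cnj \<mu> ^ l else 0)"
        unfolding coef_sum using j by (intro sum.cong) (auto simp: coef_scaleC coef_e'[OF \<mu>])
      also have "\<dots> = coef x (l, j)" using j coef_x[of l j] by (simp add: mult.commute)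
      finally show "coef x (l, j) = coef (\<Sum>j<n. coef x (0, j) *\<^sub>C e j \<mu>) (l, j)" ..
    qed
    also have "\<dots> \<in> cspan ((\<lambda>j. e j \<mu>) ` {..<n})"
      by (intro complex_vec.span_sum complex_vec.span_scale complex_vec.span_base) auto
    finally show "x \<in> cspan ((\<lambda>j. e j \<mu>) ` {..<n})" .
  qed
qed

lemma e_nonzero: "\<mu> \<in> \<D> \<Longrightarrow> j < n \<Longrightarrow> e j \<mu> \<noteq> 0"
  using coef_e'[of \<mu> j j 0] by (auto simp: coef_zero)

lemma basis_e: "\<mu> \<in> \<D> \<Longrightarrow> basis_family n (\<lambda>j. e j \<mu>) (bundle_S_z_adj m n \<mu>)"
  unfolding basis_family_def bundle_S_z_adj_def eigenspace_eq
  using orthogonal_independent[of n "\<lambda>j. e j \<mu>"] orthogonal_e e_nonzero by simp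

lemma smooth_e: "j < n \<Longrightarrow> smooth_on \<D> (e j)"
  by (rule smooth_on_cong[OF open_ball _ conj_powser_smooth[OF disk_summable_g]])
    (simp_all add: e_eq_conj_powser)

lemma antiholomorphic_e: "j < n \<Longrightarrow> antiholomorphic_on \<D> (e j)"
proof -
  assume j: "j < n"
  show ?thesis
    unfolding antiholomorphic_on_def
  proof (intro ballI exI)
    fix \<mu> :: complex assume \<mu>: "\<mu> \<in> \<D>"
    show "(e j has_derivative (\<lambda>h. cnj h *\<^sub>C conj_powser (\<lambda>l. of_nat (Suc l) *\<^sub>C g j (Suc l)) \<mu>)) (at \<mu>)"
      by (rule has_derivative_transform_within_open[OF conj_powser_has_derivative[OF disk_summable_g[OF j] \<mu>] open_ball \<mu>])
        (simp add: e_eq_conj_powser j)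
  qed
qed

lemma frame_e: "antiholomorphic_frame n \<D> (bundle_S_z_adj m n) e"
  unfolding antiholomorphic_frame_def antiholomorphic_section_def
  using antiholomorphic_e basis_e
  by (auto simp: bundle_S_z_adj_def eigenspace_eq intro!: complex_vec.span_base)

lemma block_diagonalization_N: "block_diagonalization \<D> (bundle_S_z_adj m n) [1] [n]"
proof -
  interpret conformal_frame n \<D> "bundle_S_z_adj m n" e
  proof
    show "orthogonal_family n \<D> e"
      unfolding orthogonal_family_def using orthogonal_e by blast
  qed (fact n_pos open_ball frame_e smooth_e norm_e_eq)+
  show ?thesis by (rule block_diagonalization)
qed


section \<open>The Cowen-Douglas property\<close>

text \<open>Each row of fixed \<open>k\<close> satisfies the recurrence driven by the coefficients
  of \<open>f\<close> in that row. Summing the row estimates leaves the column of initial values,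
  whose entries are distinct members of the \<open>n\<close> sequences \<open>X j\<close>, and these
  obey the same estimate.\<close>

lemma bshift_surj:
  assumes w: "w \<in> \<D>" and f: "f \<in> N"
  shows "\<exists>x\<in>N. bshift x - w *\<^sub>C x = f"
proof -
  \<comment> \<open>The initial value \<open>0\<close> is a free choice: solutions differ by
    eigenvectors.\<close>
  define X where "X j = rec_nat 0 (\<lambda>l c. w * c + coef f (l, j))" for j
  have X: "X j 0 = 0" "X j (Suc l) = w * X j l + coef f (l, j)" for j l
    by (simp_all add: X_def)
  \<comment> \<open>Spreading \<open>X\<close> along the relation that defines \<open>N\<close>
    makes membership in \<open>N\<close> automatic.\<close>
  define a where "a = (\<lambda>(i, k). X (k mod n) (i + m * (k div n)))"
  have a_Suc: "a (Suc i, k) = w * a (i, k) + coef f (i, k)" for i k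
    using coef_N[OF f, of i k] by (simp add: a_def X)
  let ?r = "cmod w" and ?F = "(norm f)\<^sup>2"
  have r: "?r < 1" "0 < 1 - ?r" using w by simp_all
  have f_row: "(\<Sum>i<L. (cmod (coef f (i, k)))\<^sup>2) \<le> ?F" for k L
    using sum_coef_le_norm[of "(\<lambda>i. (i, k)) ` {..<L}" f] by (simp add: sum.reindex inj_on_def)
  have f_box: "(\<Sum>k<K. \<Sum>i<L. (cmod (coef f (i, k)))\<^sup>2) \<le> ?F" for K L
  proof -
    have "(\<Sum>k<K. \<Sum>i<L. (cmod (coef f (i, k)))\<^sup>2) = (\<Sum>(i, k)\<in>{..<L} \<times> {..<K}. (cmod (coef f (i, k)))\<^sup>2)"
      by (subst sum.swap) (simp add: sum.cartesian_product)
    also have "\<dots> = (\<Sum>p\<in>{..<L} \<times> {..<K}. (cmod (coef f p))\<^sup>2)"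
      by (simp add: case_prod_unfold)
    also have "\<dots> \<le> ?F" by (intro sum_coef_le_norm) simp
    finally show ?thesis .
  qed
  define C where "C = ?F / (1 - ?r) / (1 - ?r)"
  have "0 \<le> C" using r by (simp add: C_def)
  have X_sum: "(\<Sum>l<L. (cmod (X j l))\<^sup>2) \<le> C" for j L
  proof -
    have "(1 - ?r) * (\<Sum>l<L. (cmod (X j l))\<^sup>2)
        \<le> (cmod (X j 0))\<^sup>2 + (\<Sum>l<L. (cmod (coef f (l, j)))\<^sup>2) / (1 - ?r)"
      by (rule recurrence_square_sum[where y = "X j" and b = "\<lambda>l. coef f (l, j)", OF X(2) r(1)])
    also have "\<dots> \<le> ?F / (1 - ?r)"
      using f_row[of j L] r by (simp add: X divide_right_mono)
    finally show ?thesis using r by (simp add: C_def pos_le_divide_eq mult.commute)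
  qed
  \<comment> \<open>Different \<open>k\<close> select different entries \<open>X j l\<close>, as
    \<open>m\<close> is positive. The column is thus a subfamily of \<open>n\<close> sequences with
    square sums at most \<open>C\<close>, and no weight appears.\<close>
  have col: "(\<Sum>k<K. (cmod (a (0, k)))\<^sup>2) \<le> real n * C" for K
  proof -
    let ?\<pi> = "\<lambda>k. (k mod n, m * (k div n))"
    have inj: "inj_on ?\<pi> {..<K}"
      using m_pos by (auto simp: inj_on_def) (metis mod_mult_div_eq)
    have "(\<Sum>k<K. (cmod (a (0, k)))\<^sup>2) = (\<Sum>p\<in>?\<pi> ` {..<K}. (cmod (X (fst p) (snd p)))\<^sup>2)"
      by (subst sum.reindex[OF inj]) (simp add: a_def)
    also have "\<dots> \<le> (\<Sum>p\<in>{..<n} \<times> {..<m * K}. (cmod (X (fst p) (snd p)))\<^sup>2)"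
    proof (rule sum_mono2)
      have "m * (k div n) < m * K" if "k < K" for k
        using le_less_trans[OF div_le_dividend that] m_pos by simp
      then show "?\<pi> ` {..<K} \<subseteq> {..<n} \<times> {..<m * K}" using n_pos by auto
    qed auto
    also have "\<dots> = (\<Sum>j<n. \<Sum>l<m * K. (cmod (X j l))\<^sup>2)"
      by (simp add: sum.cartesian_product case_prod_unfold)
    also have "\<dots> \<le> (\<Sum>j<n. C)" by (intro sum_mono X_sum)
    finally show ?thesis by simp
  qed
  have "square_summable a"
  proof (rule square_summableI)
    fix A :: "(nat \<times> nat) set" assume A: "finite A"
    obtain L where L: "fst ` A \<subseteq> {..<L}" using finite_nat_iff_bounded A by blast
    obtain K where K: "snd ` A \<subseteq> {..<K}" using finite_nat_iff_bounded A by blast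
    have "(1 - ?r) * (\<Sum>p\<in>A. (cmod (a p))\<^sup>2) \<le> (1 - ?r) * (\<Sum>p\<in>{..<L} \<times> {..<K}. (cmod (a p))\<^sup>2)"
      using L K r by (intro mult_left_mono sum_mono2) force+
    also have "(\<Sum>p\<in>{..<L} \<times> {..<K}. (cmod (a p))\<^sup>2) = (\<Sum>k<K. \<Sum>i<L. (cmod (a (i, k)))\<^sup>2)"
      by (subst sum.swap) (simp add: sum.cartesian_product case_prod_unfold)
    also have "(1 - ?r) * \<dots> = (\<Sum>k<K. (1 - ?r) * (\<Sum>i<L. (cmod (a (i, k)))\<^sup>2))"
      by (rule sum_distrib_left)
    also have "\<dots> \<le> (\<Sum>k<K. (cmod (a (0, k)))\<^sup>2 + (\<Sum>i<L. (cmod (coef f (i, k)))\<^sup>2) / (1 - ?r))"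
      by (intro sum_mono recurrence_square_sum[where y = "\<lambda>i. a (i, k)" for k] a_Suc r)
    also have "\<dots> = (\<Sum>k<K. (cmod (a (0, k)))\<^sup>2) + (\<Sum>k<K. \<Sum>i<L. (cmod (coef f (i, k)))\<^sup>2) / (1 - ?r)"
      by (simp add: sum.distrib sum_divide_distrib)
    also have "\<dots> \<le> real n * C + ?F / (1 - ?r)"
      using r by (intro add_mono col divide_right_mono f_box) simp
    finally show "(\<Sum>p\<in>A. (cmod (a p))\<^sup>2) \<le> (real n * C + ?F / (1 - ?r)) / (1 - ?r)"
      using r by (simp add: pos_le_divide_eq mult.commute)
  qed
  then have x: "coef (h2_coef a) = a" by (rule coef_h2_coef)
  have "h2_coef a \<in> N"
    unfolding mem_quotient_N x using n_pos by (simp add: a_def algebra_simps)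
  moreover have "bshift (h2_coef a) - w *\<^sub>C h2_coef a = f"
    by (rule coef_inject) (auto simp: coef_diff coef_scaleC coef_bshift x a_Suc)
  ultimately show ?thesis by blast
qed

lemma S_adj_bounded: "S_z_adj m n \<in> bounded_ops N"
  unfolding bounded_ops_def S_adj_eq using csubspace_N
  by (auto simp: bshift_in_N bshift_add bshift_scaleC csubspace_add csubspace_scale
      intro!: exI[of _ 1] norm_bshift_le)

lemma cowen_douglas_N: "cowen_douglas n \<D> N (S_z_adj m n)"
  unfolding cowen_douglas_def hilbert_subspace_def
proof (intro conjI ballI n_pos csubspace_N complete_N S_adj_bounded)
  show "open \<D>" "connected \<D>" by simp_all
  let ?B = "\<Union>j<n. range (g j)"
  have "closed_cspan ?B = N"
  proof (rule closed_subspace_eq_N[OF csubspace_closed_cspan closed_closed_cspan])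
    show "closed_cspan ?B \<subseteq> N"
      using g_in_N by (intro closed_cspan_minimal csubspace_N closed_N) auto
    show "g j l \<in> closed_cspan ?B" if "j < n" for j l
      using that by (intro closed_cspan_superset[THEN subsetD]) auto
  qed
  then show "separable_space (top_of_set N)"
    using separable_closed_cspan[of ?B] by simp
next
  fix w assume w: "w \<in> \<D>"
  show "(\<lambda>x. S_z_adj m n x - w *\<^sub>C x) ` N = N"
  proof
    show "(\<lambda>x. S_z_adj m n x - w *\<^sub>C x) ` N \<subseteq> N"
      using csubspace_N by (auto simp: S_adj_eq bshift_in_N csubspace_diff csubspace_scale)
    show "N \<subseteq> (\<lambda>x. S_z_adj m n x - w *\<^sub>C x) ` N"
    proof
      fix f assume "f \<in> N"
      then obtain x where "x \<in> N" "bshift x - w *\<^sub>C x = f" using bshift_surj[OF w] by blast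
      then show "f \<in> (\<lambda>x. S_z_adj m n x - w *\<^sub>C x) ` N"
        by (intro image_eqI[of _ _ x]) (simp_all add: S_adj_eq)
    qed
  qed
  \<comment> \<open>The fibre over \<open>\<mu>\<close> belongs to the eigenvalue
    \<open>cnj \<mu>\<close>, so the eigenspace at \<open>w\<close> is the fibre over
    \<open>cnj w\<close>.\<close>
  have w': "cnj w \<in> \<D>" using w by simp
  show "cdim (eigenspace N (S_z_adj m n) w) = n"
    using basis_e[OF w'] unfolding bundle_S_z_adj_def basis_family_def complex_cnj_cnj
    by (metis (no_types) card_image card_lessThan complex_vec.dim_span complex_vec.dim_eq_card_independent)
next
  let ?M = "closed_cspan (\<Union>w\<in>\<D>. eigenspace N (S_z_adj m n) w)"
  show "?M = N"
  proof (rule closed_subspace_eqI[OF csubspace_closed_cspan _ _ csubspace_N])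
    show "complete ?M" by (simp add: complete_eq_closed closed_closed_cspan)
    show "?M \<subseteq> N"
      by (intro closed_cspan_minimal csubspace_N closed_N) (auto simp: eigenspace_def)
    fix x assume x: "x \<in> N" and orth: "\<And>v. v \<in> ?M \<Longrightarrow> cinner x v = 0"
    have "cinner x (e j \<mu>) = 0" if \<mu>: "\<mu> \<in> \<D>" and j: "j < n" for j \<mu>
    proof (intro orth closed_cspan_superset[THEN subsetD] UN_I)
      show "cnj \<mu> \<in> \<D>" using \<mu> by simp
      show "e j \<mu> \<in> eigenspace N (S_z_adj m n) (cnj \<mu>)"
        unfolding eigenspace_eq[OF \<mu>] using j by (intro complex_vec.span_base) simp
    qed
    then have "coef x (l, j) = 0" if "j < n" for l j
      using that by (intro orth_e_imp_coef_0[OF x])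
    then show "x = 0"
      by (intro N_eqI[OF x csubspace_0[OF csubspace_N]]) (simp add: coef_zero)
  qed
qed

section \<open>The commutant\<close>

text \<open>A matrix unit: the coefficients of residue class \<open>b\<close> are carried to class
  \<open>a\<close>, with \<open>i\<close> and the quotient by \<open>n\<close> kept, and all other
  classes receive zero.\<close>

definition U :: "nat \<Rightarrow> nat \<Rightarrow> hardy2 \<Rightarrow> hardy2" where
  "U a b = pull {p. snd p mod n = a} (\<lambda>(i, k). (i, b + n * (k div n)))"

text \<open>The matrix mixes the \<open>n\<close> classes with the position \<open>l\<close> fixed;
  this is the action on the multiplicity space.\<close>

definition Phi :: "complex mat \<Rightarrow> hardy2 \<Rightarrow> hardy2" where
  "Phi A x = (if x \<in> N then \<Sum>a<n. \<Sum>b<n. A $$ (a, b) *\<^sub>C U a b x else 0)"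

lemma inj_U: "inj_on (\<lambda>(i, k). (i, b + n * (k div n))) {p. snd p mod n = a}"
  using n_pos by (auto simp: inj_on_def) (metis mod_mult_div_eq)

lemma cinner_U: "a < n \<Longrightarrow> b < n \<Longrightarrow> cinner (U a b x) y = cinner x (U b a y)"
  unfolding U_def by (rule cinner_pull) (auto simp: mod_mult_div_eq)

lemma coef_Phi:
  assumes "x \<in> N"
  shows "coef (Phi A x) (i, k) = (\<Sum>b<n. A $$ (k mod n, b) * coef x (i, b + n * (k div n)))"
proof -
  have "(\<Sum>b<n. coef (A $$ (a, b) *\<^sub>C U a b x) (i, k))
      = (if a = k mod n then \<Sum>b<n. A $$ (k mod n, b) * coef x (i, b + n * (k div n)) else 0)" for a
    by (simp add: coef_scaleC U_def coef_pull[OF inj_U])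
  then have "coef (Phi A x) (i, k)
      = (\<Sum>a<n. if a = k mod n then \<Sum>b<n. A $$ (k mod n, b) * coef x (i, b + n * (k div n)) else 0)"
    using assms by (simp add: Phi_def coef_sum)
  then show ?thesis using n_pos by simp
qed

lemma coef_Phi': "x \<in> N \<Longrightarrow> j < n \<Longrightarrow> coef (Phi A x) (l, j) = (\<Sum>b<n. A $$ (j, b) * coef x (l, b))"
  by (simp add: coef_Phi)

lemma Phi_in_N: "Phi A x \<in> N"
proof (cases "x \<in> N")
  case True
  then show ?thesis
    using n_pos unfolding mem_quotient_N
    by (simp add: coef_Phi mem_quotient_N flip: mem_quotient_N) (simp add: mem_quotient_N algebra_simps)
qed (simp add: Phi_def csubspace_0 csubspace_N)

lemma Phi_outside: "x \<notin> N \<Longrightarrow> Phi A x = 0"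
  by (simp add: Phi_def)

lemma Phi_zero: "Phi A 0 = 0"
  by (rule N_eqI) (simp_all add: Phi_in_N csubspace_0 csubspace_N coef_Phi' coef_zero)

lemma Phi_bounded_ops: "Phi A \<in> bounded_ops N"
  unfolding bounded_ops_def
proof (intro CollectI conjI ballI allI impI)
  show "Phi A (x + y) = Phi A x + Phi A y" if "x \<in> N" "y \<in> N" for x y
    using that csubspace_N
    by (intro N_eqI)
      (simp_all add: Phi_in_N csubspace_add coef_Phi' coef_add distrib_left sum.distrib)
  show "Phi A (c *\<^sub>C x) = c *\<^sub>C Phi A x" if "x \<in> N" for c x
    using that csubspace_N
    by (intro N_eqI) (simp_all add: Phi_in_N csubspace_scale coef_Phi' coef_scaleC sum_distrib_left mult_ac)
  have "norm (Phi A x) \<le> (\<Sum>a<n. \<Sum>b<n. cmod (A $$ (a, b))) * norm x" if "x \<in> N" for x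
    unfolding sum_distrib_right Phi_def if_P[OF that]
  proof (intro sum_norm_le)
    show "norm (A $$ (a, b) *\<^sub>C U a b x) \<le> cmod (A $$ (a, b)) * norm x" for a b
      unfolding norm_scaleC U_def by (intro mult_left_mono norm_pull_le[OF inj_U]) simp
  qed
  then show "\<exists>K. \<forall>x\<in>N. norm (Phi A x) \<le> K * norm x" by blast
qed (simp_all add: Phi_in_N Phi_outside)

text \<open>Taking adjoints exchanges \<open>U a b\<close> with \<open>U b a\<close> and conjugates
  its coefficient, which is the effect of \<open>mat_adjoint\<close> on the entries.\<close>

lemma cinner_Phi:
  assumes A: "A \<in> carrier_mat n n" and x: "x \<in> N" and y: "y \<in> N"
  shows "cinner (Phi A x) y = cinner x (Phi (mat_adjoint A) y)"
proof -
  have adj: "mat_adjoint A $$ (b, a) = cnj (A $$ (a, b))" if "a < n" "b < n" for a b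
    using A that by (simp add: mat_adjoint_def mat_of_rows_def)
  have "cinner (Phi A x) y = (\<Sum>a<n. \<Sum>b<n. A $$ (a, b) * cinner x (U b a y))"
    using x by (simp add: Phi_def cinner_sum_left cinner_scaleC_left cinner_U)
  also have "\<dots> = (\<Sum>b<n. \<Sum>a<n. A $$ (a, b) * cinner x (U b a y))" by (rule sum.swap)
  also have "\<dots> = cinner x (Phi (mat_adjoint A) y)"
    using y by (simp add: Phi_def cinner_sum_right cinner_scaleC_right adj)
  finally show ?thesis .
qed

lemma Phi_adj: "A \<in> carrier_mat n n \<Longrightarrow> Phi (mat_adjoint A) = adj N (Phi A)"
proof
  fix y assume A: "A \<in> carrier_mat n n"
  show "Phi (mat_adjoint A) y = adj N (Phi A) y"
  proof (cases "y \<in> N")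
    case True
    then have "adj N (Phi A) y = Phi (mat_adjoint A) y"
      by (intro adj_eqI csubspace_N Phi_in_N cinner_Phi A)
    then show ?thesis ..
  qed (simp add: adj_def Phi_outside)
qed

lemma bshift_Phi: "x \<in> N \<Longrightarrow> bshift (Phi A x) = Phi A (bshift x)"
  by (rule N_eqI) (simp_all add: bshift_in_N Phi_in_N coef_bshift coef_Phi')

text \<open>\<open>Phi\<close> commutes with the coefficient shift \<open>bshift\<close> by
  inspection. The adjoint matrix gives an operator of the same family, so passing to adjoints yields
  commutation with \<open>S\<close>.\<close>

lemma S_Phi:
  assumes A: "A \<in> carrier_mat n n" and x: "x \<in> N"
  shows "S (Phi A x) = Phi A (S x)"
proof (rule csubspace_eqI_cinner[OF csubspace_N S_in_N Phi_in_N])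
  fix v assume v: "v \<in> N"
  have "cinner (S (Phi A x)) v = cinner (Phi A x) (bshift v)"
    by (rule cinner_S[OF Phi_in_N v])
  also have "\<dots> = cinner x (bshift (Phi (mat_adjoint A) v))"
    unfolding bshift_Phi[OF v] by (rule cinner_Phi[OF A x bshift_in_N[OF v]])
  also have "\<dots> = cinner (S x) (Phi (mat_adjoint A) v)"
    by (rule cinner_S[OF x Phi_in_N, symmetric])
  also have "\<dots> = cinner (Phi A (S x)) v"
    by (rule cinner_Phi[OF A S_in_N v, symmetric])
  finally show "cinner v (S (Phi A x)) = cinner v (Phi A (S x))"
    unfolding cinner_commute[of v] by simp
qed

lemma S_zero: "S 0 = 0"
  by (rule csubspace_eqI_cinner[OF csubspace_N S_in_N csubspace_0[OF csubspace_N]])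
    (simp add: cinner_S_right csubspace_0 csubspace_N)

lemma bshift_zero: "bshift 0 = 0"
  using bshift_scaleC[of 0 0] by simp

lemma Phi_commutant: "A \<in> carrier_mat n n \<Longrightarrow> Phi A \<in> commutant_vn N S"
proof -
  assume A: "A \<in> carrier_mat n n"
  have "Phi A (S x) = S (Phi A x)" for x
    by (cases "x \<in> N") (simp_all add: S_Phi[OF A] S_outside Phi_outside Phi_zero S_zero)
  moreover have "Phi A (adj N S x) = adj N S (Phi A x)" for x
    by (cases "x \<in> N") (simp_all add: adj_S_eq bshift_Phi Phi_in_N Phi_outside Phi_zero bshift_zero)
  ultimately show ?thesis
    by (auto simp: commutant_vn_def Phi_bounded_ops fun_eq_iff)
qed

text \<open>The entry \<open>(a, b)\<close> is visible as the coefficient at \<open>(0, a)\<close>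
  of the image of \<open>g b 0\<close>.\<close>

lemma Phi_inj:
  assumes "A \<in> carrier_mat n n" "B \<in> carrier_mat n n" "Phi A = Phi B"
  shows "A = B"
proof -
  have entry: "coef (Phi C (g b 0)) (0, a) = C $$ (a, b)" if "a < n" "b < n" for C a b
  proof -
    have "coef (Phi C (g b 0)) (0, a) = (\<Sum>j<n. if j = b then C $$ (a, b) else 0)"
      using that unfolding coef_Phi'[OF g_in_N[OF that(2)] that(1)]
      by (intro sum.cong) (auto simp: coef_g')
    then show ?thesis using that by simp
  qed
  show ?thesis
    using assms entry[of _ _ A] entry[of _ _ B] by (intro eq_matI) auto
qed

text \<open>Linearity and the norm bound hold on \<open>N\<close> only, so continuity is obtained
  along sequences inside \<open>N\<close>, where the differences \<open>x k - y\<close> stay as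
  well.\<close>

lemma bounded_ops_tendsto:
  assumes T: "T \<in> bounded_ops N" and x: "\<And>k. x k \<in> N" "x \<longlonglongrightarrow> y"
  shows "(\<lambda>k. T (x k)) \<longlonglongrightarrow> T y"
proof -
  have y: "y \<in> N" using closed_sequentially[OF closed_N x] by blast
  obtain K where K: "\<forall>v\<in>N. norm (T v) \<le> K * norm v"
    using T unfolding bounded_ops_def by blast
  have add: "\<forall>u\<in>N. \<forall>v\<in>N. T (u + v) = T u + T v"
    using T by (simp add: bounded_ops_def)
  have diff: "T (x k) - T y = T (x k - y)" for k
  proof -
    have v: "x k - y \<in> N" using csubspace_diff[OF csubspace_N x(1) y] .
    have "T ((x k - y) + y) = T (x k - y) + T y" by (rule add[rule_format, OF v y])
    then show ?thesis by simp
  qed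
  have "(\<lambda>k. T (x k) - T y) \<longlonglongrightarrow> 0"
  proof (rule Lim_null_comparison)
    show "\<forall>\<^sub>F k in sequentially. norm (T (x k) - T y) \<le> K * norm (x k - y)"
      unfolding diff using K csubspace_diff[OF csubspace_N x(1) y] by (intro always_eventually) blast
    have "(\<lambda>k. K * norm (x k - y)) \<longlonglongrightarrow> K * norm (y - y)"
      by (intro tendsto_intros x)
    then show "(\<lambda>k. K * norm (x k - y)) \<longlonglongrightarrow> 0" by simp
  qed
  then show ?thesis by (rule LIM_zero_cancel)
qed

text \<open>An operator commuting with \<open>S\<close> and its adjoint preserves the kernel of the adjoint,
  spanned by the \<open>g j 0\<close>; its matrix there determines it, because \<open>S\<close> generates all \<open>g j l\<close>
  from these.\<close>

lemma commutant_eq_Phi: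
  assumes T: "T \<in> commutant_vn N S"
  shows "T = Phi (mat n n (\<lambda>(a, b). coef (T (g b 0)) (0, a)))"
proof -
  let ?A = "mat n n (\<lambda>(a, b). coef (T (g b 0)) (0, a))"
  have A: "?A \<in> carrier_mat n n" by simp
  have Tb: "T \<in> bounded_ops N" and TS: "T (S x) = S (T x)" and TB: "T (adj N S x) = adj N S (T x)" for x
    using T by (auto simp: commutant_vn_def fun_eq_iff)
  have T_out: "T x = 0" if "x \<notin> N" for x
    using Tb that by (simp add: bounded_ops_def)
  have T_in: "T x \<in> N" for x
    using Tb csubspace_0[OF csubspace_N] by (cases "x \<in> N") (simp_all add: bounded_ops_def)
  have T_add: "T (x + y) = T x + T y" and T_scale: "T (c *\<^sub>C x) = c *\<^sub>C T x" if "x \<in> N" "y \<in> N" for x y c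
    using Tb that by (auto simp: bounded_ops_def)
  have P_add: "Phi ?A (x + y) = Phi ?A x + Phi ?A y" and P_scale: "Phi ?A (c *\<^sub>C x) = c *\<^sub>C Phi ?A x"
    if "x \<in> N" "y \<in> N" for x y c
    using Phi_bounded_ops[of ?A] that by (auto simp: bounded_ops_def)
  have T0: "T 0 = 0" using T_scale[of 0 0 0] csubspace_0[OF csubspace_N] by simp
  \<comment> \<open>Agreement of \<open>T\<close> with \<open>Phi ?A\<close> defines a closed
    subspace, so it is enough to check it on the total family \<open>g j l\<close>.\<close>
  define M where "M = {x \<in> N. T x = Phi ?A x}"
  have "M = N"
  proof (rule closed_subspace_eq_N)
    show "csubspace M"
      using csubspace_N by (intro csubspaceI)
        (auto simp: M_def csubspace_0 csubspace_add csubspace_scale T0 Phi_zero T_add T_scale P_add P_scale)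
    show "closed M"
      unfolding closed_sequential_limits
    proof (intro allI impI; elim conjE)
      fix x l assume x: "\<forall>k. x k \<in> M" and lim: "x \<longlonglongrightarrow> l"
      then have xN: "\<And>k. x k \<in> N" and eq: "\<And>k. T (x k) = Phi ?A (x k)" by (auto simp: M_def)
      have "(\<lambda>k. T (x k)) \<longlonglongrightarrow> T l" by (rule bounded_ops_tendsto[OF Tb xN lim])
      moreover have "(\<lambda>k. T (x k)) \<longlonglongrightarrow> Phi ?A l"
        unfolding eq by (rule bounded_ops_tendsto[OF Phi_bounded_ops xN lim])
      ultimately have "T l = Phi ?A l" by (rule LIMSEQ_unique)
      moreover have "l \<in> N" using closed_sequentially[OF closed_N xN lim] .
      ultimately show "l \<in> M" by (simp add: M_def)
    qed
    show "M \<subseteq> N" by (auto simp: M_def)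
    fix j l assume j: "j < n"
    have "T (g j l) = Phi ?A (g j l)"
    proof (induction l)
      case 0
      have "bshift (T (g j 0)) = T (bshift (g j 0))"
        using TB[of "g j 0"] T_in g_in_N[OF j] by (simp add: adj_S_eq)
      then have "bshift (T (g j 0)) = 0" by (simp add: bshift_g(2)[OF j] T0)
      then have Suc0: "coef (T (g j 0)) (Suc l, a) = 0" for l a
        using coef_bshift[of "T (g j 0)" l a] by (simp add: coef_zero)
      show ?case
      proof (rule N_eqI)
        fix l a assume a: "a < n"
        have "coef (Phi ?A (g j 0)) (l, a) = (\<Sum>b<n. if b = j then (if l = 0 then coef (T (g j 0)) (0, a) else 0) else 0)"
          unfolding coef_Phi'[OF g_in_N[OF j] a] using a j by (intro sum.cong) (auto simp: coef_g')
        then show "coef (T (g j 0)) (l, a) = coef (Phi ?A (g j 0)) (l, a)"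
          using j Suc0 by (cases l) simp_all
      qed (use T_in Phi_in_N in auto)
    next
      case (Suc l)
      \<comment> \<open>Both operators commute with \<open>S\<close>, so agreement passes from
        \<open>g j l\<close> to \<open>g j (Suc l)\<close>.\<close>
      have "T (g j (Suc l)) = (of_nat (d (Suc l)) / of_nat (d l)) *\<^sub>C S (T (g j l))"
        unfolding g_Suc[OF j] T_scale[OF S_in_N S_in_N] TS ..
      also have "\<dots> = (of_nat (d (Suc l)) / of_nat (d l)) *\<^sub>C Phi ?A (S (g j l))"
        unfolding Suc S_Phi[OF A g_in_N[OF j]] ..
      also have "\<dots> = Phi ?A (g j (Suc l))"
        unfolding g_Suc[OF j] P_scale[OF S_in_N S_in_N] ..
      finally show ?case .
    qed
    then show "g j l \<in> M" by (simp add: M_def g_in_N j)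
  qed
  then show ?thesis
    using T_out by (auto simp: M_def fun_eq_iff Phi_outside)
qed

lemma star_isomorphic_N: "star_isomorphic_matrices N (commutant_vn N S) n"
  unfolding star_isomorphic_matrices_def
proof (intro exI[of _ Phi] conjI ballI allI)
  show "bij_betw Phi (carrier_mat n n) (commutant_vn N S)"
  proof (rule bij_betw_imageI)
    show "inj_on Phi (carrier_mat n n)" using Phi_inj by (auto intro: inj_onI)
    show "Phi ` carrier_mat n n = commutant_vn N S"
    proof
      show "commutant_vn N S \<subseteq> Phi ` carrier_mat n n"
      proof
        fix T assume "T \<in> commutant_vn N S"
        then have "T = Phi (mat n n (\<lambda>(a, b). coef (T (g b 0)) (0, a)))" by (rule commutant_eq_Phi)
        then show "T \<in> Phi ` carrier_mat n n" by (rule image_eqI) simp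
      qed
    qed (use Phi_commutant in auto)
  qed
  fix A B :: "complex mat" and c :: complex assume A: "A \<in> carrier_mat n n"
  show "Phi (c \<cdot>\<^sub>m A) = (\<lambda>x. c *\<^sub>C Phi A x)"
  proof
    fix x show "Phi (c \<cdot>\<^sub>m A) x = c *\<^sub>C Phi A x"
    proof (cases "x \<in> N")
      case True
      then show ?thesis
        using A by (intro N_eqI) (simp_all add: Phi_in_N csubspace_scale csubspace_N coef_Phi' coef_scaleC sum_distrib_left mult_ac)
    qed (simp add: Phi_outside)
  qed
  show "Phi (mat_adjoint A) = adj N (Phi A)" by (rule Phi_adj[OF A])
  assume B: "B \<in> carrier_mat n n"
  show "Phi (A + B) = (\<lambda>x. Phi A x + Phi B x)"
  proof
    fix x show "Phi (A + B) x = Phi A x + Phi B x"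
    proof (cases "x \<in> N")
      case True
      then show ?thesis
        using A B by (intro N_eqI) (simp_all add: Phi_in_N csubspace_add csubspace_N coef_Phi' coef_add distrib_right sum.distrib)
    qed (simp add: Phi_outside)
  qed
  show "Phi (A * B) = Phi A \<circ> Phi B"
  proof
    fix x show "Phi (A * B) x = (Phi A \<circ> Phi B) x"
    proof (cases "x \<in> N")
      case True
      show ?thesis
      proof (rule N_eqI)
        fix l j assume j: "j < n"
        have "coef (Phi (A * B) x) (l, j) = (\<Sum>b<n. \<Sum>k<n. A $$ (j, k) * B $$ (k, b) * coef x (l, b))"
          using A B j True
          by (simp add: coef_Phi' scalar_prod_def sum_distrib_right atLeast0LessThan)
        also have "\<dots> = (\<Sum>k<n. A $$ (j, k) * (\<Sum>b<n. B $$ (k, b) * coef x (l, b)))"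
          by (subst sum.swap) (simp add: sum_distrib_left mult.assoc)
        also have "\<dots> = coef ((Phi A \<circ> Phi B) x) (l, j)"
          using True j by (simp add: coef_Phi' Phi_in_N)
        finally show "coef (Phi (A * B) x) (l, j) = coef ((Phi A \<circ> Phi B) x) (l, j)" .
      qed (simp_all add: Phi_in_N)
    qed (simp add: Phi_outside Phi_zero)
  qed
qed

end

theorem theorem5p6:
  fixes m n :: nat
  assumes "0 < m" and "0 < n"
  shows "cowen_douglas n \<D> (quotient_N m n) (S_z_adj m n)
    \<and> antiholomorphic_frame n \<D> (bundle_S_z_adj m n) (e_vec m n)
    \<and> orthogonal_family n \<D> (e_vec m n)
    \<and> (\<forall>j<n. minimal_reducing_subspace (quotient_N m n) (S_z m n) (H_space m n j))
    \<and> (\<forall>i<n. \<forall>j<n. i \<noteq> j \<longrightarrow>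
         (\<forall>x\<in>H_space m n i. \<forall>y\<in>H_space m n j. cinner x y = 0))
    \<and> quotient_N m n = {\<Sum>j<n. x j | x. \<forall>j<n. x j \<in> H_space m n j}
    \<and> block_diagonalization \<D> (bundle_S_z_adj m n) [1] [n]
    \<and> star_isomorphic_matrices (quotient_N m n)
         (commutant_vn (quotient_N m n) (S_z m n)) n"
proof -
  interpret monomial_quotient m n by standard (fact assms)+
  have "orthogonal_family n \<D> e"
    unfolding orthogonal_family_def using orthogonal_e by blast
  moreover have "\<forall>j<n. minimal_reducing_subspace N S (H_space m n j)"
    by (simp add: H_space_eq minimal_comp)
  moreover have "\<forall>i<n. \<forall>j<n. i \<noteq> j \<longrightarrow> (\<forall>x\<in>H_space m n i. \<forall>y\<in>H_space m n j. cinner x y = 0)"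
    using comp_orthogonal by (simp add: H_space_eq)
  moreover have "N = {\<Sum>j<n. x j | x. \<forall>j<n. x j \<in> H_space m n j}"
    using N_eq_sum_comp by (simp add: H_space_eq cong: conj_cong)
  ultimately show ?thesis
    using cowen_douglas_N frame_e block_diagonalization_N star_isomorphic_N by blast
qed

end
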